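(* The spaces $\wedge$ and $\bigcirc$ are not isomorphic to their dual spaces; that is, $\wedge$ is not isomorphic to $\wedge^*$ and $\bigcirc$ is not isomorphic to $\bigcirc^*$.
   Context: All spaces are complex. For the couple $(X_0,X_1)=(\ell_\infty,\ell_1)$ put $\Sigma=\ell_\infty+\ell_1$. The Calderón space $\mathcal C$ of the couple is the Banach space of bounded continuous functions $F:\{z\in\mathbb C:0\le \mathrm{Re}\,z\le 1\}\to\Sigma$, analytic on the open strip, such that for $j=0,1$ the map $t\mapsto F(j+it)$ is continuous from $\mathbb R$ into $X_j$ and tends to $0$ as $|t|\to\infty$, with norm $\|F\|=\max_{j=0,1}\sup_{t}\|F(j+it)\|_{X_j}$. For $k=0,1,2$ let $\Delta_k:\mathcal C\to\Sigma$, $\Delta_k(F)=F^{(k)}(1/2)/k!$, and for distinct indices $\langle\Delta_a,\Delta_b\rangle(F)=(\Delta_aF,\Delta_bF)$. For a closed subspace $K\subset\mathcal C$ and one of these maps $T$, the space $T(K)$ carries the quotient norm $\|x\|=\inf\{\|F\|:F\in K,\ TF=x\}$. Put $\wedge=\langle\Delta_2,\Delta_0\rangle(\ker\Delta_1)$ and $\bigcirc=\langle\Delta_0,\Delta_1\rangle(\ker\Delta_2)$. *)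

theory Defs
  imports "HOL-Analysis.Analysis" "HOL-Library.Function_Algebras"
begin

class scaleC =
  fixes scaleC :: "complex \<Rightarrow> 'a \<Rightarrow> 'a"  (infixr "*\<^sub>C" 75)

class complex_vector = scaleC + ab_group_add +
  assumes scaleC_add_right: "a *\<^sub>C (x + y) = a *\<^sub>C x + a *\<^sub>C y"
    and scaleC_add_left: "(a + b) *\<^sub>C x = a *\<^sub>C x + b *\<^sub>C x"
    and scaleC_scaleC: "a *\<^sub>C (b *\<^sub>C x) = (a * b) *\<^sub>C x"
    and scaleC_one: "1 *\<^sub>C x = x"

instantiation complex :: complex_vector
begin
definition scaleC_complex :: "complex \<Rightarrow> complex \<Rightarrow> complex"
  where "scaleC_complex a x = a * x"
instance
  by standard (simp_all add: scaleC_complex_def algebra_simps)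
end

instantiation "fun" :: (type, complex_vector) complex_vector
begin
definition scaleC_fun :: "complex \<Rightarrow> ('a \<Rightarrow> 'b) \<Rightarrow> 'a \<Rightarrow> 'b"
  where "scaleC_fun a f = (\<lambda>i. a *\<^sub>C f i)"
instance
  by standard
    (simp_all add: scaleC_fun_def fun_eq_iff scaleC_add_right scaleC_add_left scaleC_scaleC scaleC_one)
end

instantiation prod :: (complex_vector, complex_vector) complex_vector
begin
definition scaleC_prod :: "complex \<Rightarrow> 'a \<times> 'b \<Rightarrow> 'a \<times> 'b"
  where "scaleC_prod a p = (a *\<^sub>C fst p, a *\<^sub>C snd p)"
instance
  by standard
    (simp_all add: scaleC_prod_def prod_eq_iff scaleC_add_right scaleC_add_left scaleC_scaleC scaleC_one)
end

text \<open>
  A complex normed space is given by a linear subspace of an ambient complex vector space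
  together with a norm, whose values outside that subspace are irrelevant.
\<close>

record 'a nspace =
  nset :: "'a set"
  nnorm :: "'a \<Rightarrow> real"

definition bounded_clinear_on ::
  "('a::complex_vector) nspace \<Rightarrow> ('b::complex_vector) nspace \<Rightarrow> ('a \<Rightarrow> 'b) \<Rightarrow> bool"
  where "bounded_clinear_on X Y T \<longleftrightarrow>
    (\<forall>x\<in>nset X. T x \<in> nset Y) \<and>
    (\<forall>x\<in>nset X. \<forall>y\<in>nset X. T (x + y) = T x + T y) \<and>
    (\<forall>a. \<forall>x\<in>nset X. T (a *\<^sub>C x) = a *\<^sub>C T x) \<and>
    (\<exists>B. \<forall>x\<in>nset X. nnorm Y (T x) \<le> B * nnorm X x)"

definition isomorphic_nspace ::
  "('a::complex_vector) nspace \<Rightarrow> ('b::complex_vector) nspace \<Rightarrow> bool"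
  where "isomorphic_nspace X Y \<longleftrightarrow>
    (\<exists>T S. bounded_clinear_on X Y T \<and> bounded_clinear_on Y X S \<and>
      (\<forall>x\<in>nset X. S (T x) = x) \<and> (\<forall>y\<in>nset Y. T (S y) = y))"

definition complex_nspace :: "complex nspace"
  where "complex_nspace = \<lparr>nset = UNIV, nnorm = cmod\<rparr>"

text \<open>
  A functional is only meaningful on the space itself; requiring it to vanish elsewhere makes
  each functional have exactly one representative and keeps the dual closed under the pointwise
  operations.
\<close>

definition dual_nspace :: "('a::complex_vector) nspace \<Rightarrow> ('a \<Rightarrow> complex) nspace"
  where "dual_nspace X =
    \<lparr>nset = {f. bounded_clinear_on X complex_nspace f \<and> (\<forall>x. x \<notin> nset X \<longrightarrow> f x = 0)},
     nnorm = (\<lambda>f. SUP x\<in>{x\<in>nset X. nnorm X x \<le> 1}. cmod (f x))\<rparr>"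

definition continuous_into ::
  "('a::complex_vector) nspace \<Rightarrow> ('t::topological_space) set \<Rightarrow> ('t \<Rightarrow> 'a) \<Rightarrow> bool"
  where "continuous_into X S F \<longleftrightarrow>
    (\<forall>z\<in>S. F z \<in> nset X \<and> ((\<lambda>w. nnorm X (F w - F z)) \<longlongrightarrow> 0) (at z within S))"

definition has_cderiv ::
  "('a::complex_vector) nspace \<Rightarrow> (complex \<Rightarrow> 'a) \<Rightarrow> 'a \<Rightarrow> complex \<Rightarrow> bool"
  where "has_cderiv X F D z \<longleftrightarrow>
    D \<in> nset X \<and> ((\<lambda>w. nnorm X (inverse (w - z) *\<^sub>C (F w - F z) - D)) \<longlongrightarrow> 0) (at z)"

definition cderiv :: "('a::complex_vector) nspace \<Rightarrow> (complex \<Rightarrow> 'a) \<Rightarrow> complex \<Rightarrow> 'a"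
  where "cderiv X F z = (THE D. has_cderiv X F D z)"

definition analytic_into ::
  "('a::complex_vector) nspace \<Rightarrow> complex set \<Rightarrow> (complex \<Rightarrow> 'a) \<Rightarrow> bool"
  where "analytic_into X S F \<longleftrightarrow> (\<forall>z\<in>S. F z \<in> nset X \<and> (\<exists>D. has_cderiv X F D z))"

definition sum_nspace :: "('a::complex_vector) nspace \<Rightarrow> 'a nspace \<Rightarrow> 'a nspace"
  where "sum_nspace X0 X1 =
    \<lparr>nset = {x0 + x1 | x0 x1. x0 \<in> nset X0 \<and> x1 \<in> nset X1},
     nnorm = (\<lambda>x. Inf {nnorm X0 x0 + nnorm X1 x1 | x0 x1.
                        x0 \<in> nset X0 \<and> x1 \<in> nset X1 \<and> x = x0 + x1})\<rparr>"

definition closed_strip :: "complex set"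
  where "closed_strip = {z. 0 \<le> Re z \<and> Re z \<le> 1}"

definition open_strip :: "complex set"
  where "open_strip = {z. 0 < Re z \<and> Re z < 1}"

definition admissible_edge ::
  "('a::complex_vector) nspace \<Rightarrow> real \<Rightarrow> (complex \<Rightarrow> 'a) \<Rightarrow> bool"
  where "admissible_edge X j F \<longleftrightarrow>
    continuous_into X UNIV (\<lambda>t. F (Complex j t)) \<and>
    ((\<lambda>t. nnorm X (F (Complex j t))) \<longlongrightarrow> 0) at_infinity"

text \<open>
  The elements are functions on the closed strip; as total functions they are extended by 0.
\<close>

definition calderon ::
  "('a::complex_vector) nspace \<Rightarrow> 'a nspace \<Rightarrow> (complex \<Rightarrow> 'a) nspace"
  where "calderon X0 X1 =
    \<lparr>nset = {F. (\<forall>z. z \<notin> closed_strip \<longrightarrow> F z = 0) \<and>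
                continuous_into (sum_nspace X0 X1) closed_strip F \<and>
                (\<exists>B. \<forall>z\<in>closed_strip. nnorm (sum_nspace X0 X1) (F z) \<le> B) \<and>
                analytic_into (sum_nspace X0 X1) open_strip F \<and>
                admissible_edge X0 0 F \<and> admissible_edge X1 1 F},
     nnorm = (\<lambda>F. max (SUP t. nnorm X0 (F (Complex 0 t))) (SUP t. nnorm X1 (F (Complex 1 t))))\<rparr>"

definition quotient_nspace ::
  "'a nspace \<Rightarrow> 'a set \<Rightarrow> ('a \<Rightarrow> 'b) \<Rightarrow> 'b nspace"
  where "quotient_nspace X K T =
    \<lparr>nset = T ` K, nnorm = (\<lambda>x. Inf {nnorm X F | F. F \<in> K \<and> T F = x})\<rparr>"

type_synonym cseq = "nat \<Rightarrow> complex"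

definition l_inf :: "cseq nspace"
  where "l_inf = \<lparr>nset = {x. bounded (range x)}, nnorm = (\<lambda>x. SUP n. cmod (x n))\<rparr>"

definition l_one :: "cseq nspace"
  where "l_one = \<lparr>nset = {x. summable (\<lambda>n. cmod (x n))}, nnorm = (\<lambda>x. \<Sum>n. cmod (x n))\<rparr>"

abbreviation Sigma_space :: "cseq nspace"
  where "Sigma_space \<equiv> sum_nspace l_inf l_one"

abbreviation C_space :: "(complex \<Rightarrow> cseq) nspace"
  where "C_space \<equiv> calderon l_inf l_one"

definition Delta :: "nat \<Rightarrow> (complex \<Rightarrow> cseq) \<Rightarrow> cseq"
  where "Delta k F = inverse (fact k) *\<^sub>C ((cderiv Sigma_space ^^ k) F) (1/2)"

definition ker_Delta :: "nat \<Rightarrow> (complex \<Rightarrow> cseq) set"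
  where "ker_Delta k = {F \<in> nset C_space. Delta k F = 0}"

definition Delta_pair :: "nat \<Rightarrow> nat \<Rightarrow> (complex \<Rightarrow> cseq) \<Rightarrow> cseq \<times> cseq"
  where "Delta_pair a b F = (Delta a F, Delta b F)"

definition wedge_space :: "(cseq \<times> cseq) nspace"
  where "wedge_space = quotient_nspace C_space (ker_Delta 1) (Delta_pair 2 0)"

definition circ_space :: "(cseq \<times> cseq) nspace"
  where "circ_space = quotient_nspace C_space (ker_Delta 2) (Delta_pair 0 1)"

end

theory Submission
  imports Defs "HOL-Complex_Analysis.Complex_Analysis"
begin

text \<open>
  Call a sequence \<open>u\<close> small if the norms of the sign sums of \<open>n\<close> of its terms are \<open>o(sqrt n)\<close>.
  On both spaces the functionals reading off the coordinates of \<open>F (1/2)\<close> are bounded below in norm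
  and small in the dual space: if \<open>F' (1/2)\<close> or \<open>F'' (1/2)\<close> vanishes, a three-lines argument
  bounds a sign sum of \<open>n\<close> coordinates of \<open>F (1/2)\<close> by a multiple of \<open>sqrt n / ln n\<close>.
  An isomorphism with the dual would therefore produce a small sequence bounded below in the space itself.

  No such sequence exists. Up to equivalence both spaces are extensions built from \<open>l\<^sup>2\<close> and the Orlicz
  space of \<open>t\<^sup>2 (ln t)\<^sup>2\<close>. The component in the quotient of a small sequence is small in \<open>l\<^sup>2\<close>, and
  testing against disjoint blocks shows that it has a subsequence tending to 0 in the Orlicz space. Subtracting
  liftings of that subsequence moves everything into the kernel of the extension, where the same
  argument applies again and forces the norms to 0.
\<close>

section \<open>Sign sums and the logarithmic modular\<close>


text \<open>The asymmetry exploited is that of \<open>l2\<close> against the Orlicz space and its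
  dual. Taking \<open>F (1/2)\<close> maps either space onto the Orlicz space, whose norm is
  stronger than that of \<open>l2\<close>. Dually the coordinate functionals behave like unit
  vectors of the dual Orlicz space, whose norm is weaker, and this gains the logarithm. In
  \<open>l2\<close>, averaging over signs gives \<open>n\<close> vectors bounded below a sign sum of
  order at least \<open>sqrt n\<close>, so \<open>o(sqrt n)\<close> is the dividing line. The kernel
  of the extension is \<open>l2\<close> for the first space and the Orlicz space for the second;
  only there do the two proofs differ. Norms are never identified exactly. Lower bounds come from
  pairing \<open>F\<close> with explicit functions in the Calderon space of the dual couple, upper
  bounds from explicit functions of the same shape \<open>gexp\<close>. Such a function has
  coefficients of size \<open>v\<close> with \<open>v\<close> in the unit ball of \<open>l2\<close>,
  and making a prescribed Taylor coefficient vanish costs a factor \<open>ln v\<close>. Hence a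
  value \<open>x\<close> is reached if \<open>x * ln v\<close> is still of size \<open>v\<close>,
  that is, with \<open>v\<close> of order \<open>x * ln x\<close>: this is the origin of
  \<open>orl\<close>.\<close>

lemma sum_fun_apply: "(\<Sum>i\<in>A. f i) k = (\<Sum>i\<in>A. f i k)"
  for f :: "'a \<Rightarrow> 'b \<Rightarrow> 'c::comm_monoid_add"
  by (induction A rule: infinite_finite_induct) auto

text \<open>\<open>P s r\<close> stands for a bound of \<open>s\<close> by \<open>r\<close>. A
  relation instead of a norm lets the same notion cover partial sums, families of test inequalities
  and quotient norms given by representatives.\<close>

definition small_sign_sums :: "('a::complex_vector \<Rightarrow> real \<Rightarrow> bool) \<Rightarrow> (nat \<Rightarrow> 'a) \<Rightarrow> bool"
  where "small_sign_sums P u \<longleftrightarrow>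
    (\<forall>d>0. \<exists>n0. \<forall>A e. finite A \<longrightarrow> n0 \<le> card A \<longrightarrow> (\<forall>i. e i \<in> {1, -1}) \<longrightarrow>
       P (\<Sum>i\<in>A. e i *\<^sub>C u i) (d * sqrt (card A)))"

definition l2_le :: "cseq \<Rightarrow> real \<Rightarrow> bool"
  where "l2_le s r \<longleftrightarrow> (\<forall>S. finite S \<longrightarrow> (\<Sum>k\<in>S. (cmod (s k))\<^sup>2) \<le> r\<^sup>2)"

text \<open>
  The Orlicz function is \<open>(orl t)\<^sup>2 = 4 t\<^sup>2 (ln t)\<^sup>2\<close>; it is only used for \<open>0 \<le> t \<le> 1/e\<close>, and
  \<open>ln 0 = 0\<close> makes \<open>orl 0 = 0\<close>. The factor \<open>(ln (orl \<bar>y\<bar>))\<^sup>2\<close> in \<open>test_le\<close> is comparable to \<open>(ln \<bar>y\<bar>)\<^sup>2\<close>.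
\<close>

definition orl :: "real \<Rightarrow> real"
  where "orl t = 2 * t * (- ln t)"

text \<open>Up to constants and for small arguments, \<open>t * (ln t)\<^sup>2\<close> is the
  derivative of the Orlicz function, so the sequences tested against are the usual norming
  functionals of Orlicz duality. The weight is also what the Leibniz rule will produce.\<close>

definition test_le :: "cseq \<Rightarrow> real \<Rightarrow> bool"
  where "test_le s r \<longleftrightarrow> (\<forall>S y. finite S \<longrightarrow> (\<forall>k\<in>S. cmod (y k) \<le> exp (-1)) \<longrightarrow>
     (\<Sum>k\<in>S. (orl (cmod (y k)))\<^sup>2) \<le> 1 \<longrightarrow>
     cmod (\<Sum>k\<in>S. s k * cnj (y k) * (ln (orl (cmod (y k))))\<^sup>2) \<le> r)"

text \<open>A modular ball; the cap \<open>exp (-1)\<close> confines the moduli to the range where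
  \<open>orl\<close> is increasing and \<open>- ln t\<close> is at least 1.\<close>

definition orlicz_unit :: "cseq \<Rightarrow> bool"
  where "orlicz_unit x \<longleftrightarrow> (\<forall>k. cmod (x k) \<le> exp (-1)) \<and>
     (\<forall>S. finite S \<longrightarrow> (\<Sum>k\<in>S. (orl (cmod (x k)))\<^sup>2) \<le> 1)"

text \<open>Replaces averaging over signs, under which off-diagonal terms vanish: signs are picked
  one at a time, each making the real part of the new cross terms \<open>q\<close> nonnegative,
  while \<open>s * s = 1\<close> leaves the diagonal untouched.\<close>

lemma sign_choice:
  fixes c :: "nat \<Rightarrow> nat \<Rightarrow> complex"
  assumes "finite A"
  shows "\<exists>e. (\<forall>i. e i \<in> {1, -1}) \<and>
    (\<Sum>i\<in>A. Re (c i i)) \<le> Re (\<Sum>i\<in>A. \<Sum>j\<in>A. e i * e j * c i j)"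
  using assms
proof (induction A)
  case empty
  then show ?case by (intro exI[of _ "\<lambda>_. 1"]) simp
next
  case (insert m A)
  then obtain e where e: "\<forall>i. e i \<in> {1, -1}"
    "(\<Sum>i\<in>A. Re (c i i)) \<le> Re (\<Sum>i\<in>A. \<Sum>j\<in>A. e i * e j * c i j)" by blast
  define q where "q = (\<Sum>j\<in>A. e j * c m j) + (\<Sum>i\<in>A. e i * c i m)"
  define s :: complex where "s = (if Re q \<ge> 0 then 1 else -1)"
  have s: "s \<in> {1,-1}" "s * s = 1" "Re (s * q) \<ge> 0" by (auto simp: s_def)
  let ?e = "e(m := s)"
  have eq: "(\<Sum>i\<in>insert m A. \<Sum>j\<in>insert m A. ?e i * ?e j * c i j) =
     c m m + s * q + (\<Sum>i\<in>A. \<Sum>j\<in>A. e i * e j * c i j)"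
  proof -
    have ne: "i \<in> A \<Longrightarrow> i \<noteq> m" for i using insert by auto
    have 1: "(\<Sum>j\<in>insert m A. ?e i * ?e j * c i j) = e i * s * c i m + (\<Sum>j\<in>A. e i * e j * c i j)"
      if "i \<in> A" for i
      using insert that by (auto simp: ne intro!: sum.cong)
    have 2: "(\<Sum>j\<in>insert m A. ?e m * ?e j * c m j) = c m m + (\<Sum>j\<in>A. s * e j * c m j)"
      using insert s by (auto simp: ne intro!: sum.cong)
    have "(\<Sum>i\<in>insert m A. \<Sum>j\<in>insert m A. ?e i * ?e j * c i j) =
      (\<Sum>j\<in>insert m A. ?e m * ?e j * c m j) + (\<Sum>i\<in>A. \<Sum>j\<in>insert m A. ?e i * ?e j * c i j)"
      using insert by (subst sum.insert) auto
    also have "\<dots> = c m m + (\<Sum>j\<in>A. s * e j * c m j) + (\<Sum>i\<in>A. e i * s * c i m + (\<Sum>j\<in>A. e i * e j * c i j))"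
      using 1 2 by simp
    also have "\<dots> = c m m + s * q + (\<Sum>i\<in>A. \<Sum>j\<in>A. e i * e j * c i j)"
      unfolding q_def by (simp add: sum.distrib sum_distrib_left algebra_simps)
    finally show ?thesis .
  qed
  have pm: "\<forall>i. ?e i \<in> {1,-1}" using e s by auto
  have "(\<Sum>i\<in>insert m A. Re (c i i)) \<le> Re (c m m + s * q + (\<Sum>i\<in>A. \<Sum>j\<in>A. e i * e j * c i j))"
    using insert(1,2) e(2) s(3) by (subst sum.insert) auto
  with pm show ?case unfolding eq[symmetric] by (intro exI[of _ ?e] conjI)
qed

lemma ln_le_div_exp_1: "ln x \<le> x / exp 1" if "x > 0" for x :: real
  using ln_le_minus_one[of "x / exp 1"] that by (simp add: ln_div)

lemma exp_1_ge: "exp (1::real) \<ge> 5/2"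
  using exp_lower_Taylor_quadratic[of 1] by simp

context
  fixes t :: real assumes t: "0 < t" "t \<le> exp (-1)"
begin

lemma one_le_neg_ln: "- ln t \<ge> 1"
  using t ln_le_cancel_iff[of t "exp (-1)"] by simp

lemma orl_pos: "orl t > 0" and orl_ge: "orl t \<ge> 2 * t" 
proof -
  have "t * 1 \<le> t * (- ln t)" using t one_le_neg_ln by (intro mult_left_mono) auto
  then show "orl t > 0" "orl t \<ge> 2 * t" using t by (auto simp: orl_def)
qed

text \<open>A crude bound from \<open>ln x \<le> x / e\<close> at \<open>x = 1 / sqrt t\<close>. It
  makes the modular terms uniformly small as soon as the coordinates are.\<close>

lemma orl_le_sqrt: "(orl t)\<^sup>2 \<le> 4 * t"
proof -
  have "ln (1 / sqrt t) \<le> 1 / sqrt t / exp 1" using t by (intro ln_le_div_exp_1) auto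
  then have "- ln t / 2 \<le> 1 / sqrt t / exp 1" using t by (simp add: ln_div ln_sqrt)
  also have "\<dots> \<le> 1 / sqrt t / 2" using exp_1_ge t by (intro divide_left_mono) auto
  finally have "- ln t \<le> 1 / sqrt t" by simp
  then have "(- ln t)\<^sup>2 \<le> (1 / sqrt t)\<^sup>2" using one_le_neg_ln by (intro power_mono) auto
  then have "t * (- ln t)\<^sup>2 \<le> 1" using t by (simp add: field_simps power_divide)
  then have "4 * t * (t * (- ln t)\<^sup>2) \<le> 4 * t * 1" using t by (intro mult_left_mono) auto
  then show ?thesis by (simp add: orl_def power2_eq_square algebra_simps)
qed

text \<open>Passing from \<open>t\<close> to \<open>orl t\<close> changes the logarithm by
  \<open>ln 2 + ln (- ln t)\<close>, which is at most 4/5 of \<open>- ln t\<close>; hence the factor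
  5.\<close>

lemma ln_orl: "- ln (orl t) \<ge> - ln t / 5" "- ln (orl t) \<le> - ln t" 
proof -
  have l: "ln (orl t) = ln 2 + ln t + ln (- ln t)"
    unfolding orl_def using t one_le_neg_ln by (subst ln_mult; (subst ln_mult)?) auto
  have "ln (2 * (- ln t)) \<le> 2 * (- ln t) / exp 1" using one_le_neg_ln by (intro ln_le_div_exp_1) auto
  also have "\<dots> \<le> 2 * (- ln t) / (5/2)" using one_le_neg_ln exp_1_ge by (intro divide_left_mono) auto
  finally have "ln 2 + ln (- ln t) \<le> 4/5 * (- ln t)"
    using one_le_neg_ln by (subst (asm) ln_mult) auto
  then show "- ln (orl t) \<ge> - ln t / 5" using l by simp
  show "- ln (orl t) \<le> - ln t" using l one_le_neg_ln ln_ge_zero[of "- ln t"] ln_ge_zero[of 2] by linarith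
qed

end

lemma orl_0 [simp]: "orl 0 = 0" by (simp add: orl_def)

lemma orl_sq_le: "(orl t)\<^sup>2 \<le> 4 * t" if "0 \<le> t" "t \<le> exp (-1)"
  using orl_le_sqrt[of t] that by (cases "t = 0") auto

lemma small_sign_sumsD:
  assumes "small_sign_sums P u" "d > 0"
  shows "\<exists>n0. \<forall>A e. finite A \<longrightarrow> n0 \<le> card A \<longrightarrow> (\<forall>i. e i \<in> {1, -1}) \<longrightarrow>
       P (\<Sum>i\<in>A. e i *\<^sub>C u i) (d * sqrt (card A))"
  using assms unfolding small_sign_sums_def by (elim allE[of _ d]) simp

lemma scaleC_complex: "a *\<^sub>C (b::complex) = a * b"
  by (simp add: scaleC_complex_def)
lemma scaleC_apply: "(a *\<^sub>C f) k = a *\<^sub>C f k"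
  by (simp add: scaleC_fun_def)

lemma sign_sum_apply: "(\<Sum>i\<in>A. e i *\<^sub>C (x i :: cseq)) k = (\<Sum>i\<in>A. e i * x i k)"
  by (simp add: sum_fun_apply scaleC_apply scaleC_complex)

text \<open>\<open>sign_choice\<close> for the Gram matrix: some sign sum has squared norm at least
  the sum of the squared norms, so \<open>Suc n0\<close> terms of norm above \<open>th\<close> would
  contradict smallness.\<close>

lemma l2_small_tendsto_0:
  assumes "small_sign_sums l2_le x" "th > 0"
  shows "\<exists>i0. \<forall>i\<ge>i0. l2_le (x i) th"
proof -
  obtain n0 where n0: "\<forall>A e. finite A \<longrightarrow> n0 \<le> card A \<longrightarrow> (\<forall>i. e i \<in> {1,-1}) \<longrightarrow>
      l2_le (\<Sum>i\<in>A. e i *\<^sub>C x i) (th * sqrt (card A))"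
    using small_sign_sumsD[OF assms] ..
  have "finite {i. \<not> l2_le (x i) th}"
  proof (rule ccontr)
    assume "infinite {i. \<not> l2_le (x i) th}"
    then obtain A where A: "finite A" "card A = Suc n0" "A \<subseteq> {i. \<not> l2_le (x i) th}"
      using infinite_arbitrarily_large by metis
    then have "\<forall>i\<in>A. \<exists>S. finite S \<and> th\<^sup>2 < (\<Sum>k\<in>S. (cmod (x i k))\<^sup>2)"
      unfolding l2_le_def by force
    then obtain S where S: "\<And>i. i \<in> A \<Longrightarrow> finite (S i)" "\<And>i. i \<in> A \<Longrightarrow> th\<^sup>2 < (\<Sum>k\<in>S i. (cmod (x i k))\<^sup>2)"
      by metis
    \<comment> \<open>One finite window contains all the partial sums chosen, which keeps the inner
      products finite.\<close>
    define U where "U = (\<Union>i\<in>A. S i)"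
    have U: "finite U" using A S by (auto simp: U_def)
    define c where "c = (\<lambda>i j. \<Sum>k\<in>U. x i k * cnj (x j k))"
    obtain e where e: "\<And>i. e i \<in> {1,-1}" "(\<Sum>i\<in>A. Re (c i i)) \<le> Re (\<Sum>i\<in>A. \<Sum>j\<in>A. e i * e j * c i j)"
      using sign_choice[OF A(1), of c] by blast
    have ce: "cnj (e i) = e i" for i using e(1)[of i] by auto
    have "(\<Sum>i\<in>A. \<Sum>j\<in>A. e i * e j * c i j) = (\<Sum>i\<in>A. \<Sum>j\<in>A. \<Sum>k\<in>U. (e i * x i k) * cnj (e j * x j k))"
      unfolding c_def sum_distrib_left by (intro sum.cong) (auto simp: ce)
    also have "\<dots> = (\<Sum>i\<in>A. \<Sum>k\<in>U. \<Sum>j\<in>A. (e i * x i k) * cnj (e j * x j k))"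
      by (intro sum.cong sum.swap refl)
    also have "\<dots> = (\<Sum>k\<in>U. \<Sum>i\<in>A. \<Sum>j\<in>A. (e i * x i k) * cnj (e j * x j k))"
      by (rule sum.swap)
    also have "\<dots> = (\<Sum>k\<in>U. (\<Sum>i\<in>A. e i * x i k) * cnj (\<Sum>i\<in>A. e i * x i k))"
      by (intro sum.cong refl) (simp only: cnj_sum sum_product)
    also have "\<dots> = of_real (\<Sum>k\<in>U. (cmod (\<Sum>i\<in>A. e i * x i k))\<^sup>2)"
      by (simp only: complex_norm_square[symmetric] of_real_sum of_real_power)
    finally have "Re (\<Sum>i\<in>A. \<Sum>j\<in>A. e i * e j * c i j) = (\<Sum>k\<in>U. (cmod (\<Sum>i\<in>A. e i * x i k))\<^sup>2)"
      by simp
    also have "\<dots> \<le> (th * sqrt (card A))\<^sup>2"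
    proof -
      have "l2_le (\<Sum>i\<in>A. e i *\<^sub>C x i) (th * sqrt (card A))" using n0[rule_format, OF A(1), of e] A(2) e(1) by (auto simp del: of_nat_Suc)
      then show ?thesis using U unfolding l2_le_def by (simp add: sign_sum_apply)
    qed
    also have "\<dots> = th\<^sup>2 * card A" by (simp add: power_mult_distrib)
    also have "\<dots> = (\<Sum>i\<in>A. th\<^sup>2)" by simp
    also have "\<dots> < (\<Sum>i\<in>A. Re (c i i))"
    proof (rule sum_strict_mono)
      fix i assume i: "i \<in> A"
      have "c i i = of_real (\<Sum>k\<in>U. (cmod (x i k))\<^sup>2)"
        by (simp only: c_def complex_norm_square[symmetric] of_real_sum of_real_power)
      then have "Re (c i i) = (\<Sum>k\<in>U. (cmod (x i k))\<^sup>2)" by simp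
      also have "\<dots> \<ge> (\<Sum>k\<in>S i. (cmod (x i k))\<^sup>2)"
        using i U by (intro sum_mono2) (auto simp: U_def)
      finally show "th\<^sup>2 < Re (c i i)" using S i by force
    qed (use A in auto)
    finally show False using e by simp
  qed
  then obtain m where "\<And>i. i \<in> {i. \<not> l2_le (x i) th} \<Longrightarrow> i \<le> m"
    by (meson finite_nat_set_iff_bounded_le)
  then have "\<forall>i\<ge>Suc m. l2_le (x i) th" by (meson mem_Collect_eq not_less_eq_eq)
  then show ?thesis ..
qed

text \<open>Elements are dropped as long as the rest still sums to at least 1/2; when the rest first
  falls below 1/2, the last element adds at most 1/2 to it.\<close>

lemma subset_sum_between:
  fixes f :: "'a \<Rightarrow> real"
  assumes "finite S" "\<And>k. k \<in> S \<Longrightarrow> 0 \<le> f k" "\<And>k. k \<in> S \<Longrightarrow> f k \<le> 1/2" "sum f S \<ge> 1/2"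
  shows "\<exists>B\<subseteq>S. 1/2 \<le> sum f B \<and> sum f B \<le> 1"
  using assms
proof (induction S)
  case (insert a S)
  show ?case
  proof (cases "sum f S \<ge> 1/2")
    case True
    then show ?thesis using insert by blast
  next
    case False
    have "sum f (insert a S) \<le> 1" using False insert(1,2) insert(5)[of a] by simp
    then show ?thesis using insert by blast
  qed
qed auto


lemma l2_le_mono: "l2_le s r \<Longrightarrow> r \<le> r' \<Longrightarrow> 0 \<le> r \<Longrightarrow> l2_le s r'"
  unfolding l2_le_def using order_trans[OF _ power_mono[of r r' 2]] by blast

lemma test_le_mono: "test_le s r \<Longrightarrow> r \<le> r' \<Longrightarrow> test_le s r'"
  unfolding test_le_def using order_trans by blast

lemma l2_le_coord: "cmod (s k) \<le> r" if "l2_le s r" "r \<ge> 0"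
proof -
  have "(\<Sum>k\<in>{k}. (cmod (s k))\<^sup>2) \<le> r\<^sup>2" using that unfolding l2_le_def by (elim allE[of _ "{k}"]) simp
  then show ?thesis using that(2) power2_le_imp_le by simp
qed

text \<open>
  Since the coordinates of \<open>x i\<close> tend to 0 as \<open>i\<close> grows, the part of the modular of \<open>x i\<close> living on
  the blocks already chosen is eventually negligible.
\<close>

lemma disjoint_blocks:
  assumes x: "small_sign_sums l2_le x" and no: "\<forall>i\<ge>i0. \<not> orlicz_unit (x i)"
  shows "\<exists>I B. finite I \<and> card I = (m::nat) \<and> (\<forall>i\<in>I. i0 \<le> i \<and> finite (B i) \<and>
     1/2 \<le> (\<Sum>k\<in>B i. (orl (cmod (x i k)))\<^sup>2) \<and> (\<Sum>k\<in>B i. (orl (cmod (x i k)))\<^sup>2) \<le> 1)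
     \<and> (\<forall>i\<in>I. \<forall>j\<in>I. i \<noteq> j \<longrightarrow> B i \<inter> B j = {})"
proof (induction m)
  case 0
  show ?case by (intro exI[of _ "{}"]) simp
next
  case (Suc m)
  then obtain I B where IB: "finite I" "card I = m"
    "\<And>i. i \<in> I \<Longrightarrow> i0 \<le> i \<and> finite (B i) \<and>
     1/2 \<le> (\<Sum>k\<in>B i. (orl (cmod (x i k)))\<^sup>2) \<and> (\<Sum>k\<in>B i. (orl (cmod (x i k)))\<^sup>2) \<le> 1"
    "\<And>i j. i \<in> I \<Longrightarrow> j \<in> I \<Longrightarrow> i \<noteq> j \<Longrightarrow> B i \<inter> B j = {}" by (elim exE conjE) (rule that, assumption, assumption, erule bspec, assumption, blast)
  define U where "U = (\<Union>i\<in>I. B i)"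
  have fU: "finite U" using IB by (auto simp: U_def)
  \<comment> \<open>The old blocks occupy \<open>card U\<close> coordinates, each contributing at
    most \<open>4 * th\<close> to the modular. This \<open>th\<close> keeps their share below 1/2,
    so at least 1/2 remains outside, and it also keeps single terms below 1/2.\<close>
  define th where "th = min (exp (-1)) (1 / (8 * (real (card U) + 1)))"
  have th: "0 < th" "th \<le> exp (-1)" "th \<le> 1 / (8 * (real (card U) + 1))" by (simp_all add: th_def)
  then have thU: "8 * th * (real (card U) + 1) \<le> 1" by (simp add: field_simps)
  have "8 * th * 1 \<le> 8 * th * (real (card U) + 1)" using th by (intro mult_left_mono) auto
  then have th8: "th \<le> 1/8" using thU by linarith
  obtain i1 where i1: "\<forall>i\<ge>i1. l2_le (x i) th" using l2_small_tendsto_0[OF x th(1)] ..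
  obtain i where i: "i \<ge> i1" "i \<ge> i0" "i \<notin> I"
  proof -
    have "infinite {max i0 i1..}" by (rule infinite_Ici)
    then obtain i where "i \<in> {max i0 i1..} - I" using IB(1) finite_subset[of "{max i0 i1..}" I] by blast
    then show ?thesis using that[of i] by simp
  qed
  have xi: "cmod (x i k) \<le> th" for k using i1 i th l2_le_coord[of "x i" th k] by simp
  have xe: "cmod (x i k) \<le> exp (-1)" for k using xi[of k] th by simp
  have Phi: "(orl (cmod (x i k)))\<^sup>2 \<le> 4 * th" for k
    using orl_sq_le[of "cmod (x i k)"] xe[of k] xi[of k] by simp
  have "\<not> orlicz_unit (x i)" using no i by simp
  then obtain S where S: "finite S" "(\<Sum>k\<in>S. (orl (cmod (x i k)))\<^sup>2) > 1"
    unfolding orlicz_unit_def using xe by force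
  have "(\<Sum>k\<in>S \<inter> U. (orl (cmod (x i k)))\<^sup>2) \<le> real (card (S \<inter> U)) * (4 * th)"
    using sum_bounded_above[of "S \<inter> U" "\<lambda>k. (orl (cmod (x i k)))\<^sup>2" "4 * th"] Phi by simp
  also have "\<dots> \<le> real (card U) * (4 * th)"
    using th fU by (intro mult_right_mono) (auto intro: card_mono)
  also have "\<dots> \<le> 1/2" using thU th by (simp add: algebra_simps)
  finally have "1/2 \<le> (\<Sum>k\<in>S - U. (orl (cmod (x i k)))\<^sup>2)"
    using S sum.Int_Diff[of S "\<lambda>k. (orl (cmod (x i k)))\<^sup>2" U] by linarith
  moreover have "(orl (cmod (x i k)))\<^sup>2 \<le> 1/2" for k using Phi[of k] th8 by simp
  ultimately obtain C where C: "C \<subseteq> S - U" "1/2 \<le> (\<Sum>k\<in>C. (orl (cmod (x i k)))\<^sup>2)"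
      "(\<Sum>k\<in>C. (orl (cmod (x i k)))\<^sup>2) \<le> 1"
    using subset_sum_between[of "S - U" "\<lambda>k. (orl (cmod (x i k)))\<^sup>2"] S by auto
  have fC: "finite C" using C S finite_subset by blast
  have dis: "B j \<inter> C = {}" if "j \<in> I" for j using C that by (auto simp: U_def)
  let ?B = "B(i := C)"
  have "\<forall>j\<in>insert i I. i0 \<le> j \<and> finite (?B j) \<and>
     1/2 \<le> (\<Sum>k\<in>?B j. (orl (cmod (x j k)))\<^sup>2) \<and> (\<Sum>k\<in>?B j. (orl (cmod (x j k)))\<^sup>2) \<le> 1"
    using i fC C IB(3) by auto
  moreover have "\<forall>j\<in>insert i I. \<forall>l\<in>insert i I. j \<noteq> l \<longrightarrow> ?B j \<inter> ?B l = {}"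
    using IB(4) dis i(3) by (auto simp: Int_commute)
  ultimately show ?case using IB(1,2) i(3)
    by (intro exI[of _ "insert i I"] exI[of _ ?B]) simp
qed

text \<open>
  The test sequence is \<open>x i / (2 sqrt n)\<close> on the \<open>i\<close>-th of \<open>n\<close> disjoint blocks, with the signs of the
  sign sum itself: by \<open>sign_choice\<close> some choice of signs makes the diagonal terms dominate, so the
  tails of the \<open>x i\<close> outside their blocks are harmless.
\<close>

lemma orlicz_unit_frequently_unit:
  assumes x: "small_sign_sums l2_le x" and xt: "small_sign_sums test_le x"
  shows "\<exists>i\<ge>i0. orlicz_unit (x i)"
proof (rule ccontr)
  assume "\<not> ?thesis"
  then have no: "\<forall>i\<ge>i0. \<not> orlicz_unit (x i)" by blast
  \<comment> \<open>Multiplied by \<open>q = 2 * sqrt n\<close>, the constant 1/500 becomes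
    \<open>n / 250\<close>, which lies below the \<open>n / 200\<close> supplied by the
    diagonal.\<close>
  obtain n0 where n0: "\<forall>A e. finite A \<longrightarrow> n0 \<le> card A \<longrightarrow> (\<forall>i. e i \<in> {1, -1}) \<longrightarrow>
       test_le (\<Sum>i\<in>A. e i *\<^sub>C x i) (1/500 * sqrt (card A))"
    using small_sign_sumsD[OF xt, of "1/500"] by auto
  define n where "n = Suc n0"
  define q where "q = 2 * sqrt (real n)"
  have q2: "q \<ge> 2" "q\<^sup>2 = 4 * real n" by (simp_all add: q_def n_def power_mult_distrib)
  have lnq: "ln q > 0" using q2 by simp
  \<comment> \<open>Dividing by \<open>q\<close> enlarges the logarithms by \<open>ln q\<close>;
    coordinates this small in \<open>l2\<close> make the resulting extra term in the modular
    bounded.\<close>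
  define th where "th = min (exp (-1)) (1 / (2 * ln q))"
  have th: "0 < th" "th \<le> exp (-1)" "th \<le> 1 / (2 * ln q)" using lnq by (simp_all add: th_def)
  then have thq: "2 * th * ln q \<le> 1" using lnq by (simp add: field_simps)
  obtain i1 where i1: "\<forall>i\<ge>i1. l2_le (x i) th" using l2_small_tendsto_0[OF x th(1)] ..
  have no': "\<forall>i\<ge>max i0 i1. \<not> orlicz_unit (x i)" using no by simp
  obtain I B where I: "finite I" "card I = n" and IB:
    "\<And>i. i \<in> I \<Longrightarrow> max i0 i1 \<le> i \<and> finite (B i) \<and>
     1/2 \<le> (\<Sum>k\<in>B i. (orl (cmod (x i k)))\<^sup>2) \<and> (\<Sum>k\<in>B i. (orl (cmod (x i k)))\<^sup>2) \<le> 1"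
    and dis: "\<And>i j. i \<in> I \<Longrightarrow> j \<in> I \<Longrightarrow> i \<noteq> j \<Longrightarrow> B i \<inter> B j = {}"
    using disjoint_blocks[OF x no', of n] by (elim exE conjE) (rule that, assumption, assumption, erule bspec, assumption, blast)
  have l2: "l2_le (x i) th" if "i \<in> I" for i using IB[OF that] i1 by simp
  have xi: "cmod (x i k) \<le> th" if "i \<in> I" for i k
    using l2_le_coord[OF l2[OF that]] th by simp
  have xe: "cmod (x i k) \<le> exp (-1)" if "i \<in> I" for i k using xi[OF that, of k] th by simp
  have yle: "cmod (x i k) / q \<le> exp (-1)" if "i \<in> I" for i k
  proof -
    have "cmod (x i k) / q \<le> cmod (x i k) / 1" using q2 by (intro divide_left_mono) auto
    then show ?thesis using xe[OF that, of k] by simp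
  qed
  define D where "D i k = (ln (orl (cmod (x i k) / q)))\<^sup>2" for i k
  define S where "S = (\<Union>i\<in>I. B i)"
  have fS: "finite S" using I IB by (auto simp: S_def)
  have sumS: "sum f S = (\<Sum>i\<in>I. sum f (B i))" for f :: "nat \<Rightarrow> 'b::comm_monoid_add"
    unfolding S_def using I IB dis by (subst sum.UNION_disjoint) auto
  define ix where "ix k = (THE i. i \<in> I \<and> k \<in> B i)" for k
  have ix: "ix k = i" if "i \<in> I" "k \<in> B i" for i k
    unfolding ix_def using that dis by (intro the_equality) blast+
  define c where "c i j = (\<Sum>k\<in>B i. x j k * cnj (x i k) * of_real (D i k))" for i j
  obtain e where e: "\<And>i. e i \<in> {1,-1}" "(\<Sum>i\<in>I. Re (c i i)) \<le> Re (\<Sum>i\<in>I. \<Sum>j\<in>I. e i * e j * c i j)"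
    using sign_choice[OF I(1), of c] by blast
  have ce: "cnj (e i) = e i" and ne: "cmod (e i) = 1" for i using e(1)[of i] by auto
  define y where "y k = e (ix k) * x (ix k) k / of_real q" for k
  have ny: "cmod (y k) = cmod (x i k) / q" if "i \<in> I" "k \<in> B i" for i k
    using ix[OF that] ne q2 by (simp add: y_def norm_mult norm_divide)
  have orl_y: "(orl (cmod (x i k) / q))\<^sup>2 \<le> (2 * (orl (cmod (x i k)))\<^sup>2 + 8 * (ln q)\<^sup>2 * (cmod (x i k))\<^sup>2) / (4 * real n)"
    if "i \<in> I" for i k
  proof (cases "x i k = 0")
    case False
    let ?t = "cmod (x i k)"
    have "orl (?t / q) * q = orl ?t + 2 * ?t * ln q"
      using False q2 by (simp add: orl_def ln_div field_simps)
    then have "(orl (?t / q))\<^sup>2 * q\<^sup>2 = (orl ?t + 2 * ?t * ln q)\<^sup>2"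
      by (simp flip: power_mult_distrib)
    also have "\<dots> \<le> 2 * (orl ?t)\<^sup>2 + 2 * (2 * ?t * ln q)\<^sup>2"
      using sum_squares_ge_zero[of "orl ?t - 2 * ?t * ln q" 0] by (simp add: power2_eq_square algebra_simps)
    also have "\<dots> = 2 * (orl ?t)\<^sup>2 + 8 * (ln q)\<^sup>2 * ?t\<^sup>2" by (simp add: power2_eq_square)
    finally show ?thesis using q2 n_def by (simp add: field_simps)
  qed simp
  have T1: "(\<Sum>k\<in>S. (orl (cmod (y k)))\<^sup>2) \<le> 1"
  proof -
    have "(\<Sum>k\<in>S. (orl (cmod (y k)))\<^sup>2) = (\<Sum>i\<in>I. \<Sum>k\<in>B i. (orl (cmod (x i k) / q))\<^sup>2)"
      unfolding sumS by (intro sum.cong refl) (simp add: ny)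
    also have "\<dots> \<le> (\<Sum>i\<in>I. 1 / real n)"
    proof (rule sum_mono)
      fix i assume i: "i \<in> I"
      have l: "(\<Sum>k\<in>B i. (cmod (x i k))\<^sup>2) \<le> th\<^sup>2" using l2[OF i] IB[OF i] by (simp add: l2_le_def)
      have "(\<Sum>k\<in>B i. (orl (cmod (x i k) / q))\<^sup>2) \<le>
        (\<Sum>k\<in>B i. (2 * (orl (cmod (x i k)))\<^sup>2 + 8 * (ln q)\<^sup>2 * (cmod (x i k))\<^sup>2) / (4 * real n))"
        using orl_y[OF i] by (rule sum_mono)
      also have "\<dots> = (2 * (\<Sum>k\<in>B i. (orl (cmod (x i k)))\<^sup>2) + 8 * (ln q)\<^sup>2 * (\<Sum>k\<in>B i. (cmod (x i k))\<^sup>2)) / (4 * real n)"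
        unfolding sum_divide_distrib[symmetric] sum.distrib sum_distrib_left[symmetric] ..
      also have "\<dots> \<le> (2 * 1 + 8 * (ln q)\<^sup>2 * th\<^sup>2) / (4 * real n)"
        using IB[OF i] l by (intro divide_right_mono add_mono mult_left_mono) auto
      also have "\<dots> = (2 + 2 * (2 * th * ln q)\<^sup>2) / (4 * real n)" by (simp add: power2_eq_square)
      also have "\<dots> \<le> (2 + 2 * 1\<^sup>2) / (4 * real n)"
        using thq th lnq by (intro divide_right_mono add_mono mult_left_mono power_mono) auto
      also have "\<dots> = 1 / real n" by simp
      finally show "(\<Sum>k\<in>B i. (orl (cmod (x i k) / q))\<^sup>2) \<le> 1 / real n" .
    qed
    also have "\<dots> = 1" using I n_def by simp
    finally show ?thesis .
  qed
  have T2: "\<forall>k\<in>S. cmod (y k) \<le> exp (-1)"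
    using yle ny unfolding S_def by auto
  let ?s = "\<Sum>i\<in>I. e i *\<^sub>C x i"
  have "test_le ?s (1/500 * sqrt (real n))"
    using n0[rule_format, OF I(1), of e] I(2) e(1) by (auto simp: n_def simp del: of_nat_Suc)
  then have "cmod (\<Sum>k\<in>S. ?s k * cnj (y k) * (ln (orl (cmod (y k))))\<^sup>2) \<le> 1/500 * sqrt (real n)"
    using fS T1 T2 unfolding test_le_def by blast
  moreover have "(\<Sum>k\<in>S. ?s k * cnj (y k) * (ln (orl (cmod (y k))))\<^sup>2) =
     (\<Sum>i\<in>I. \<Sum>j\<in>I. e i * e j * c i j) / of_real q"
  proof -
    have "(\<Sum>k\<in>S. ?s k * cnj (y k) * (ln (orl (cmod (y k))))\<^sup>2) =
      (\<Sum>i\<in>I. \<Sum>k\<in>B i. \<Sum>j\<in>I. e i * e j * (x j k * cnj (x i k) * of_real (D i k)) / of_real q)"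
    proof (subst sumS, intro sum.cong refl)
      fix i k assume ik: "i \<in> I" "k \<in> B i"
      have "?s k * cnj (y k) * (ln (orl (cmod (y k))))\<^sup>2 =
        (\<Sum>j\<in>I. e j * x j k) * (e i * cnj (x i k) / of_real q * of_real (D i k))"
        using ny[OF ik] by (simp add: sign_sum_apply y_def ix[OF ik] D_def ce)
      also have "\<dots> = (\<Sum>j\<in>I. (e j * x j k) * (e i * cnj (x i k) / of_real q * of_real (D i k)))"
        by (rule sum_distrib_right)
      finally show "?s k * cnj (y k) * (ln (orl (cmod (y k))))\<^sup>2 =
         (\<Sum>j\<in>I. e i * e j * (x j k * cnj (x i k) * of_real (D i k)) / of_real q)"
        by (simp add: mult_ac)
    qed
    also have "\<dots> = (\<Sum>i\<in>I. \<Sum>j\<in>I. \<Sum>k\<in>B i. e i * e j * (x j k * cnj (x i k) * of_real (D i k)) / of_real q)"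
      by (intro sum.cong refl sum.swap)
    also have "\<dots> = (\<Sum>i\<in>I. \<Sum>j\<in>I. e i * e j * c i j) / of_real q"
      unfolding c_def sum_distrib_left sum_divide_distrib ..
    finally show ?thesis .
  qed
  ultimately have "cmod (\<Sum>i\<in>I. \<Sum>j\<in>I. e i * e j * c i j) / q \<le> 1/500 * sqrt (real n)"
    using q2 by (simp add: norm_divide)
  then have "cmod (\<Sum>i\<in>I. \<Sum>j\<in>I. e i * e j * c i j) \<le> 1/500 * sqrt (real n) * q"
    using q2 by (simp add: field_simps)
  also have "\<dots> = real n / 250" by (simp add: q_def)
  finally have "Re (\<Sum>i\<in>I. \<Sum>j\<in>I. e i * e j * c i j) \<le> real n / 250"
    using complex_Re_le_cmod order_trans by blast
  \<comment> \<open>By \<open>ln_orl\<close> the squared logarithm loses at most a factor 25 and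
    \<open>orl\<close> squared carries a factor 4, so each diagonal term is at least 1/100 of the
    modular term; a block has modular at least 1/2.\<close>
  moreover have "(\<Sum>i\<in>I. Re (c i i)) \<ge> (\<Sum>i\<in>I. 1/200)"
  proof (rule sum_mono)
    fix i assume i: "i \<in> I"
    have "c i i = of_real (\<Sum>k\<in>B i. (cmod (x i k))\<^sup>2 * D i k)"
      by (simp only: c_def complex_norm_square[symmetric] of_real_sum of_real_power of_real_mult)
    then have "Re (c i i) = (\<Sum>k\<in>B i. (cmod (x i k))\<^sup>2 * D i k)" by simp
    moreover have "(\<Sum>k\<in>B i. (orl (cmod (x i k)))\<^sup>2 / 100) \<le> (\<Sum>k\<in>B i. (cmod (x i k))\<^sup>2 * D i k)"
    proof (rule sum_mono)
      fix k
      let ?t = "cmod (x i k)"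
      show "(orl ?t)\<^sup>2 / 100 \<le> ?t\<^sup>2 * D i k"
      proof (cases "x i k = 0")
        case False
        have "- ln (?t / q) / 5 \<le> - ln (orl (?t / q))"
          using False q2 yle[OF i, of k] by (intro ln_orl) auto
        moreover have "- ln (?t / q) = - ln ?t + ln q" using False q2 by (simp add: ln_div)
        moreover have "- ln ?t \<ge> 1" using False xe[OF i, of k] by (intro one_le_neg_ln) auto
        ultimately have "(- ln ?t / 5)\<^sup>2 \<le> (- ln (orl (?t / q)))\<^sup>2" using lnq by (intro power_mono) auto
        then have "?t\<^sup>2 * (- ln ?t / 5)\<^sup>2 \<le> ?t\<^sup>2 * D i k"
          unfolding D_def by (intro mult_left_mono) auto
        then show ?thesis by (simp add: orl_def power2_eq_square field_simps)
      qed simp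
    qed
    moreover have "(\<Sum>k\<in>B i. (orl (cmod (x i k)))\<^sup>2 / 100) \<ge> 1/200"
      using IB[OF i] by (simp flip: sum_divide_distrib)
    ultimately show "1/200 \<le> Re (c i i)" by linarith
  qed
  ultimately have "(\<Sum>i\<in>I. 1/200) \<le> real n / 250" using e(2) by linarith
  then show False using I by (simp add: n_def)
qed

lemma small_sign_sums_scale:
  assumes "small_sign_sums P x" "c > 0" "\<And>s r. P s r \<Longrightarrow> P (of_real c *\<^sub>C s) (c * r)"
  shows "small_sign_sums P (\<lambda>i. of_real c *\<^sub>C x i :: cseq)"
  unfolding small_sign_sums_def
proof (intro allI impI)
  fix d :: real assume d: "d > 0"
  obtain n0 where n0: "\<forall>A e. finite A \<longrightarrow> n0 \<le> card A \<longrightarrow> (\<forall>i. e i \<in> {1, -1}) \<longrightarrow>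
       P (\<Sum>i\<in>A. e i *\<^sub>C x i) (d / c * sqrt (card A))"
    using small_sign_sumsD[OF assms(1), of "d / c"] d assms(2) by auto
  have "P (\<Sum>i\<in>A. e i *\<^sub>C (of_real c *\<^sub>C x i)) (d * sqrt (card A))"
    if A: "finite A" "n0 \<le> card A" and e: "\<forall>i. e i \<in> {1,-1}" for A e
  proof -
    have "P (of_real c *\<^sub>C (\<Sum>i\<in>A. e i *\<^sub>C x i)) (c * (d / c * sqrt (card A)))"
      using n0 A e by (intro assms(3)) blast
    moreover have "of_real c *\<^sub>C (\<Sum>i\<in>A. e i *\<^sub>C x i) = (\<Sum>i\<in>A. e i *\<^sub>C (of_real c *\<^sub>C x i))"
      by (simp add: fun_eq_iff sign_sum_apply scaleC_apply scaleC_complex sum_fun_apply sum_distrib_left mult_ac)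
    ultimately show ?thesis using assms(2) by simp
  qed
  then show "\<exists>n0. \<forall>A e. finite A \<longrightarrow> n0 \<le> card A \<longrightarrow> (\<forall>i. e i \<in> {1, -1}) \<longrightarrow>
       P (\<Sum>i\<in>A. e i *\<^sub>C (of_real c *\<^sub>C x i)) (d * sqrt (card A))" by blast
qed

text \<open>Smallness survives scaling, so the unit case applies to the multiples by
  \<open>c\<close>. With \<open>c\<close> arbitrary this says that Orlicz norms tend to 0 along a
  subsequence.\<close>

lemma orlicz_unit_frequently:
  assumes x: "small_sign_sums l2_le x" and xt: "small_sign_sums test_le x" and "c > 0"
  shows "\<exists>i\<ge>i0. orlicz_unit (of_real c *\<^sub>C x i)"
proof (rule orlicz_unit_frequently_unit)
  show "small_sign_sums l2_le (\<lambda>i. of_real c *\<^sub>C x i)"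
  proof (rule small_sign_sums_scale[OF x \<open>c > 0\<close>])
    fix s r assume "l2_le s r"
    then show "l2_le (of_real c *\<^sub>C s) (c * r)"
      using \<open>c > 0\<close> by (auto simp: l2_le_def scaleC_apply scaleC_complex norm_mult power_mult_distrib simp flip: sum_distrib_left)
  qed
  show "small_sign_sums test_le (\<lambda>i. of_real c *\<^sub>C x i)"
  proof (rule small_sign_sums_scale[OF xt \<open>c > 0\<close>])
    fix s r assume s: "test_le s r"
    show "test_le (of_real c *\<^sub>C s) (c * r)"
      unfolding test_le_def
    proof (intro allI impI)
      fix S and y :: cseq assume *: "finite S" "\<forall>k\<in>S. cmod (y k) \<le> exp (-1)" "(\<Sum>k\<in>S. (orl (cmod (y k)))\<^sup>2) \<le> 1"
      have "(\<Sum>k\<in>S. (of_real c *\<^sub>C s) k * cnj (y k) * (ln (orl (cmod (y k))))\<^sup>2) =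
        of_real c * (\<Sum>k\<in>S. s k * cnj (y k) * (ln (orl (cmod (y k))))\<^sup>2)"
        by (simp add: scaleC_apply scaleC_complex sum_distrib_left mult_ac)
      moreover have "cmod (\<Sum>k\<in>S. s k * cnj (y k) * (ln (orl (cmod (y k))))\<^sup>2) \<le> r"
        using s * unfolding test_le_def by blast
      ultimately show "cmod (\<Sum>k\<in>S. (of_real c *\<^sub>C s) k * cnj (y k) * (ln (orl (cmod (y k))))\<^sup>2) \<le> c * r"
        using \<open>c > 0\<close> by (simp add: norm_mult)
    qed
  qed
qed

section \<open>Scalar functions on the strip\<close>


definition tay :: "nat \<Rightarrow> (complex \<Rightarrow> complex) \<Rightarrow> complex"
  where "tay m f = (deriv ^^ m) f (1/2) / fact m"

definition strip_bdd :: "(complex \<Rightarrow> complex) \<Rightarrow> bool"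
  where "strip_bdd f \<longleftrightarrow> continuous_on closed_strip f \<and> f holomorphic_on open_strip \<and>
    bounded (f ` closed_strip)"

lemma open_open_strip: "open open_strip"
proof -
  have *: "open_strip = {z. 0 < Re z} \<inter> {z. Re z < 1}" by (auto simp: open_strip_def)
  show ?thesis unfolding * by (intro open_Int open_halfspace_Re_gt open_halfspace_Re_lt)
qed

lemma half_in_open_strip [simp]: "1/2 \<in> open_strip"
  by (simp add: open_strip_def)

lemma open_subset_closed_strip: "open_strip \<subseteq> closed_strip"
  by (auto simp: open_strip_def closed_strip_def)

lemma cball_in_open_strip: "cball (1/2) (1/4) \<subseteq> open_strip"
proof
  fix z :: complex assume "z \<in> cball (1/2) (1/4)"
  then have "cmod (z - 1/2) \<le> 1/4" by (simp add: dist_norm norm_minus_commute)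
  then have "\<bar>Re (z - 1/2)\<bar> \<le> 1/4" using abs_Re_le_cmod order_trans by blast
  then show "z \<in> open_strip" unfolding open_strip_def abs_le_iff by simp
qed

text \<open>Phragmen-Lindelof: the Gaussian factor has modulus at most \<open>exp (e/4)\<close> on
  the strip and decays vertically, which reduces the claim to the maximum principle on a rectangle;
  then \<open>e\<close> tends to 0.\<close>

lemma strip_bdd_bound:
  assumes f: "strip_bdd f" and M: "\<And>t. cmod (f (Complex 0 t)) \<le> M" "\<And>t. cmod (f (Complex 1 t)) \<le> M"
    and z: "z \<in> closed_strip"
  shows "cmod (f z) \<le> M"
proof -
  obtain B where B: "\<And>w. w \<in> closed_strip \<Longrightarrow> cmod (f w) \<le> B"
    using f unfolding strip_bdd_def bounded_iff by blast
  have B0: "B \<ge> 0" using B[OF z] norm_ge_zero order_trans by blast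
  have M0: "M \<ge> 0" using M(1)[of 0] norm_ge_zero order_trans by blast
  define a where "a = (Re z - 1/2)\<^sup>2 - (Im z)\<^sup>2"
  have gauss: "cmod (exp (of_real e * (w - 1/2)\<^sup>2)) = exp (e * ((Re w - 1/2)\<^sup>2 - (Im w)\<^sup>2))" for e w
    by (simp add: power2_eq_square)
  have main: "cmod (f z) * exp (e * a) \<le> (M + e) * exp (e / 4)" if e: "e > 0" for e
  proof -
    \<comment> \<open>On the horizontal sides the product is at most
      \<open>B * exp (e/4) * exp (- (e * R\<^sup>2))\<close>; since \<open>exp x\<close> exceeds
      \<open>x\<close>, this height pushes it below \<open>e\<close>.\<close>
    define R where "R = \<bar>Im z\<bar> + 1 + B * exp (e/4) / e\<^sup>2"
    have R: "R \<ge> 1" "\<bar>Im z\<bar> \<le> R" "e\<^sup>2 * R \<ge> B * exp (e/4)"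
      using e B0 by (auto simp: R_def field_simps)
    have "B * exp (e/4) \<le> e\<^sup>2 * R\<^sup>2"
      using R(3) mult_left_mono[of R "R\<^sup>2" "e\<^sup>2"] R(1) by (simp add: power2_eq_square mult_le_cancel_left1)
    also have "\<dots> \<le> e * exp (e * R\<^sup>2)"
      using order_trans[OF less_imp_le[OF less_add_one] exp_ge_add_one_self[of "e * R\<^sup>2", simplified add.commute[of 1]]] e mult_left_mono[of "e * R\<^sup>2" "exp (e * R\<^sup>2)" e]
      by (simp only: power2_eq_square[of e] mult.assoc)
    finally have BR: "B * exp (e/4) * exp (- (e * R\<^sup>2)) \<le> e" by (simp add: exp_minus field_simps)
    let ?S = "cbox (Complex 0 (-R)) (Complex 1 R)"
    define h where "h = (\<lambda>w. f w * exp (of_real e * (w - 1/2)\<^sup>2))"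
    have S: "?S \<subseteq> closed_strip" by (auto simp: in_cbox_complex_iff closed_strip_def)
    have iS: "interior ?S \<subseteq> open_strip" by (auto simp: in_box_complex_iff open_strip_def interior_cbox)
    have "cmod (h z) \<le> (M + e) * exp (e/4)"
    proof (rule maximum_modulus_frontier[where f = h and S = ?S])
      show "h holomorphic_on interior ?S"
        unfolding h_def using f iS
        by (intro holomorphic_intros) (auto simp: strip_bdd_def intro: holomorphic_on_subset)
      show "continuous_on (closure ?S) h"
        unfolding h_def using f S
        by (intro continuous_intros) (auto simp: strip_bdd_def intro: continuous_on_subset)
      show "bounded ?S" by simp
      show "z \<in> ?S" using z R by (auto simp: in_cbox_complex_iff closed_strip_def abs_le_iff)
      fix w assume w: "w \<in> frontier ?S"
      then have wS: "w \<in> ?S" using frontier_closed by (metis closed_cbox frontier_subset_closed subsetD)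
      then have wc: "w \<in> closed_strip" using S by blast
      have "\<bar>Re w - 1/2\<bar> \<le> 1/2" using wc unfolding closed_strip_def abs_le_iff by auto
      then have "\<bar>Re w - 1/2\<bar>\<^sup>2 \<le> (1/2)\<^sup>2" by (intro power_mono) auto
      then have re: "(Re w - 1/2)\<^sup>2 \<le> 1/4" by (simp add: power2_eq_square)
      have nh: "cmod (h w) = cmod (f w) * exp (e * ((Re w - 1/2)\<^sup>2 - (Im w)\<^sup>2))"
        by (simp only: h_def norm_mult gauss)
      have "w \<notin> box (Complex 0 (-R)) (Complex 1 R)" using w by (simp add: frontier_def interior_cbox)
      then have "Re w = 0 \<or> Re w = 1 \<or> \<bar>Im w\<bar> = R"
        using wS by (auto simp: in_box_complex_iff in_cbox_complex_iff)
      then show "cmod (h w) \<le> (M + e) * exp (e/4)"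
      proof (elim disjE)
        assume im: "\<bar>Im w\<bar> = R"
        have "e * ((Re w - 1/2)\<^sup>2 - (Im w)\<^sup>2) \<le> e * (1/4 - R\<^sup>2)"
          using re e im[symmetric] by (intro mult_left_mono) auto
        then have "cmod (h w) \<le> B * exp (e * (1/4 - R\<^sup>2))"
          unfolding nh using B[OF wc] B0 by (intro mult_mono) auto
        also have "\<dots> = B * exp (e/4) * exp (- (e * R\<^sup>2))" by (simp add: algebra_simps flip: exp_add)
        also have "\<dots> \<le> e * 1" using BR by simp
        also have "\<dots> \<le> (M + e) * exp (e/4)" using e M0 by (intro mult_mono) auto
        finally show ?thesis .
      next
        assume "Re w = 0"
        then have "cmod (f w) \<le> M" using M(1)[of "Im w"] by (metis complex.collapse)
        moreover have "e * ((Re w - 1/2)\<^sup>2 - (Im w)\<^sup>2) \<le> e * (1/4)"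
          using e re by (intro mult_left_mono) (simp_all add: order_trans[OF _ re] add_increasing2 diff_le_eq)
        ultimately show ?thesis unfolding nh using e M0 by (intro mult_mono) auto
      next
        assume "Re w = 1"
        then have "cmod (f w) \<le> M" using M(2)[of "Im w"] by (metis complex.collapse)
        moreover have "e * ((Re w - 1/2)\<^sup>2 - (Im w)\<^sup>2) \<le> e * (1/4)"
          using e re by (intro mult_left_mono) (simp_all add: order_trans[OF _ re] add_increasing2 diff_le_eq)
        ultimately show ?thesis unfolding nh using e M0 by (intro mult_mono) auto
      qed
    qed
    then show ?thesis by (simp only: h_def norm_mult gauss a_def)
  qed
  have "((\<lambda>e. cmod (f z) * exp (e * a)) \<longlongrightarrow> cmod (f z) * exp (0 * a)) (at_right 0)"
    by (intro tendsto_intros)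
  moreover have "((\<lambda>e. (M + e) * exp (e / 4)) \<longlongrightarrow> (M + 0) * exp (0 / 4)) (at_right 0)"
    by (intro tendsto_intros) auto
  moreover have "eventually (\<lambda>e. cmod (f z) * exp (e * a) \<le> (M + e) * exp (e / 4)) (at_right 0)"
    using main by (auto simp: eventually_at_right_field intro: exI[of _ 1])
  ultimately have "cmod (f z) * exp (0 * a) \<le> (M + 0) * exp (0 / 4)"
    by (intro tendsto_le[OF _ _ _]) auto
  then show ?thesis by simp
qed

text \<open>Cauchy's inequality on the disc of radius 1/4 about 1/2, where the edge bound
  \<open>M\<close> holds by \<open>strip_bdd_bound\<close>.\<close>

lemma tay_bound:
  assumes f: "strip_bdd f" and M: "\<And>t. cmod (f (Complex 0 t)) \<le> M" "\<And>t. cmod (f (Complex 1 t)) \<le> M"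
  shows "cmod (tay m f) \<le> 4 ^ m * M"
proof -
  have "cmod ((deriv ^^ m) f (1/2)) \<le> fact m * M / (1/4) ^ m"
  proof (rule Cauchy_inequality)
    show "f holomorphic_on ball (1/2) (1/4)"
      using f cball_in_open_strip ball_subset_cball by (meson strip_bdd_def holomorphic_on_subset order_trans)
    show "continuous_on (cball (1/2) (1/4)) f"
      using f cball_in_open_strip open_subset_closed_strip by (meson strip_bdd_def continuous_on_subset order_trans)
    fix x :: complex assume "cmod (1/2 - x) = 1/4"
    then have "x \<in> cball (1/2) (1/4)" by (simp add: dist_norm)
    then show "cmod (f x) \<le> M"
      using cball_in_open_strip open_subset_closed_strip strip_bdd_bound[OF f M] by blast
  qed simp
  then show ?thesis by (simp add: tay_def norm_divide field_simps)
qed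

lemma strip_bdd_add: "strip_bdd f \<Longrightarrow> strip_bdd g \<Longrightarrow> strip_bdd (\<lambda>z. f z + g z)"
  unfolding strip_bdd_def by (auto intro!: continuous_intros holomorphic_intros bounded_plus_comp)

lemma strip_bdd_mult: "strip_bdd f \<Longrightarrow> strip_bdd g \<Longrightarrow> strip_bdd (\<lambda>z. f z * g z)"
proof -
  assume *: "strip_bdd f" "strip_bdd g"
  then obtain B C where B: "\<And>z. z \<in> closed_strip \<Longrightarrow> cmod (f z) \<le> B" "\<And>z. z \<in> closed_strip \<Longrightarrow> cmod (g z) \<le> C"
    unfolding strip_bdd_def bounded_iff by auto
  have "cmod (f z * g z) \<le> B * C" if "z \<in> closed_strip" for z
    unfolding norm_mult using B[OF that] by (intro mult_mono) (auto intro: order_trans[OF norm_ge_zero])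
  then show ?thesis using *
    unfolding strip_bdd_def bounded_iff by (auto intro!: continuous_intros holomorphic_intros exI[of _ "B*C"])
qed

lemma strip_bdd_const: "strip_bdd (\<lambda>z. c)"
  unfolding strip_bdd_def by (auto simp: image_constant_conv)

lemma strip_bdd_sum: "(\<And>k. k \<in> S \<Longrightarrow> strip_bdd (f k)) \<Longrightarrow> strip_bdd (\<lambda>z. \<Sum>k\<in>S. f k z)"
  by (induction S rule: infinite_finite_induct) (auto intro: strip_bdd_add strip_bdd_const)

lemma tay_sum:
  assumes "\<And>k. k \<in> S \<Longrightarrow> strip_bdd (f k)"
  shows "tay m (\<lambda>z. \<Sum>k\<in>S. f k z) = (\<Sum>k\<in>S. tay m (f k))"
  using assms
proof (induction S rule: infinite_finite_induct)
  case (insert a S)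
  have "(deriv ^^ m) (\<lambda>z. f a z + (\<Sum>k\<in>S. f k z)) (1/2) =
    (deriv ^^ m) (f a) (1/2) + (deriv ^^ m) (\<lambda>z. \<Sum>k\<in>S. f k z) (1/2)"
    using insert by (intro higher_deriv_add[OF _ _ open_open_strip] holomorphic_intros) (auto simp: strip_bdd_def)
  then show ?case using insert by (simp add: tay_def add_divide_distrib)
qed (simp_all add: tay_def)

lemma tay_mult:
  assumes "strip_bdd f" "strip_bdd g"
  shows "tay 0 (\<lambda>z. f z * g z) = tay 0 f * tay 0 g"
    "tay 1 (\<lambda>z. f z * g z) = tay 0 f * tay 1 g + tay 1 f * tay 0 g"
    "tay 2 (\<lambda>z. f z * g z) = tay 0 f * tay 2 g + tay 1 f * tay 1 g + tay 2 f * tay 0 g"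
proof -
  have *: "(deriv ^^ n) (\<lambda>w. f w * g w) (1/2) =
           (\<Sum>i = 0..n. of_nat (n choose i) * (deriv ^^ i) f (1/2) * (deriv ^^ (n-i)) g (1/2))" for n
    using assms by (intro higher_deriv_mult[OF _ _ open_open_strip]) (auto simp: strip_bdd_def)
  show "tay 0 (\<lambda>z. f z * g z) = tay 0 f * tay 0 g" by (simp add: tay_def)
  show "tay 1 (\<lambda>z. f z * g z) = tay 0 f * tay 1 g + tay 1 f * tay 0 g"
    unfolding tay_def * by simp
  show "tay 2 (\<lambda>z. f z * g z) = tay 0 f * tay 2 g + tay 1 f * tay 1 g + tay 2 f * tay 0 g"
    unfolding tay_def * by (simp add: eval_nat_numeral field_simps)
qed

text \<open>
  With \<open>D = - ln v\<close> the first exponential has modulus \<open>v\<close> to the power \<open>1 - 2 Re z\<close>, as in the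
  Calderon-type factorisation of a unit vector of \<open>l\<^sup>2\<close>. The Gaussian factor provides decay at infinity,
  and the three coefficients prescribe the 2-jet at \<open>1/2\<close>.
\<close>

definition gexp :: "real \<Rightarrow> complex \<Rightarrow> complex \<Rightarrow> complex \<Rightarrow> complex \<Rightarrow> complex"
  where "gexp D a b c z = exp (2 * of_real D * (z - 1/2) + (z - 1/2)\<^sup>2) * (a + b * (z - 1/2) + c * (z - 1/2)\<^sup>2)"

text \<open>With \<open>u = z - 1/2\<close> the exponential expands as
  \<open>1 + 2 D u + (2 D^2 + 1) u^2 + ...\<close>; the formulas are its product with
  \<open>a + b u + c u^2\<close>.\<close>

lemma tay_gexp:
  "tay 0 (gexp D a b c) = a"
  "tay 1 (gexp D a b c) = b + 2 * of_real D * a"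
  "tay 2 (gexp D a b c) = c + 2 * of_real D * b + (2 * (of_real D)\<^sup>2 + 1) * a"
proof -
  show "tay 0 (gexp D a b c) = a" by (simp add: tay_def gexp_def)
  let ?E = "\<lambda>z. exp (2 * of_real D * (z - 1/2) + (z - 1/2)\<^sup>2) :: complex"
  let ?d = "\<lambda>z. ?E z * (2 * of_real D + 2 * (z - 1/2)) * (a + b * (z - 1/2) + c * (z - 1/2)\<^sup>2) + ?E z * (b + 2 * c * (z - 1/2))"
  have "(gexp D a b c has_field_derivative ?d z) (at z)" for z
    unfolding gexp_def[abs_def] by (rule derivative_eq_intros refl | simp)+
  then have d: "deriv (gexp D a b c) = ?d" by (intro ext DERIV_imp_deriv)
  then show "tay 1 (gexp D a b c) = b + 2 * of_real D * a" by (simp add: tay_def)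
  have "(?d has_field_derivative (2 * c + 4 * of_real D * b + (4 * (of_real D)\<^sup>2 + 2) * a)) (at (1/2))"
    by (rule derivative_eq_intros refl | simp add: power2_eq_square algebra_simps)+
  then have "deriv (deriv (gexp D a b c)) (1/2) = 2 * c + 4 * of_real D * b + (4 * (of_real D)\<^sup>2 + 2) * a"
    unfolding d by (intro DERIV_imp_deriv)
  then show "tay 2 (gexp D a b c) = c + 2 * of_real D * b + (2 * (of_real D)\<^sup>2 + 1) * a"
    by (simp add: tay_def eval_nat_numeral field_simps)
qed

lemma gexp_bound:
  assumes z: "z \<in> closed_strip" and v: "cmod a \<le> v" "cmod b \<le> v" "cmod c \<le> v"
  shows "cmod (gexp D a b c z) \<le> 4 * (1 + (Im z)\<^sup>2) * exp (- (Im z)\<^sup>2) * (v * exp (2 * D * (Re z - 1/2)))"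
proof -
  let ?u = "z - 1/2" and ?t = "Im z"
  have v0: "v \<ge> 0" using v(1) norm_ge_zero order_trans by blast
  have "\<bar>Re z - 1/2\<bar> \<le> 1/2" using z unfolding closed_strip_def abs_le_iff by auto
  then have "\<bar>Re z - 1/2\<bar>\<^sup>2 \<le> (1/2)\<^sup>2" by (intro power_mono) auto
  then have re: "(Re z - 1/2)\<^sup>2 \<le> 1/4" by (simp add: power2_eq_square)
  have u2: "(cmod ?u)\<^sup>2 = (Re z - 1/2)\<^sup>2 + ?t\<^sup>2" by (simp add: cmod_power2)
  have u1: "2 * cmod ?u \<le> 1 + (cmod ?u)\<^sup>2"
    using sum_squares_ge_zero[of "cmod ?u - 1" 0] by (simp add: power2_eq_square algebra_simps)
  have "cmod (a + b * ?u + c * ?u\<^sup>2) \<le> cmod a + cmod b * cmod ?u + cmod c * (cmod ?u)\<^sup>2"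
    by (intro order_trans[OF norm_triangle_ineq] add_mono) (auto simp: norm_mult norm_power)
  also have "\<dots> \<le> v + v * cmod ?u + v * (cmod ?u)\<^sup>2"
    using v by (intro add_mono mult_right_mono) auto
  also have "\<dots> = v * (1 + cmod ?u + (cmod ?u)\<^sup>2)" by (simp add: algebra_simps)
  \<comment> \<open>\<open>2 |u| \<le> 1 + |u|^2\<close> and \<open>|u|^2 \<le> 1/4 + t^2\<close>
    give the bound \<open>15/8 + 3/2 t^2\<close>.\<close>
  also have "\<dots> \<le> v * (15/8 * (1 + ?t\<^sup>2))"
  proof (rule mult_left_mono[OF _ v0])
    show "1 + cmod ?u + (cmod ?u)\<^sup>2 \<le> 15/8 * (1 + ?t\<^sup>2)"
      using u1 u2 re zero_le_power2[of ?t] by argo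
  qed
  finally have P: "cmod (a + b * ?u + c * ?u\<^sup>2) \<le> v * (15/8 * (1 + ?t\<^sup>2))" .
  have "cmod (exp (2 * of_real D * ?u + ?u\<^sup>2)) = exp (2 * D * (Re z - 1/2) + ((Re z - 1/2)\<^sup>2 - ?t\<^sup>2))"
    by (simp add: power2_eq_square)
  also have "\<dots> \<le> exp (2 * D * (Re z - 1/2) + (1/4 - ?t\<^sup>2))" using re by simp
  also have "\<dots> = exp (1/4) * (exp (- ?t\<^sup>2) * exp (2 * D * (Re z - 1/2)))"
    by (simp add: algebra_simps flip: exp_add)
  also have "\<dots> \<le> 2 * (exp (- ?t\<^sup>2) * exp (2 * D * (Re z - 1/2)))"
    using exp_bound_half[of "1/4::real"] by (intro mult_right_mono) auto
  finally have "cmod (gexp D a b c z) \<le> 2 * (exp (- ?t\<^sup>2) * exp (2 * D * (Re z - 1/2))) * (v * (15/8 * (1 + ?t\<^sup>2)))"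
    unfolding gexp_def norm_mult using P by (intro mult_mono) auto
  also have "\<dots> = (2 * 15/8) * ((1 + ?t\<^sup>2) * exp (- ?t\<^sup>2) * (v * exp (2 * D * (Re z - 1/2))))" by simp
  also have "\<dots> \<le> 4 * ((1 + ?t\<^sup>2) * exp (- ?t\<^sup>2) * (v * exp (2 * D * (Re z - 1/2))))"
    using v0 by (intro mult_right_mono) auto
  finally show ?thesis by (simp only: mult.assoc)
qed

lemma gauss_le_1: "(1 + t\<^sup>2) * exp (- t\<^sup>2) \<le> (1::real)"
  using exp_ge_add_one_self[of "t\<^sup>2"] by (simp add: exp_minus field_simps)

lemma gexp_bound':
  assumes z: "z \<in> closed_strip" and v: "cmod a \<le> v" "cmod b \<le> v" "cmod c \<le> v"
  shows "cmod (gexp D a b c z) \<le> 4 * (v * exp (2 * D * (Re z - 1/2)))"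
proof -
  have v0: "v \<ge> 0" using v(1) norm_ge_zero order_trans by blast
  have "4 * ((1 + (Im z)\<^sup>2) * exp (- (Im z)\<^sup>2)) * (v * exp (2 * D * (Re z - 1/2)))
     \<le> 4 * 1 * (v * exp (2 * D * (Re z - 1/2)))"
    using gauss_le_1[of "Im z"] v0 by (intro mult_right_mono) auto
  then show ?thesis using order_trans[OF gexp_bound[OF assms, of D]] by (simp only: mult.assoc mult_1)
qed

lemma strip_bdd_gexp: "strip_bdd (gexp D a b c)"
proof -
  define v where "v = max (cmod a) (max (cmod b) (cmod c))"
  have "cmod (gexp D a b c z) \<le> 4 * (v * exp \<bar>D\<bar>)" if z: "z \<in> closed_strip" for z
  proof -
    have "\<bar>Re z - 1/2\<bar> \<le> 1/2" using z unfolding closed_strip_def abs_le_iff by auto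
    then have "\<bar>D\<bar> * \<bar>Re z - 1/2\<bar> \<le> \<bar>D\<bar> * (1/2)" by (intro mult_left_mono) auto
    then have "D * (Re z - 1/2) \<le> \<bar>D\<bar> * (1/2)" by (metis abs_ge_self abs_mult order_trans)
    then have "exp (2 * D * (Re z - 1/2)) \<le> exp \<bar>D\<bar>" by simp
    moreover have "v \<ge> 0" by (auto simp: v_def le_max_iff_disj)
    ultimately have "v * exp (2 * D * (Re z - 1/2)) \<le> v * exp \<bar>D\<bar>" by (intro mult_left_mono)
    then show ?thesis using gexp_bound'[OF z, of a v b c D] by (force simp: v_def)
  qed
  moreover have "continuous_on closed_strip (gexp D a b c)"
    unfolding gexp_def[abs_def] by (intro continuous_intros)
  moreover have "gexp D a b c holomorphic_on open_strip"
    unfolding gexp_def[abs_def] by (intro holomorphic_intros)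
  ultimately show ?thesis unfolding strip_bdd_def bounded_iff by blast
qed

text \<open>The scalar content of a norm bound in the Calderon space: coordinates and finite sums
  suffice for pairing with finitely supported test functions.\<close>

definition edge_bdd :: "(complex \<Rightarrow> cseq) \<Rightarrow> real \<Rightarrow> bool"
  where "edge_bdd F M \<longleftrightarrow> (\<forall>k. strip_bdd (\<lambda>z. F z k)) \<and> (\<forall>t k. cmod (F (Complex 0 t) k) \<le> M) \<and>
    (\<forall>t S. finite S \<longrightarrow> (\<Sum>k\<in>S. cmod (F (Complex 1 t) k)) \<le> M)"

text \<open>The test functions belong to the dual couple: with \<open>D = - ln v\<close> their size
  is \<open>4 v^2\<close> on the left edge, summable against bounded coordinates, and 4 on the right
  edge, bounded against summable ones. So the scalar pairing is at most \<open>4 * M\<close> on both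
  edges.\<close>

lemma test_function_bound:
  assumes F: "edge_bdd F M" and S: "finite S" and v: "\<And>k. k \<in> S \<Longrightarrow> 0 < v k" "(\<Sum>k\<in>S. (v k)\<^sup>2) \<le> 1"
    and ab: "\<And>k. k \<in> S \<Longrightarrow> cmod (a k) \<le> v k \<and> cmod (b k) \<le> v k \<and> cmod (c k) \<le> v k"
  shows "cmod (tay m (\<lambda>z. \<Sum>k\<in>S. F z k * gexp (- ln (v k)) (a k) (b k) (c k) z)) \<le> 4 ^ m * (4 * M)"
proof (rule tay_bound)
  let ?T = "\<lambda>k. gexp (- ln (v k)) (a k) (b k) (c k)"
  have M: "M \<ge> 0" using F unfolding edge_bdd_def by (metis norm_ge_zero order_trans)
  show "strip_bdd (\<lambda>z. \<Sum>k\<in>S. F z k * ?T k z)"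
    using F by (intro strip_bdd_sum strip_bdd_mult strip_bdd_gexp) (auto simp: edge_bdd_def)
  fix t
  have T0: "cmod (?T k (Complex 0 t)) \<le> 4 * (v k)\<^sup>2" if "k \<in> S" for k
    using gexp_bound'[of "Complex 0 t" "a k" "v k" "b k" "c k" "- ln (v k)"] ab[OF that] v(1)[OF that]
    by (simp add: closed_strip_def power2_eq_square)
  have "cmod (\<Sum>k\<in>S. F (Complex 0 t) k * ?T k (Complex 0 t)) \<le> (\<Sum>k\<in>S. M * (4 * (v k)\<^sup>2))"
    using F T0 M unfolding edge_bdd_def by (intro sum_norm_le) (auto simp: norm_mult intro!: mult_mono)
  also have "\<dots> = 4 * M * (\<Sum>k\<in>S. (v k)\<^sup>2)" by (simp add: sum_distrib_left mult_ac)
  also have "\<dots> \<le> 4 * M * 1" using v M by (intro mult_left_mono) auto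
  finally show "cmod (\<Sum>k\<in>S. F (Complex 0 t) k * ?T k (Complex 0 t)) \<le> 4 * M" by simp
  have T1: "cmod (?T k (Complex 1 t)) \<le> 4" if "k \<in> S" for k
    using gexp_bound'[of "Complex 1 t" "a k" "v k" "b k" "c k" "- ln (v k)"] ab[OF that] v(1)[OF that]
    by (simp add: closed_strip_def exp_minus)
  have "cmod (\<Sum>k\<in>S. F (Complex 1 t) k * ?T k (Complex 1 t)) \<le> (\<Sum>k\<in>S. cmod (F (Complex 1 t) k) * 4)"
    using T1 by (intro sum_norm_le) (auto simp: norm_mult intro!: mult_left_mono)
  also have "\<dots> = (\<Sum>k\<in>S. cmod (F (Complex 1 t) k)) * 4" by (simp add: sum_distrib_right)
  also have "\<dots> \<le> M * 4" using F S unfolding edge_bdd_def by (intro mult_right_mono) auto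
  finally show "cmod (\<Sum>k\<in>S. F (Complex 1 t) k * ?T k (Complex 1 t)) \<le> 4 * M" by simp
qed

section \<open>The Calderon space of the couple\<close>


lemma zero_scaleC [simp]: "0 *\<^sub>C x = (0 :: 'a::complex_vector)"
proof -
  have "0 *\<^sub>C x = 0 *\<^sub>C x + 0 *\<^sub>C x" using scaleC_add_left[of 0 0 x] by simp
  then show ?thesis by simp
qed

lemma minus_one_scaleC: "(-1) *\<^sub>C x = - (x :: 'a::complex_vector)"
proof -
  have "(-1) *\<^sub>C x + x = 0" using scaleC_add_left[of "-1" 1 x] by (simp add: scaleC_one)
  then show ?thesis by (simp add: eq_neg_iff_add_eq_0)
qed

text \<open>The records carry no norm axioms, so each space has to supply these. Homogeneity is
  stated as an inequality, from which nonnegativity is then derived.\<close>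

definition seminormed :: "'a::complex_vector nspace \<Rightarrow> bool"
  where "seminormed X \<longleftrightarrow>
    (\<forall>x\<in>nset X. \<forall>y\<in>nset X. x + y \<in> nset X \<and> nnorm X (x + y) \<le> nnorm X x + nnorm X y) \<and>
    (\<forall>a. \<forall>x\<in>nset X. a *\<^sub>C x \<in> nset X \<and> nnorm X (a *\<^sub>C x) \<le> cmod a * nnorm X x)"

context
  fixes X :: "'a::complex_vector nspace"
  assumes X: "seminormed X"
begin

lemma sn_add: "x \<in> nset X \<Longrightarrow> y \<in> nset X \<Longrightarrow> x + y \<in> nset X"
  and sn_tri: "x \<in> nset X \<Longrightarrow> y \<in> nset X \<Longrightarrow> nnorm X (x + y) \<le> nnorm X x + nnorm X y"
  and sn_scale: "x \<in> nset X \<Longrightarrow> a *\<^sub>C x \<in> nset X"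
  and sn_norm_scale: "x \<in> nset X \<Longrightarrow> nnorm X (a *\<^sub>C x) \<le> cmod a * nnorm X x"
  using X unfolding seminormed_def by blast+

lemma sn_uminus: "x \<in> nset X \<Longrightarrow> - x \<in> nset X"
  and sn_norm_uminus: "x \<in> nset X \<Longrightarrow> nnorm X (- x) \<le> nnorm X x"
  using sn_scale[of x "-1"] sn_norm_scale[of x "-1"] by (simp_all add: minus_one_scaleC)

lemma sn_diff: "x \<in> nset X \<Longrightarrow> y \<in> nset X \<Longrightarrow> x - y \<in> nset X"
  using sn_add[of x "- y"] sn_uminus by simp

lemma sn_tri_diff: "x \<in> nset X \<Longrightarrow> y \<in> nset X \<Longrightarrow> nnorm X (x - y) \<le> nnorm X x + nnorm X y"
  using sn_tri[of x "- y"] sn_uminus[of y] sn_norm_uminus[of y] by simp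

lemma sn_zero: "x \<in> nset X \<Longrightarrow> 0 \<in> nset X"
  using sn_scale[of x 0] by simp

lemma sn_nonneg: assumes "x \<in> nset X" shows "0 \<le> nnorm X x"
proof -
  have "0 \<in> nset X" using sn_zero assms .
  then have "nnorm X 0 \<le> nnorm X 0 + nnorm X 0" using sn_tri[of 0 0] by simp
  moreover have "nnorm X 0 \<le> nnorm X x + nnorm X x" using sn_tri_diff[OF assms assms] by simp
  ultimately show ?thesis by linarith
qed

lemma sn_norm_diff: assumes "x \<in> nset X" "y \<in> nset X"
  shows "\<bar>nnorm X x - nnorm X y\<bar> \<le> nnorm X (x - y)"
proof -
  have "nnorm X x \<le> nnorm X (x - y) + nnorm X y" using sn_tri[OF sn_diff[OF assms] assms(2)] by simp
  moreover have "nnorm X (y - x) \<le> nnorm X (x - y)" using sn_norm_uminus[OF sn_diff[OF assms]] by simp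
  moreover have "nnorm X y \<le> nnorm X (y - x) + nnorm X x" using sn_tri[OF sn_diff[OF assms(2,1)] assms(1)] by simp
  ultimately show ?thesis by linarith
qed

lemma sn_sum: "(\<And>i. i \<in> A \<Longrightarrow> f i \<in> nset X) \<Longrightarrow> x \<in> nset X \<Longrightarrow> sum f A \<in> nset X"
  by (induction A rule: infinite_finite_induct) (auto intro: sn_add sn_zero)

lemma sn_norm_zero: "x \<in> nset X \<Longrightarrow> nnorm X 0 = 0"
  using sn_norm_scale[of x 0] sn_nonneg[OF sn_zero] by simp

lemma sn_norm_sum:
  "(\<And>i. i \<in> A \<Longrightarrow> f i \<in> nset X) \<Longrightarrow> x \<in> nset X \<Longrightarrow> nnorm X (sum f A) \<le> (\<Sum>i\<in>A. nnorm X (f i))"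
proof (induction A rule: infinite_finite_induct)
  case (insert a A)
  have "nnorm X (f a + sum f A) \<le> nnorm X (f a) + nnorm X (sum f A)"
    using insert by (intro sn_tri sn_sum[of A f x]) auto
  then show ?case using insert by simp
qed (simp_all add: sn_norm_zero)

lemma continuous_into_norm:
  assumes "continuous_into X S F" shows "continuous_on S (\<lambda>t. nnorm X (F t))"
  unfolding continuous_on
proof
  fix z assume z: "z \<in> S"
  have *: "\<forall>w\<in>S. F w \<in> nset X" "((\<lambda>w. nnorm X (F w - F z)) \<longlongrightarrow> 0) (at z within S)"
    using assms z unfolding continuous_into_def by auto
  have "((\<lambda>w. nnorm X (F w) - nnorm X (F z)) \<longlongrightarrow> 0) (at z within S)"
  proof (rule Lim_null_comparison[OF _ *(2)])
    show "\<forall>\<^sub>F w in at z within S. norm (nnorm X (F w) - nnorm X (F z)) \<le> nnorm X (F w - F z)"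
      using * z sn_norm_diff by (auto simp: eventually_at_filter)
  qed
  then show "((\<lambda>w. nnorm X (F w)) \<longlongrightarrow> nnorm X (F z)) (at z within S)" by (rule LIM_zero_cancel)
qed

lemma continuous_into_add:
  assumes "continuous_into X S F" "continuous_into X S G"
  shows "continuous_into X S (\<lambda>z. F z + G z)"
  unfolding continuous_into_def
proof (intro ballI conjI)
  fix z assume z: "z \<in> S"
  have F: "\<forall>w\<in>S. F w \<in> nset X" "((\<lambda>w. nnorm X (F w - F z)) \<longlongrightarrow> 0) (at z within S)"
    and G: "\<forall>w\<in>S. G w \<in> nset X" "((\<lambda>w. nnorm X (G w - G z)) \<longlongrightarrow> 0) (at z within S)"
    using assms z unfolding continuous_into_def by auto
  show "F z + G z \<in> nset X" using F G z sn_add by blast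
  show "((\<lambda>w. nnorm X (F w + G w - (F z + G z))) \<longlongrightarrow> 0) (at z within S)"
  proof (rule Lim_null_comparison)
    show "((\<lambda>w. nnorm X (F w - F z) + nnorm X (G w - G z)) \<longlongrightarrow> 0) (at z within S)"
      using tendsto_add[OF F(2) G(2)] by simp
    have "norm (nnorm X (F w + G w - (F z + G z))) \<le> nnorm X (F w - F z) + nnorm X (G w - G z)" if "w \<in> S" for w
    proof -
      have "F w - F z \<in> nset X" "G w - G z \<in> nset X" using that F G z sn_diff by blast+
      moreover have eq: "F w + G w - (F z + G z) = (F w - F z) + (G w - G z)" by simp
      ultimately show ?thesis using sn_tri[of "F w - F z" "G w - G z"] sn_nonneg[OF sn_add, of "F w - F z" "G w - G z"]
        unfolding eq by simp
    qed
    then show "\<forall>\<^sub>F w in at z within S. norm (nnorm X (F w + G w - (F z + G z))) \<le> nnorm X (F w - F z) + nnorm X (G w - G z)"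
      by (auto simp: eventually_at_filter)
  qed
qed

lemma continuous_into_scale:
  assumes "continuous_into X S F"
  shows "continuous_into X S (\<lambda>z. a *\<^sub>C F z)"
  unfolding continuous_into_def
proof (intro ballI conjI)
  fix z assume z: "z \<in> S"
  have F: "\<forall>w\<in>S. F w \<in> nset X" "((\<lambda>w. nnorm X (F w - F z)) \<longlongrightarrow> 0) (at z within S)"
    using assms z unfolding continuous_into_def by auto
  show "a *\<^sub>C F z \<in> nset X" using F z sn_scale by blast
  show "((\<lambda>w. nnorm X (a *\<^sub>C F w - a *\<^sub>C F z)) \<longlongrightarrow> 0) (at z within S)"
  proof (rule Lim_null_comparison)
    show "((\<lambda>w. cmod a * nnorm X (F w - F z)) \<longlongrightarrow> 0) (at z within S)"
      using tendsto_mult[OF tendsto_const F(2)] by simp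
    have "norm (nnorm X (a *\<^sub>C F w - a *\<^sub>C F z)) \<le> cmod a * nnorm X (F w - F z)" if "w \<in> S" for w
    proof -
      have d: "F w - F z \<in> nset X" using that F z sn_diff by blast
      have "a *\<^sub>C (F w - F z) + a *\<^sub>C F z = a *\<^sub>C F w" by (simp flip: scaleC_add_right)
      then have "a *\<^sub>C F w - a *\<^sub>C F z = a *\<^sub>C (F w - F z)" by (simp add: diff_eq_eq)
      then show ?thesis using sn_norm_scale[OF d] sn_nonneg[OF sn_scale[OF d]] by simp
    qed
    then show "\<forall>\<^sub>F w in at z within S. norm (nnorm X (a *\<^sub>C F w - a *\<^sub>C F z)) \<le> cmod a * nnorm X (F w - F z)"
      by (auto simp: eventually_at_filter)
  qed
qed

lemma edge_mem: "admissible_edge X j F \<Longrightarrow> F (Complex j t) \<in> nset X"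
  unfolding admissible_edge_def continuous_into_def by blast

text \<open>A continuous function tending to 0 at infinity is bounded; this gives meaning to the
  suprema in the Calderon norm.\<close>

lemma edge_bdd_above:
  assumes "admissible_edge X j F" shows "bdd_above (range (\<lambda>t. nnorm X (F (Complex j t))))"
proof -
  let ?f = "\<lambda>t. nnorm X (F (Complex j t))"
  have c: "continuous_on UNIV ?f" and l: "(?f \<longlongrightarrow> 0) at_infinity"
    using assms continuous_into_norm unfolding admissible_edge_def by auto
  have "eventually (\<lambda>t. dist (?f t) 0 < 1) at_infinity" using l tendstoD by fastforce
  then obtain b where b: "\<And>t. b \<le> norm t \<Longrightarrow> dist (?f t) 0 < 1" unfolding eventually_at_infinity by blast
  have "bounded (?f ` cball 0 b)"
    using c by (intro compact_imp_bounded compact_continuous_image continuous_on_subset[OF c]) auto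
  then obtain B where B: "\<And>t. t \<in> cball 0 b \<Longrightarrow> norm (?f t) \<le> B" unfolding bounded_iff by blast
  have "?f t \<le> max 1 B" for t
    using b[of t] B[of t] by (cases "b \<le> norm t") (auto simp: dist_real_def le_max_iff_disj)
  then show ?thesis by (intro bdd_aboveI) auto
qed

lemma edge_add:
  assumes "admissible_edge X j F" "admissible_edge X j G"
  shows "admissible_edge X j (\<lambda>z. F z + G z)"
proof -
  have "((\<lambda>t. nnorm X (F (Complex j t) + G (Complex j t))) \<longlongrightarrow> 0) at_infinity"
  proof (rule Lim_null_comparison)
    show "((\<lambda>t. nnorm X (F (Complex j t)) + nnorm X (G (Complex j t))) \<longlongrightarrow> 0) at_infinity"
      using assms tendsto_add[of "\<lambda>t. nnorm X (F (Complex j t))" 0] unfolding admissible_edge_def by fastforce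
    show "\<forall>\<^sub>F t in at_infinity. norm (nnorm X (F (Complex j t) + G (Complex j t)))
        \<le> nnorm X (F (Complex j t)) + nnorm X (G (Complex j t))"
      using assms sn_tri sn_nonneg[OF sn_add] edge_mem by (intro always_eventually) auto
  qed
  then show ?thesis using assms continuous_into_add unfolding admissible_edge_def by blast
qed

lemma edge_scale:
  assumes "admissible_edge X j F"
  shows "admissible_edge X j (\<lambda>z. a *\<^sub>C F z)"
proof -
  have "((\<lambda>t. nnorm X (a *\<^sub>C F (Complex j t))) \<longlongrightarrow> 0) at_infinity"
  proof (rule Lim_null_comparison)
    show "((\<lambda>t. cmod a * nnorm X (F (Complex j t))) \<longlongrightarrow> 0) at_infinity"
      using assms tendsto_mult[OF tendsto_const, of "\<lambda>t. nnorm X (F (Complex j t))" 0] unfolding admissible_edge_def by fastforce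
    show "\<forall>\<^sub>F t in at_infinity. norm (nnorm X (a *\<^sub>C F (Complex j t))) \<le> cmod a * nnorm X (F (Complex j t))"
      using assms sn_norm_scale sn_nonneg[OF sn_scale] edge_mem by (intro always_eventually) auto
  qed
  then show ?thesis using assms continuous_into_scale unfolding admissible_edge_def by blast
qed

end

section \<open>The spaces \<open>l_inf\<close>, \<open>l_one\<close> and their sum\<close>

lemma l_inf_mem: "x \<in> nset l_inf \<longleftrightarrow> bounded (range x)"
  by (simp add: l_inf_def)

lemma l_inf_coord: assumes "x \<in> nset l_inf" shows "cmod (x n) \<le> nnorm l_inf x"
proof -
  obtain B where "\<And>n. cmod (x n) \<le> B" using assms unfolding l_inf_mem bounded_iff by auto
  then show ?thesis unfolding l_inf_def by (auto intro!: cSUP_upper bdd_aboveI)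
qed

lemma l_inf_le: assumes "\<And>n. cmod (x n) \<le> M" shows "x \<in> nset l_inf" "nnorm l_inf x \<le> M"
  using assms unfolding l_inf_def by (auto simp: bounded_iff intro!: cSUP_least)

lemma l_one_mem: "x \<in> nset l_one \<longleftrightarrow> summable (\<lambda>n. cmod (x n))"
  by (simp add: l_one_def)

lemma l_one_sum: "x \<in> nset l_one \<Longrightarrow> finite S \<Longrightarrow> (\<Sum>k\<in>S. cmod (x k)) \<le> nnorm l_one x"
  unfolding l_one_def by (auto intro: sum_le_suminf)

lemma seminormed_l_inf: "seminormed l_inf"
proof -
  have "x + y \<in> nset l_inf \<and> nnorm l_inf (x + y) \<le> nnorm l_inf x + nnorm l_inf y"
    if "x \<in> nset l_inf" "y \<in> nset l_inf" for x y
  proof -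
    have "cmod ((x + y) n) \<le> nnorm l_inf x + nnorm l_inf y" for n
      using that by (auto intro!: norm_triangle_mono l_inf_coord)
    then show ?thesis using l_inf_le by blast
  qed
  moreover have "a *\<^sub>C x \<in> nset l_inf \<and> nnorm l_inf (a *\<^sub>C x) \<le> cmod a * nnorm l_inf x"
    if "x \<in> nset l_inf" for a x
  proof -
    have "cmod ((a *\<^sub>C x) n) \<le> cmod a * nnorm l_inf x" for n
      using that by (auto simp: scaleC_apply scaleC_complex norm_mult intro!: mult_left_mono l_inf_coord)
    then show ?thesis using l_inf_le by blast
  qed
  ultimately show ?thesis unfolding seminormed_def by blast
qed

lemma seminormed_l_one: "seminormed l_one"
proof -
  have "x + y \<in> nset l_one \<and> nnorm l_one (x + y) \<le> nnorm l_one x + nnorm l_one y"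
    if "x \<in> nset l_one" "y \<in> nset l_one" for x y
  proof -
    have s: "summable (\<lambda>n. cmod (x n))" "summable (\<lambda>n. cmod (y n))" using that l_one_mem by auto
    then have s': "summable (\<lambda>n. cmod (x n) + cmod (y n))" by (rule summable_add)
    have s2: "summable (\<lambda>n. cmod ((x + y) n))"
      by (rule summable_comparison_test'[OF s', of 0]) (auto simp: norm_triangle_ineq)
    have "(\<Sum>n. cmod ((x + y) n)) \<le> (\<Sum>n. cmod (x n) + cmod (y n))"
      by (rule suminf_le[OF _ s2 s']) (auto simp: norm_triangle_ineq)
    also have "\<dots> = (\<Sum>n. cmod (x n)) + (\<Sum>n. cmod (y n))" using s by (rule suminf_add[symmetric])
    finally show ?thesis using s2 by (simp add: l_one_def)
  qed
  moreover have "a *\<^sub>C x \<in> nset l_one \<and> nnorm l_one (a *\<^sub>C x) \<le> cmod a * nnorm l_one x"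
    if "x \<in> nset l_one" for a x
    using that by (simp add: l_one_def scaleC_apply scaleC_complex norm_mult suminf_mult summable_mult)
  ultimately show ?thesis unfolding seminormed_def by blast
qed

lemma l_one_subset: "x \<in> nset l_one \<Longrightarrow> x \<in> nset l_inf" "x \<in> nset l_one \<Longrightarrow> cmod (x n) \<le> nnorm l_one x"
  using l_one_sum[of x "{_}"] by (auto intro: l_inf_le(1))

text \<open>\<open>l_one\<close> embeds contractively into \<open>l_inf\<close>, so the sum adds
  nothing to \<open>l_inf\<close>; for the same reason the two norms agree in
  \<open>Sigma_norm\<close>.\<close>

lemma Sigma_mem: "nset Sigma_space = nset l_inf"
proof -
  have "x \<in> nset Sigma_space" if "x \<in> nset l_inf" for x
  proof -
    have "x = x + 0 \<and> x \<in> nset l_inf \<and> 0 \<in> nset l_one" using that by (simp add: l_one_mem)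
    then show ?thesis unfolding sum_nspace_def by (simp, blast)
  qed
  moreover have "x \<in> nset l_inf" if "x \<in> nset Sigma_space" for x
    using that l_one_subset sn_add[OF seminormed_l_inf] by (auto simp: sum_nspace_def)
  ultimately show ?thesis by blast
qed

lemma Sigma_norm: assumes "x \<in> nset l_inf" shows "nnorm Sigma_space x = nnorm l_inf x"
proof -
  let ?A = "{nnorm l_inf x0 + nnorm l_one x1 | x0 x1. x0 \<in> nset l_inf \<and> x1 \<in> nset l_one \<and> x = x0 + x1}"
  have m: "nnorm l_inf x \<in> ?A"
  proof -
    have "nnorm l_inf x = nnorm l_inf x + nnorm l_one 0 \<and> x \<in> nset l_inf \<and> 0 \<in> nset l_one \<and> x = x + 0"
      using assms by (simp add: l_one_def)
    then show ?thesis by blast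
  qed
  have l: "nnorm l_inf x \<le> a" if "a \<in> ?A" for a
    using that l_one_subset l_inf_coord by (auto intro!: l_inf_le(2) norm_triangle_mono)
  have "Inf ?A = nnorm l_inf x"
    using m l by (intro cInf_eq_minimum) auto
  then show ?thesis by (simp add: sum_nspace_def)
qed

section \<open>Derivatives in the sup norm versus coordinatewise derivatives\<close>

lemma has_cderiv_coord:
  assumes D: "has_cderiv Sigma_space F D z" and r: "r > 0"
    and Fm: "\<And>w. w \<in> ball z r \<Longrightarrow> F w \<in> nset l_inf"
  shows "((\<lambda>w. F w n) has_field_derivative D n) (at z)"
proof -
  have Dm: "D \<in> nset l_inf" using D by (simp add: has_cderiv_def Sigma_mem)
  have "((\<lambda>w. (F w n - F z n) / (w - z) - D n) \<longlongrightarrow> 0) (at z)"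
  proof (rule Lim_null_comparison)
    show "((\<lambda>w. nnorm Sigma_space (inverse (w - z) *\<^sub>C (F w - F z) - D)) \<longlongrightarrow> 0) (at z)"
      using D by (simp add: has_cderiv_def)
    have "cmod ((F w n - F z n) / (w - z) - D n) \<le> nnorm Sigma_space (inverse (w - z) *\<^sub>C (F w - F z) - D)"
      if "w \<in> ball z r" for w
    proof -
      have m: "inverse (w - z) *\<^sub>C (F w - F z) - D \<in> nset l_inf"
        using Fm[OF that] Fm[of z] r Dm
        by (intro sn_diff[OF seminormed_l_inf] sn_scale[OF seminormed_l_inf]) auto
      show ?thesis using l_inf_coord[OF m, of n]
        unfolding Sigma_norm[OF m] by (simp add: scaleC_apply scaleC_complex divide_inverse mult.commute)
    qed
    then show "\<forall>\<^sub>F w in at z. norm ((F w n - F z n) / (w - z) - D n) \<le>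
       nnorm Sigma_space (inverse (w - z) *\<^sub>C (F w - F z) - D)"
      using r unfolding eventually_at by (auto intro!: exI[of _ r] simp: dist_commute)
  qed
  then show ?thesis
    unfolding has_field_derivative_iff by (rule LIM_zero_cancel)
qed

text \<open>Cauchy's estimate for second derivatives is uniform in the coordinate, hence so are the
  Taylor remainders, and the coordinatewise derivatives form a derivative in norm. The last
  conclusion allows the lemma to be applied again to the derivative.\<close>

lemma cderiv_ball:
  assumes r: "r > 0" and hol: "\<And>n. (\<lambda>w. F w n) holomorphic_on ball z r"
    and B: "\<And>w n. w \<in> ball z r \<Longrightarrow> cmod (F w n) \<le> B"
  shows "has_cderiv Sigma_space F (\<lambda>n. deriv (\<lambda>w. F w n) z) z"
    "cderiv Sigma_space F z = (\<lambda>n. deriv (\<lambda>w. F w n) z)"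
    "\<And>w n. w \<in> ball z (r/2) \<Longrightarrow> cmod (deriv (\<lambda>w. F w n) w) \<le> 4 * B / r"
proof -
  let ?D = "\<lambda>n. deriv (\<lambda>w. F w n) z"
  have sub: "cball w (r/4) \<subseteq> ball z r" if "w \<in> ball z (r/2)" for w
  proof
    fix u assume "u \<in> cball w (r/4)"
    then show "u \<in> ball z r" using that r dist_triangle[of z u w] by (simp add: dist_commute)
  qed
  have Ca: "cmod ((deriv ^^ m) (\<lambda>w. F w n) w) \<le> fact m * B / (r/4) ^ m" if w: "w \<in> ball z (r/2)" for m n w
  proof (rule Cauchy_inequality)
    show "(\<lambda>w. F w n) holomorphic_on ball w (r/4)"
      using hol sub[OF w] ball_subset_cball by (meson holomorphic_on_subset order_trans)
    show "continuous_on (cball w (r/4)) (\<lambda>w. F w n)"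
      using hol[of n] sub[OF w] by (meson holomorphic_on_imp_continuous_on continuous_on_subset)
    fix u assume "cmod (w - u) = r/4"
    then have "u \<in> cball w (r/4)" by (simp add: dist_norm)
    then show "cmod (F u n) \<le> B" using B sub[OF w] by blast
  qed (use r in auto)
  show bd: "cmod (deriv (\<lambda>w. F w n) w) \<le> 4 * B / r" if "w \<in> ball z (r/2)" for w n
    using Ca[OF that, of 1 n] by (simp add: field_simps)
  have zz: "z \<in> ball z (r/2)" using r by simp
  have Dm: "?D \<in> nset l_inf" using bd[OF zz] by (rule l_inf_le(1))
  have Fm: "F w \<in> nset l_inf" if "w \<in> ball z r" for w using B[OF that] by (rule l_inf_le(1))
  \<comment> \<open>The Cauchy bound \<open>2 * B / (r/4)\<^sup>2\<close> for second
    derivatives.\<close>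
  define K where "K = 32 * B / r\<^sup>2"
  have T: "cmod (F w n - F z n - ?D n * (w - z)) \<le> K * (cmod (w - z))\<^sup>2" if w: "w \<in> ball z (r/2)" for w n
  proof -
    have "cmod ((deriv ^^ 0) (\<lambda>w. F w n) w - (\<Sum>i\<le>1. (deriv ^^ i) (\<lambda>w. F w n) z * (w - z) ^ i / fact i))
       \<le> K * cmod (w - z) ^ Suc 1 / fact 1"
    proof (rule complex_Taylor[where S = "ball z (r/2)"])
      fix i u assume u: "u \<in> ball z (r/2)"
      have "u \<in> ball z r" using u r by simp
      then have "((deriv ^^ i) (\<lambda>w. F w n) has_field_derivative deriv ((deriv ^^ i) (\<lambda>w. F w n)) u) (at u)"
        using holomorphic_higher_deriv[OF hol[of n], of i] by (intro holomorphic_derivI[of _ "ball z r"]) auto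
      then show "((deriv ^^ i) (\<lambda>w. F w n) has_field_derivative (deriv ^^ Suc i) (\<lambda>w. F w n) u) (at u within ball z (r/2))"
        by (simp add: has_field_derivative_at_within)
    next
      fix u assume "u \<in> ball z (r/2)"
      then show "cmod ((deriv ^^ Suc 1) (\<lambda>w. F w n) u) \<le> K"
        using Ca[of u 2 n] by (simp add: K_def eval_nat_numeral field_simps)
    qed (use w r in auto)
    then show ?thesis by (simp add: power2_eq_square algebra_simps)
  qed
  show has: "has_cderiv Sigma_space F ?D z"
    unfolding has_cderiv_def Sigma_mem
  proof (rule conjI[OF Dm], rule Lim_null_comparison)
    show "((\<lambda>w. K * cmod (w - z)) \<longlongrightarrow> 0) (at z)"
      by (rule tendsto_eq_intros refl | simp)+
    have "norm (nnorm Sigma_space (inverse (w - z) *\<^sub>C (F w - F z) - ?D)) \<le> K * cmod (w - z)"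
      if w: "w \<in> ball z (r/2)" "w \<noteq> z" for w
    proof -
      let ?q = "inverse (w - z) *\<^sub>C (F w - F z) - ?D"
      have "cmod (?q n) \<le> K * cmod (w - z)" for n
      proof -
        have "?q n = inverse (w - z) * (F w n - F z n - ?D n * (w - z))"
          using w by (simp add: scaleC_apply scaleC_complex field_simps)
        then have "cmod (?q n) = inverse (cmod (w - z)) * cmod (F w n - F z n - ?D n * (w - z))"
          by (simp add: norm_mult norm_inverse)
        also have "\<dots> \<le> inverse (cmod (w - z)) * (K * (cmod (w - z))\<^sup>2)"
          by (intro mult_left_mono T w) auto
        also have "\<dots> = K * cmod (w - z)" using w by (simp add: power2_eq_square field_simps)
        finally show ?thesis .
      qed
      then have "?q \<in> nset l_inf" "nnorm l_inf ?q \<le> K * cmod (w - z)" by (rule l_inf_le)+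
      then show ?thesis
        using sn_nonneg[OF seminormed_l_inf] by (simp only: Sigma_norm real_norm_def abs_of_nonneg)
    qed
    then show "\<forall>\<^sub>F w in at z. norm (nnorm Sigma_space (inverse (w - z) *\<^sub>C (F w - F z) - ?D)) \<le> K * cmod (w - z)"
      using r unfolding eventually_at by (auto intro!: exI[of _ "r/2"] simp: dist_commute)
  qed
  have "D = ?D" if D: "has_cderiv Sigma_space F D z" for D
    using has_cderiv_coord[OF D r] Fm by (auto intro!: ext DERIV_imp_deriv[symmetric])
  then show "cderiv Sigma_space F z = ?D"
    unfolding cderiv_def using has by (intro the_equality)
qed


section \<open>Membership and norm in the Calderon space\<close>

lemma C_unfold: "F \<in> nset C_space \<longleftrightarrow> (\<forall>z. z \<notin> closed_strip \<longrightarrow> F z = 0) \<and>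
    continuous_into Sigma_space closed_strip F \<and>
    (\<exists>B. \<forall>z\<in>closed_strip. nnorm Sigma_space (F z) \<le> B) \<and>
    analytic_into Sigma_space open_strip F \<and>
    admissible_edge l_inf 0 F \<and> admissible_edge l_one 1 F"
  by (simp add: calderon_def)

lemma C_zero_outside: "F \<in> nset C_space \<Longrightarrow> z \<notin> closed_strip \<Longrightarrow> F z = 0"
  by (simp add: C_unfold)

lemma C_mem: "F \<in> nset C_space \<Longrightarrow> z \<in> closed_strip \<Longrightarrow> F z \<in> nset l_inf"
  by (simp add: C_unfold continuous_into_def Sigma_mem)

lemma C_bounded:
  assumes "F \<in> nset C_space"
  obtains B where "\<And>z k. z \<in> closed_strip \<Longrightarrow> cmod (F z k) \<le> B"
proof -
  obtain B where "\<And>z. z \<in> closed_strip \<Longrightarrow> nnorm Sigma_space (F z) \<le> B"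
    using assms by (auto simp: C_unfold)
  then have "cmod (F z k) \<le> B" if "z \<in> closed_strip" for z k
    using that l_inf_coord[OF C_mem[OF assms that]] Sigma_norm[OF C_mem[OF assms that]] by (metis order_trans)
  then show ?thesis by (rule that)
qed

lemma C_strip_bdd:
  assumes F: "F \<in> nset C_space" shows "strip_bdd (\<lambda>z. F z k)"
proof -
  have "continuous_on closed_strip (\<lambda>z. F z k)"
    unfolding continuous_on
  proof
    fix z assume z: "z \<in> closed_strip"
    have c: "((\<lambda>w. nnorm Sigma_space (F w - F z)) \<longlongrightarrow> 0) (at z within closed_strip)"
      using F z unfolding C_unfold continuous_into_def by blast
    have "((\<lambda>w. F w k - F z k) \<longlongrightarrow> 0) (at z within closed_strip)"
    proof (rule Lim_null_comparison[OF _ c])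
      have "cmod (F w k - F z k) \<le> nnorm Sigma_space (F w - F z)" if "w \<in> closed_strip" for w
      proof -
        have m: "F w - F z \<in> nset l_inf" using C_mem[OF F] z that sn_diff[OF seminormed_l_inf] by blast
        show ?thesis using l_inf_coord[OF m, of k] by (simp add: Sigma_norm[OF m])
      qed
      then show "\<forall>\<^sub>F w in at z within closed_strip. norm (F w k - F z k) \<le> nnorm Sigma_space (F w - F z)"
        by (auto simp: eventually_at_filter)
    qed
    then show "((\<lambda>w. F w k) \<longlongrightarrow> F z k) (at z within closed_strip)" by (rule LIM_zero_cancel)
  qed
  moreover have "(\<lambda>z. F z k) holomorphic_on open_strip"
    unfolding holomorphic_on_open[OF open_open_strip]
  proof
    fix z assume z: "z \<in> open_strip"
    then obtain D where D: "has_cderiv Sigma_space F D z" using F unfolding C_unfold analytic_into_def by blast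
    obtain r where r: "r > 0" "ball z r \<subseteq> open_strip" using z open_open_strip open_contains_ball by blast
    have "((\<lambda>z. F z k) has_field_derivative D k) (at z)"
      using r open_subset_closed_strip C_mem[OF F] by (intro has_cderiv_coord[OF D r(1)]) blast
    then show "\<exists>f'. ((\<lambda>z. F z k) has_field_derivative f') (at z)" ..
  qed
  moreover have "bounded ((\<lambda>z. F z k) ` closed_strip)"
    using C_bounded[OF F] unfolding bounded_iff by (metis imageE)
  ultimately show ?thesis by (simp add: strip_bdd_def)
qed

lemma C_edges: "F \<in> nset C_space \<Longrightarrow> admissible_edge l_inf 0 F" "F \<in> nset C_space \<Longrightarrow> admissible_edge l_one 1 F"
  by (simp_all add: C_unfold)

lemma C_norm_def: "nnorm C_space F = max (SUP t. nnorm l_inf (F (Complex 0 t))) (SUP t. nnorm l_one (F (Complex 1 t)))"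
  by (simp add: calderon_def)

lemma C_norm_ge:
  assumes F: "F \<in> nset C_space"
  shows "nnorm l_inf (F (Complex 0 t)) \<le> nnorm C_space F" "nnorm l_one (F (Complex 1 t)) \<le> nnorm C_space F"
  unfolding C_norm_def
  using cSUP_upper[OF UNIV_I edge_bdd_above[OF seminormed_l_inf C_edges(1)[OF F]], of t]
    cSUP_upper[OF UNIV_I edge_bdd_above[OF seminormed_l_one C_edges(2)[OF F]], of t] by auto

lemma C_norm_le:
  assumes "\<And>t. nnorm l_inf (F (Complex 0 t)) \<le> M" "\<And>t. nnorm l_one (F (Complex 1 t)) \<le> M"
  shows "nnorm C_space F \<le> M"
  unfolding C_norm_def using assms by (intro max.boundedI cSUP_least) auto

lemma C_edge_bdd:
  assumes F: "F \<in> nset C_space" shows "edge_bdd F (nnorm C_space F)"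
proof -
  have "cmod (F (Complex 0 t) k) \<le> nnorm C_space F" for t k
    using l_inf_coord[OF edge_mem[OF seminormed_l_inf C_edges(1)[OF F]]] C_norm_ge(1)[OF F] order_trans by blast
  moreover have "(\<Sum>k\<in>S. cmod (F (Complex 1 t) k)) \<le> nnorm C_space F" if "finite S" for t S
    using l_one_sum[OF edge_mem[OF seminormed_l_one C_edges(2)[OF F]] that] C_norm_ge(2)[OF F] order_trans by blast
  ultimately show ?thesis using C_strip_bdd[OF F] by (auto simp: edge_bdd_def)
qed

lemma continuous_into_Sigma: "continuous_into Sigma_space S F \<longleftrightarrow> continuous_into l_inf S F"
proof -
  have "((\<lambda>w. nnorm Sigma_space (F w - F z)) \<longlongrightarrow> 0) (at z within S) \<longleftrightarrow> ((\<lambda>w. nnorm l_inf (F w - F z)) \<longlongrightarrow> 0) (at z within S)"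
    if "\<forall>z\<in>S. F z \<in> nset l_inf" "z \<in> S" for z
  proof (rule tendsto_cong)
    have "nnorm Sigma_space (F w - F z) = nnorm l_inf (F w - F z)" if "w \<in> S" for w
      using that \<open>\<forall>z\<in>S. F z \<in> nset l_inf\<close> \<open>z \<in> S\<close> by (intro Sigma_norm sn_diff[OF seminormed_l_inf]) auto
    then show "\<forall>\<^sub>F w in at z within S. nnorm Sigma_space (F w - F z) = nnorm l_inf (F w - F z)"
      by (auto simp: eventually_at_filter)
  qed
  then show ?thesis unfolding continuous_into_def Sigma_mem by blast
qed

text \<open>Through \<open>cderiv_ball\<close>, scalar holomorphy of the coordinates and one uniform
  bound give analyticity into the sum space.\<close>

lemma C_spaceI:
  assumes "\<And>z. z \<notin> closed_strip \<Longrightarrow> F z = 0"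
    and cont: "continuous_into l_inf closed_strip F"
    and B: "\<And>z k. z \<in> closed_strip \<Longrightarrow> cmod (F z k) \<le> B"
    and hol: "\<And>k. (\<lambda>z. F z k) holomorphic_on open_strip"
    and "admissible_edge l_inf 0 F" "admissible_edge l_one 1 F"
  shows "F \<in> nset C_space"
proof -
  have "nnorm Sigma_space (F z) \<le> B" if "z \<in> closed_strip" for z
    using l_inf_le[OF B[OF that]] by (simp add: Sigma_norm)
  moreover have "analytic_into Sigma_space open_strip F"
    unfolding analytic_into_def Sigma_mem
  proof (intro ballI conjI)
    fix z assume z: "z \<in> open_strip"
    show "F z \<in> nset l_inf" using B z open_subset_closed_strip by (intro l_inf_le(1)) blast
    obtain r where r: "r > 0" "ball z r \<subseteq> open_strip" using z open_open_strip open_contains_ball by blast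
    have "has_cderiv Sigma_space F (\<lambda>n. deriv (\<lambda>w. F w n) z) z"
    proof (rule cderiv_ball(1)[OF r(1)])
      show "(\<lambda>w. F w n) holomorphic_on ball z r" for n using hol r(2) by (rule holomorphic_on_subset)
      show "cmod (F w n) \<le> B" if "w \<in> ball z r" for w n using B that r(2) open_subset_closed_strip by blast
    qed
    then show "\<exists>D. has_cderiv Sigma_space F D z" by blast
  qed
  ultimately show ?thesis using assms unfolding C_unfold continuous_into_Sigma by blast
qed

lemma seminormed_C: "seminormed C_space"
proof -
  have "F + G \<in> nset C_space \<and> nnorm C_space (F + G) \<le> nnorm C_space F + nnorm C_space G"
    if F: "F \<in> nset C_space" and G: "G \<in> nset C_space" for F G
  proof
    obtain B1 where B1: "\<And>z k. z \<in> closed_strip \<Longrightarrow> cmod (F z k) \<le> B1" using C_bounded[OF F] by blast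
    obtain B2 where B2: "\<And>z k. z \<in> closed_strip \<Longrightarrow> cmod (G z k) \<le> B2" using C_bounded[OF G] by blast
    show "F + G \<in> nset C_space"
    proof (rule C_spaceI)
      show "(F + G) z = 0" if "z \<notin> closed_strip" for z using C_zero_outside[OF F that] C_zero_outside[OF G that] by (auto simp: fun_eq_iff)
      show "continuous_into l_inf closed_strip (F + G)"
        using F G unfolding plus_fun_def[of F G] C_unfold continuous_into_Sigma
        by (intro continuous_into_add[OF seminormed_l_inf]) auto
      show "cmod ((F + G) z k) \<le> B1 + B2" if "z \<in> closed_strip" for z k
        using B1[OF that] B2[OF that] by (auto intro: norm_triangle_mono)
      show "(\<lambda>z. (F + G) z k) holomorphic_on open_strip" for k
        using C_strip_bdd[OF F, of k] C_strip_bdd[OF G, of k]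
        by (auto simp: strip_bdd_def intro!: holomorphic_intros)
      show "admissible_edge l_inf 0 (F + G)"
        unfolding plus_fun_def[of F G] by (intro edge_add seminormed_l_inf C_edges F G)
      show "admissible_edge l_one 1 (F + G)"
        unfolding plus_fun_def[of F G] by (intro edge_add seminormed_l_one C_edges F G)
    qed
    show "nnorm C_space (F + G) \<le> nnorm C_space F + nnorm C_space G"
    proof (rule C_norm_le)
      fix t
      show "nnorm l_inf ((F + G) (Complex 0 t)) \<le> nnorm C_space F + nnorm C_space G"
        using sn_tri[OF seminormed_l_inf edge_mem[OF seminormed_l_inf C_edges(1)[OF F]] edge_mem[OF seminormed_l_inf C_edges(1)[OF G]], of t t]
          C_norm_ge(1)[OF F, of t] C_norm_ge(1)[OF G, of t] by simp
      show "nnorm l_one ((F + G) (Complex 1 t)) \<le> nnorm C_space F + nnorm C_space G"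
        using sn_tri[OF seminormed_l_one edge_mem[OF seminormed_l_one C_edges(2)[OF F]] edge_mem[OF seminormed_l_one C_edges(2)[OF G]], of t t]
          C_norm_ge(2)[OF F, of t] C_norm_ge(2)[OF G, of t] by simp
    qed
  qed
  moreover have "a *\<^sub>C F \<in> nset C_space \<and> nnorm C_space (a *\<^sub>C F) \<le> cmod a * nnorm C_space F"
    if F: "F \<in> nset C_space" for a F
  proof
    obtain B1 where B1: "\<And>z k. z \<in> closed_strip \<Longrightarrow> cmod (F z k) \<le> B1" using C_bounded[OF F] by blast
    show "a *\<^sub>C F \<in> nset C_space"
    proof (rule C_spaceI)
      show "(a *\<^sub>C F) z = 0" if "z \<notin> closed_strip" for z
        using that F C_zero_outside by (auto simp: scaleC_apply scaleC_complex fun_eq_iff)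
      show "continuous_into l_inf closed_strip (a *\<^sub>C F)"
        using F unfolding scaleC_fun_def[of a F] C_unfold continuous_into_Sigma
        by (intro continuous_into_scale[OF seminormed_l_inf]) auto
      show "cmod ((a *\<^sub>C F) z k) \<le> cmod a * B1" if "z \<in> closed_strip" for z k
        using B1[OF that] by (auto simp: scaleC_apply scaleC_complex norm_mult intro!: mult_left_mono)
      show "(\<lambda>z. (a *\<^sub>C F) z k) holomorphic_on open_strip" for k
        using C_strip_bdd[OF F, of k]
        by (auto simp: scaleC_apply scaleC_complex strip_bdd_def intro!: holomorphic_intros)
      show "admissible_edge l_inf 0 (a *\<^sub>C F)"
        unfolding scaleC_fun_def[of a F] by (intro edge_scale seminormed_l_inf C_edges F)
      show "admissible_edge l_one 1 (a *\<^sub>C F)"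
        unfolding scaleC_fun_def[of a F] by (intro edge_scale seminormed_l_one C_edges F)
    qed
    show "nnorm C_space (a *\<^sub>C F) \<le> cmod a * nnorm C_space F"
    proof (rule C_norm_le)
      fix t
      show "nnorm l_inf ((a *\<^sub>C F) (Complex 0 t)) \<le> cmod a * nnorm C_space F"
        unfolding scaleC_fun_def[of a F]
        by (rule order_trans[OF sn_norm_scale[OF seminormed_l_inf edge_mem[OF seminormed_l_inf C_edges(1)[OF F]]]])
          (intro mult_left_mono C_norm_ge F norm_ge_zero)
      show "nnorm l_one ((a *\<^sub>C F) (Complex 1 t)) \<le> cmod a * nnorm C_space F"
        unfolding scaleC_fun_def[of a F]
        by (rule order_trans[OF sn_norm_scale[OF seminormed_l_one edge_mem[OF seminormed_l_one C_edges(2)[OF F]]]])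
          (intro mult_left_mono C_norm_ge F norm_ge_zero)
    qed
  qed
  ultimately show ?thesis unfolding seminormed_def by blast
qed

text \<open>Reduces iterated norm derivatives to scalar Taylor coefficients, after which only
  one-variable complex analysis is used. For the second order \<open>cderiv_ball\<close> is applied
  to the derivative, on half the disc because its bound is available only there.\<close>

lemma Delta_tay:
  assumes F: "F \<in> nset C_space"
  shows "Delta 0 F = (\<lambda>n. tay 0 (\<lambda>z. F z n))" "Delta 1 F = (\<lambda>n. tay 1 (\<lambda>z. F z n))"
    "Delta 2 F = (\<lambda>n. tay 2 (\<lambda>z. F z n))"
proof -
  obtain B where B: "\<And>z k. z \<in> closed_strip \<Longrightarrow> cmod (F z k) \<le> B" using C_bounded[OF F] by blast
  have hol: "(\<lambda>z. F z n) holomorphic_on open_strip" for n using C_strip_bdd[OF F] by (simp add: strip_bdd_def)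
  have cd: "cderiv Sigma_space F w = (\<lambda>n. deriv (\<lambda>z. F z n) w)" if w: "w \<in> open_strip" for w
  proof -
    obtain r where r: "r > 0" "ball w r \<subseteq> open_strip" using w open_open_strip open_contains_ball by blast
    show ?thesis
    proof (rule cderiv_ball(2)[OF r(1)])
      show "(\<lambda>w. F w n) holomorphic_on ball w r" for n using hol r(2) by (rule holomorphic_on_subset)
      show "cmod (F u n) \<le> B" if "u \<in> ball w r" for u n using B that r(2) open_subset_closed_strip by blast
    qed
  qed
  show "Delta 0 F = (\<lambda>n. tay 0 (\<lambda>z. F z n))"
    by (simp add: Delta_def tay_def scaleC_one)
  show "Delta 1 F = (\<lambda>n. tay 1 (\<lambda>z. F z n))"
    by (simp add: Delta_def tay_def scaleC_one cd)
  have bs: "ball (1/2) (1/4) \<subseteq> open_strip" using cball_in_open_strip ball_subset_cball by (rule order_trans[rotated])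
  have db: "cmod (deriv (\<lambda>w. F w n) w) \<le> 4 * B / (1/4)" if "w \<in> ball (1/2) (1/4/2)" for w n
  proof (rule cderiv_ball(3)[OF _ _ _ that])
    show "(\<lambda>w. F w n) holomorphic_on ball (1/2) (1/4)" for n using hol bs by (rule holomorphic_on_subset)
    show "cmod (F u n) \<le> B" if "u \<in> ball (1/2) (1/4)" for u n using B that bs open_subset_closed_strip by blast
  qed simp
  let ?G = "cderiv Sigma_space F"
  have bs2: "ball (1/2) (1/8) \<subseteq> open_strip" using bs subset_ball[of "1/8" "1/4" "1/2::complex"] by simp
  have "cderiv Sigma_space ?G (1/2) = (\<lambda>n. deriv (\<lambda>w. ?G w n) (1/2))"
  proof (rule cderiv_ball(2)[of "1/8"])
    show "(\<lambda>w. ?G w n) holomorphic_on ball (1/2) (1/8)" for n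
    proof (rule holomorphic_transform[of "deriv (\<lambda>z. F z n)"])
      show "deriv (\<lambda>z. F z n) holomorphic_on ball (1/2) (1/8)"
        using holomorphic_deriv[OF hol open_open_strip] bs2 by (rule holomorphic_on_subset)
    qed (use cd bs2 in auto)
    show "cmod (?G w n) \<le> 4 * B / (1/4)" if "w \<in> ball (1/2) (1/8)" for w n
      using db[of w n] that cd[of w] bs2 by auto
  qed simp
  \<comment> \<open>\<open>cderiv\<close> is known to act coordinatewise only inside the open strip;
    agreement near 1/2 determines the next derivative.\<close>
  moreover have "deriv (\<lambda>w. ?G w n) (1/2) = deriv (deriv (\<lambda>z. F z n)) (1/2)" for n
  proof (rule deriv_cong_ev)
    show "\<forall>\<^sub>F x in nhds (1/2). ?G x n = deriv (\<lambda>z. F z n) x"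
      using eventually_nhds_in_open[OF open_open_strip half_in_open_strip] by eventually_elim (simp add: cd)
  qed simp
  ultimately show "Delta 2 F = (\<lambda>n. tay 2 (\<lambda>z. F z n))"
    by (simp add: Delta_def tay_def fun_eq_iff scaleC_apply scaleC_complex eval_nat_numeral)
qed

section \<open>Lower and upper estimates\<close>


lemma tay_test_sum:
  assumes F: "edge_bdd F M"
  shows "tay 0 (\<lambda>z. \<Sum>k\<in>S. F z k * gexp (D k) (a k) (b k) (c k) z) =
      (\<Sum>k\<in>S. tay 0 (\<lambda>z. F z k) * a k)"
    "tay 1 (\<lambda>z. \<Sum>k\<in>S. F z k * gexp (D k) (a k) (b k) (c k) z) =
      (\<Sum>k\<in>S. tay 0 (\<lambda>z. F z k) * (b k + 2 * of_real (D k) * a k) + tay 1 (\<lambda>z. F z k) * a k)"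
    "tay 2 (\<lambda>z. \<Sum>k\<in>S. F z k * gexp (D k) (a k) (b k) (c k) z) =
      (\<Sum>k\<in>S. tay 0 (\<lambda>z. F z k) * (c k + 2 * of_real (D k) * b k + (2 * (of_real (D k))\<^sup>2 + 1) * a k)
        + tay 1 (\<lambda>z. F z k) * (b k + 2 * of_real (D k) * a k) + tay 2 (\<lambda>z. F z k) * a k)"
proof -
  have sb: "strip_bdd (\<lambda>z. F z k)" for k using F by (simp add: edge_bdd_def)
  have ts: "tay m (\<lambda>z. \<Sum>k\<in>S. F z k * gexp (D k) (a k) (b k) (c k) z) =
    (\<Sum>k\<in>S. tay m (\<lambda>z. F z k * gexp (D k) (a k) (b k) (c k) z))" for m
    by (intro tay_sum strip_bdd_mult sb strip_bdd_gexp)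
  note tm = tay_mult[OF sb strip_bdd_gexp]
  show "tay 0 (\<lambda>z. \<Sum>k\<in>S. F z k * gexp (D k) (a k) (b k) (c k) z) =
      (\<Sum>k\<in>S. tay 0 (\<lambda>z. F z k) * a k)"
    unfolding ts by (intro sum.cong refl) (simp only: tm tay_gexp)
  show "tay 1 (\<lambda>z. \<Sum>k\<in>S. F z k * gexp (D k) (a k) (b k) (c k) z) =
      (\<Sum>k\<in>S. tay 0 (\<lambda>z. F z k) * (b k + 2 * of_real (D k) * a k) + tay 1 (\<lambda>z. F z k) * a k)"
    unfolding ts by (intro sum.cong refl) (simp only: tm tay_gexp)
  show "tay 2 (\<lambda>z. \<Sum>k\<in>S. F z k * gexp (D k) (a k) (b k) (c k) z) =
      (\<Sum>k\<in>S. tay 0 (\<lambda>z. F z k) * (c k + 2 * of_real (D k) * b k + (2 * (of_real (D k))\<^sup>2 + 1) * a k)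
        + tay 1 (\<lambda>z. F z k) * (b k + 2 * of_real (D k) * a k) + tay 2 (\<lambda>z. F z k) * a k)"
    unfolding ts by (intro sum.cong refl) (simp only: tm tay_gexp)
qed

text \<open>Self-duality of \<open>l2\<close> on finite sets, tested with the normalized conjugate.
  Only nonzero entries occur because their logarithms enter the test functions.\<close>

lemma l2_leI:
  assumes *: "\<And>S a. finite S \<Longrightarrow> (\<And>k. k \<in> S \<Longrightarrow> a k \<noteq> 0) \<Longrightarrow> (\<Sum>k\<in>S. (cmod (a k))\<^sup>2) \<le> 1 \<Longrightarrow>
     cmod (\<Sum>k\<in>S. x k * a k) \<le> r"
  shows "l2_le x r"
  unfolding l2_le_def
proof (intro allI impI)
  fix S :: "nat set" assume S: "finite S"
  define s where "s = sqrt (\<Sum>k\<in>S. (cmod (x k))\<^sup>2)"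
  have s2: "s\<^sup>2 = (\<Sum>k\<in>S. (cmod (x k))\<^sup>2)" by (simp add: s_def sum_nonneg)
  have s0: "s \<ge> 0" by (simp add: s_def sum_nonneg)
  show "(\<Sum>k\<in>S. (cmod (x k))\<^sup>2) \<le> r\<^sup>2"
  proof (cases "s = 0")
    case False
    let ?S = "{k\<in>S. x k \<noteq> 0}"
    have SS: "(\<Sum>k\<in>?S. (cmod (x k))\<^sup>2) = s\<^sup>2"
      unfolding s2 by (rule sum.mono_neutral_left) (use S in auto)
    have "cmod (\<Sum>k\<in>?S. x k * (cnj (x k) / of_real s)) \<le> r"
    proof (rule *)
      have "(\<Sum>k\<in>?S. (cmod (cnj (x k) / of_real s))\<^sup>2) = (\<Sum>k\<in>?S. (cmod (x k))\<^sup>2) / s\<^sup>2"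
        by (simp add: norm_divide power_divide sum_divide_distrib)
      then show "(\<Sum>k\<in>?S. (cmod (cnj (x k) / of_real s))\<^sup>2) \<le> 1" using SS False by simp
    qed (use S False in auto)
    moreover have "(\<Sum>k\<in>?S. x k * (cnj (x k) / of_real s)) = of_real ((\<Sum>k\<in>?S. (cmod (x k))\<^sup>2) / s)"
      by (simp add: sum_divide_distrib complex_norm_square del: of_real_power)
    ultimately have "cmod (of_real ((\<Sum>k\<in>?S. (cmod (x k))\<^sup>2) / s)) \<le> r" by metis
    then have "s \<le> r" unfolding norm_of_real SS using False s0 by (simp add: power2_eq_square)
    then have "s\<^sup>2 \<le> r\<^sup>2" using s0 by (intro power_mono)
    then show ?thesis by (simp add: s2)
  qed (use s2 in simp)
qed

text \<open>When all lower coefficients of \<open>F\<close> vanish, coefficient \<open>m\<close> of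
  the pairing is just \<open>tay m\<close> of \<open>F\<close> against \<open>a\<close>, so
  \<open>b = c = 0\<close> already tests all of \<open>l2\<close>. The factor 64 is a common
  majorant of \<open>4 ^ m\<close>.\<close>

lemma lower_l2:
  assumes F: "edge_bdd F M"
  shows "l2_le (\<lambda>k. tay 0 (\<lambda>z. F z k)) (64 * (4 * M))"
    "(\<And>k. tay 0 (\<lambda>z. F z k) = 0) \<Longrightarrow> l2_le (\<lambda>k. tay 1 (\<lambda>z. F z k)) (64 * (4 * M))"
    "(\<And>k. tay 0 (\<lambda>z. F z k) = 0) \<Longrightarrow> (\<And>k. tay 1 (\<lambda>z. F z k) = 0) \<Longrightarrow>
       l2_le (\<lambda>k. tay 2 (\<lambda>z. F z k)) (4 ^ 2 * (4 * M))"
proof -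
  have M: "M \<ge> 0" using F unfolding edge_bdd_def by (metis norm_ge_zero order_trans)
  have tb: "cmod (tay m (\<lambda>z. \<Sum>k\<in>S. F z k * gexp (- ln (cmod (a k))) (a k) 0 0 z)) \<le> 4 ^ m * (4 * M)"
    if "finite S" "\<And>k. k \<in> S \<Longrightarrow> a k \<noteq> 0" "(\<Sum>k\<in>S. (cmod (a k))\<^sup>2) \<le> 1" for S a m
    using that by (intro test_function_bound[OF F]) auto
  show "l2_le (\<lambda>k. tay 0 (\<lambda>z. F z k)) (64 * (4 * M))"
  proof (rule l2_leI)
    fix S and a :: cseq assume "finite S" "\<And>k. k \<in> S \<Longrightarrow> a k \<noteq> 0" "(\<Sum>k\<in>S. (cmod (a k))\<^sup>2) \<le> 1"
    from tb[OF this, of 0] show "cmod (\<Sum>k\<in>S. tay 0 (\<lambda>z. F z k) * a k) \<le> 64 * (4 * M)"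
      unfolding tay_test_sum[OF F] using M by simp
  qed
  show "l2_le (\<lambda>k. tay 1 (\<lambda>z. F z k)) (64 * (4 * M))" if 0: "\<And>k. tay 0 (\<lambda>z. F z k) = 0"
  proof (rule l2_leI)
    fix S and a :: cseq assume "finite S" "\<And>k. k \<in> S \<Longrightarrow> a k \<noteq> 0" "(\<Sum>k\<in>S. (cmod (a k))\<^sup>2) \<le> 1"
    from tb[OF this, of 1] show "cmod (\<Sum>k\<in>S. tay 1 (\<lambda>z. F z k) * a k) \<le> 64 * (4 * M)"
      unfolding tay_test_sum[OF F] using M by (simp add: 0)
  qed
  show "l2_le (\<lambda>k. tay 2 (\<lambda>z. F z k)) (4 ^ 2 * (4 * M))"
    if 0: "\<And>k. tay 0 (\<lambda>z. F z k) = 0" and 1: "\<And>k. tay 1 (\<lambda>z. F z k) = 0"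
  proof (rule l2_leI)
    fix S and a :: cseq assume "finite S" "\<And>k. k \<in> S \<Longrightarrow> a k \<noteq> 0" "(\<Sum>k\<in>S. (cmod (a k))\<^sup>2) \<le> 1"
    from tb[OF this, of 2] show "cmod (\<Sum>k\<in>S. tay 2 (\<lambda>z. F z k) * a k) \<le> 4 ^ 2 * (4 * M)"
      unfolding tay_test_sum[OF F] by (simp only: 0 1 mult_zero_left add_0)
  qed
qed

lemma test_leI:
  assumes *: "\<And>S y. finite S \<Longrightarrow> (\<And>k. k \<in> S \<Longrightarrow> 0 < cmod (y k) \<and> cmod (y k) \<le> exp (-1)) \<Longrightarrow>
     (\<Sum>k\<in>S. (orl (cmod (y k)))\<^sup>2) \<le> 1 \<Longrightarrow>
     cmod (\<Sum>k\<in>S. x k * cnj (y k) * (ln (orl (cmod (y k))))\<^sup>2) \<le> r"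
  shows "test_le x r"
  unfolding test_le_def
proof (intro allI impI)
  fix S and y :: cseq
  assume S: "finite S" "\<forall>k\<in>S. cmod (y k) \<le> exp (-1)" "(\<Sum>k\<in>S. (orl (cmod (y k)))\<^sup>2) \<le> 1"
  let ?S = "{k\<in>S. y k \<noteq> 0}"
  have "(\<Sum>k\<in>S. x k * cnj (y k) * (ln (orl (cmod (y k))))\<^sup>2) = (\<Sum>k\<in>?S. x k * cnj (y k) * (ln (orl (cmod (y k))))\<^sup>2)"
    by (rule sum.mono_neutral_right) (use S in auto)
  moreover have "(\<Sum>k\<in>?S. (orl (cmod (y k)))\<^sup>2) \<le> (\<Sum>k\<in>S. (orl (cmod (y k)))\<^sup>2)"
    by (rule sum_mono2) (use S in auto)
  ultimately show "cmod (\<Sum>k\<in>S. x k * cnj (y k) * (ln (orl (cmod (y k))))\<^sup>2) \<le> r"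
    using *[of ?S y] S by auto
qed

text \<open>For \<open>v = orl (cmod y)\<close> and \<open>D = - ln v\<close>, both \<open>y\<close>
  and \<open>2 * D * y\<close> are admissible coefficients of size \<open>v\<close>. The factor 2 in
  \<open>orl\<close> is there for the second.\<close>

lemma orl_coeff:
  assumes y: "0 < cmod y" "cmod y \<le> exp (-1)"
  shows "0 < orl (cmod y)" "cmod y \<le> orl (cmod y)"
    "0 \<le> - ln (orl (cmod y))" "2 * cmod y * (- ln (orl (cmod y))) \<le> orl (cmod y)"
proof -
  show "0 < orl (cmod y)" using orl_pos[OF y] .
  show "cmod y \<le> orl (cmod y)" using orl_ge[OF y] y by linarith
  show "0 \<le> - ln (orl (cmod y))" using ln_orl(1)[OF y] one_le_neg_ln[OF y] by linarith
  show "2 * cmod y * (- ln (orl (cmod y))) \<le> orl (cmod y)"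
    unfolding orl_def[of "cmod y"] using ln_orl(2)[OF y] y
    by (intro mult_left_mono) (auto simp: orl_def)
qed

text \<open>
  The coefficients of \<open>gexp\<close> are chosen so that the Leibniz rule leaves only the term with the squared
  logarithm: for vanishing \<open>F'' (1/2)\<close>, for instance, the test function has vanishing derivative at \<open>1/2\<close>.
\<close>

lemma lower_test:
  assumes F: "edge_bdd F M"
  shows "(\<And>k. tay 1 (\<lambda>z. F z k) = 0) \<Longrightarrow> test_le (\<lambda>k. tay 0 (\<lambda>z. F z k)) (32 * (4 * M))"
    "(\<And>k. tay 2 (\<lambda>z. F z k) = 0) \<Longrightarrow> test_le (\<lambda>k. tay 0 (\<lambda>z. F z k)) (32 * (4 * M))"
    "(\<And>k. tay 0 (\<lambda>z. F z k) = 0) \<Longrightarrow> (\<And>k. tay 2 (\<lambda>z. F z k) = 0) \<Longrightarrow>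
       test_le (\<lambda>k. tay 1 (\<lambda>z. F z k)) (32 * (4 * M))"
proof -
  have M: "M \<ge> 0" using F unfolding edge_bdd_def by (metis norm_ge_zero order_trans)
  let ?D = "\<lambda>y k. - ln (orl (cmod (y k)))"
  have tb: "cmod (tay m (\<lambda>z. \<Sum>k\<in>S. F z k * gexp (?D y k) (a k) (b k) (c k) z)) \<le> 4 ^ m * (4 * M)"
    if "finite S" "\<And>k. k \<in> S \<Longrightarrow> 0 < cmod (y k) \<and> cmod (y k) \<le> exp (-1)" "(\<Sum>k\<in>S. (orl (cmod (y k)))\<^sup>2) \<le> 1"
      "\<And>k. k \<in> S \<Longrightarrow> cmod (a k) \<le> orl (cmod (y k)) \<and> cmod (b k) \<le> orl (cmod (y k)) \<and> cmod (c k) \<le> orl (cmod (y k))"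
    for S m a b c and y :: cseq
    using that orl_coeff(1) by (intro test_function_bound[OF F]) auto
  have c1: "cmod (cnj (y k) * of_real (?D y k)) \<le> orl (cmod (y k))"
    and c2: "cmod (- 2 * of_real (?D y k) * cnj (y k)) \<le> orl (cmod (y k))"
    and c3: "cmod (y k) \<le> orl (cmod (y k))" and c4: "0 \<le> orl (cmod (y k))"
    if "0 < cmod (y k) \<and> cmod (y k) \<le> exp (-1)" for k and y :: cseq
    using that orl_coeff[of "y k"] mult_nonneg_nonneg[of "cmod (y k)" "?D y k"]
    by (simp_all add: norm_mult mult_ac del: mult_minus_left mult_minus_right)
  show "test_le (\<lambda>k. tay 0 (\<lambda>z. F z k)) (32 * (4 * M))" if 1: "\<And>k. tay 1 (\<lambda>z. F z k) = 0"
  proof (rule test_leI)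
    fix S and y :: cseq assume y: "finite S" "\<And>k. k \<in> S \<Longrightarrow> 0 < cmod (y k) \<and> cmod (y k) \<le> exp (-1)"
      "(\<Sum>k\<in>S. (orl (cmod (y k)))\<^sup>2) \<le> 1"
    \<comment> \<open>With \<open>a = D * cnj y\<close> and \<open>b = 0\<close> the test function
      has first coefficient \<open>2 * D * a\<close>, and \<open>tay 1\<close> of \<open>F\<close>
      is zero, so only the squared logarithm survives.\<close>
    have "cmod (\<Sum>k\<in>S. tay 0 (\<lambda>z. F z k) * (2 * of_real (?D y k) * (cnj (y k) * of_real (?D y k)))) \<le> 4 ^ 1 * (4 * M)"
      using tb[OF y, of "\<lambda>k. cnj (y k) * of_real (?D y k)" "\<lambda>_. 0" "\<lambda>_. 0" 1] y c1 c4
      unfolding tay_test_sum[OF F] by (simp add: 1 1[unfolded One_nat_def])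
    also have "(\<Sum>k\<in>S. tay 0 (\<lambda>z. F z k) * (2 * of_real (?D y k) * (cnj (y k) * of_real (?D y k)))) =
      2 * (\<Sum>k\<in>S. tay 0 (\<lambda>z. F z k) * cnj (y k) * (ln (orl (cmod (y k))))\<^sup>2)"
      by (simp add: sum_distrib_left power2_eq_square mult_ac)
    finally show "cmod (\<Sum>k\<in>S. tay 0 (\<lambda>z. F z k) * cnj (y k) * (ln (orl (cmod (y k))))\<^sup>2) \<le> 32 * (4 * M)"
      using M by (simp add: norm_mult)
  qed
  show "test_le (\<lambda>k. tay 0 (\<lambda>z. F z k)) (32 * (4 * M))" if 2: "\<And>k. tay 2 (\<lambda>z. F z k) = 0"
  proof (rule test_leI)
    fix S and y :: cseq assume y: "finite S" "\<And>k. k \<in> S \<Longrightarrow> 0 < cmod (y k) \<and> cmod (y k) \<le> exp (-1)"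
      "(\<Sum>k\<in>S. (orl (cmod (y k)))\<^sup>2) \<le> 1"
    \<comment> \<open>Coefficients \<open>a\<close>, \<open>- 2 D a\<close>, \<open>- a\<close> give
      the test function the jet \<open>a\<close>, 0, \<open>- 2 D^2 a\<close>: the vanishing middle
      entry removes \<open>tay 1\<close> of \<open>F\<close>, on which nothing is known.\<close>
    have eq: "tay 0 (\<lambda>z. F z k) * (- cnj (y k) + 2 * of_real (?D y k) * (- 2 * of_real (?D y k) * cnj (y k))
         + (2 * (of_real (?D y k))\<^sup>2 + 1) * cnj (y k))
        + tay 1 (\<lambda>z. F z k) * (- 2 * of_real (?D y k) * cnj (y k) + 2 * of_real (?D y k) * cnj (y k)) + tay 2 (\<lambda>z. F z k) * cnj (y k)
       = - 2 * (tay 0 (\<lambda>z. F z k) * cnj (y k) * (ln (orl (cmod (y k))))\<^sup>2)" for k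
      by (simp add: 2 power2_eq_square algebra_simps)
    have "cmod (\<Sum>k\<in>S. - 2 * (tay 0 (\<lambda>z. F z k) * cnj (y k) * (ln (orl (cmod (y k))))\<^sup>2)) \<le> 4 ^ 2 * (4 * M)"
      using tb[OF y, of "\<lambda>k. cnj (y k)" "\<lambda>k. - 2 * of_real (?D y k) * cnj (y k)" "\<lambda>k. - cnj (y k)" 2] y c2 c3
      unfolding tay_test_sum[OF F] eq by simp
    then show "cmod (\<Sum>k\<in>S. tay 0 (\<lambda>z. F z k) * cnj (y k) * (ln (orl (cmod (y k))))\<^sup>2) \<le> 32 * (4 * M)"
      unfolding sum_distrib_left[symmetric] using M by (simp add: norm_mult)
  qed
  show "test_le (\<lambda>k. tay 1 (\<lambda>z. F z k)) (32 * (4 * M))"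
    if 0: "\<And>k. tay 0 (\<lambda>z. F z k) = 0" and 2: "\<And>k. tay 2 (\<lambda>z. F z k) = 0"
  proof (rule test_leI)
    fix S and y :: cseq assume y: "finite S" "\<And>k. k \<in> S \<Longrightarrow> 0 < cmod (y k) \<and> cmod (y k) \<le> exp (-1)"
      "(\<Sum>k\<in>S. (orl (cmod (y k)))\<^sup>2) \<le> 1"
    \<comment> \<open>The second coefficient now pairs \<open>tay 1\<close> of \<open>F\<close> with
      the first coefficient \<open>2 * D * a\<close> of the test function, again for
      \<open>a = D * cnj y\<close>.\<close>
    have "cmod (\<Sum>k\<in>S. tay 1 (\<lambda>z. F z k) * (2 * of_real (?D y k) * (cnj (y k) * of_real (?D y k)))) \<le> 4 ^ 2 * (4 * M)"
      using tb[OF y, of "\<lambda>k. cnj (y k) * of_real (?D y k)" "\<lambda>_. 0" "\<lambda>_. 0" 2] y c1 c4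
      unfolding tay_test_sum[OF F] by (simp add: 0 2)
    also have "(\<Sum>k\<in>S. tay 1 (\<lambda>z. F z k) * (2 * of_real (?D y k) * (cnj (y k) * of_real (?D y k)))) =
      2 * (\<Sum>k\<in>S. tay 1 (\<lambda>z. F z k) * cnj (y k) * (ln (orl (cmod (y k))))\<^sup>2)"
      by (simp add: sum_distrib_left power2_eq_square mult_ac)
    finally show "cmod (\<Sum>k\<in>S. tay 1 (\<lambda>z. F z k) * cnj (y k) * (ln (orl (cmod (y k))))\<^sup>2) \<le> 32 * (4 * M)"
      using M by (simp add: norm_mult)
  qed
qed


section \<open>Functions with a prescribed 2-jet\<close>

lemma continuous_into_l_infI:
  assumes cont: "\<And>k. continuous_on S (\<lambda>z. F z k)"
    and bd: "\<And>z k. z \<in> S \<Longrightarrow> cmod (F z k) \<le> m k" and m: "m \<longlonglongrightarrow> 0"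
  shows "continuous_into l_inf S F"
  unfolding continuous_into_def
proof (intro ballI conjI)
  obtain K where K: "\<And>k. norm (m k) \<le> K"
    using BseqE[OF convergent_imp_Bseq[OF convergentI[OF m]]] by metis
  have mem: "F z \<in> nset l_inf" if "z \<in> S" for z
    proof (rule l_inf_le(1))
    show "cmod (F z k) \<le> K" for k using bd[OF that, of k] K[of k] by simp
  qed
  fix z assume z: "z \<in> S"
  show "F z \<in> nset l_inf" using mem[OF z] .
  show "((\<lambda>w. nnorm l_inf (F w - F z)) \<longlongrightarrow> 0) (at z within S)"
  proof (rule tendstoI)
    fix e :: real assume e: "e > 0"
    \<comment> \<open>Beyond \<open>N\<close> the majorant alone controls the difference; the
      finitely many earlier coordinates use their own continuity.\<close>
    have "eventually (\<lambda>k. m k < e/4) sequentially" using m e by (intro order_tendstoD(2)) auto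
    then obtain N where N: "\<And>k. k \<ge> N \<Longrightarrow> m k < e/4" unfolding eventually_sequentially by blast
    have "eventually (\<lambda>w. dist (F w k) (F z k) < e/2) (at z within S)" for k
      using cont[of k] z e unfolding continuous_on by (intro tendstoD) auto
    then have "eventually (\<lambda>w. \<forall>k\<in>{..<N}. dist (F w k) (F z k) < e/2) (at z within S)"
      by (intro eventually_ball_finite) auto
    moreover have "eventually (\<lambda>w. w \<in> S) (at z within S)" by (simp add: eventually_at_filter)
    ultimately show "eventually (\<lambda>w. dist (nnorm l_inf (F w - F z)) 0 < e) (at z within S)"
    proof eventually_elim
      case (elim w)
      have "cmod ((F w - F z) k) \<le> e/2" for k
      proof (cases "k < N")
        case True
        then show ?thesis using elim(1) by (simp add: dist_norm less_imp_le)
      next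
        case False
        have "cmod (F w k - F z k) \<le> m k + m k"
          using bd[OF elim(2), of k] bd[OF z, of k] by (intro order_trans[OF norm_triangle_ineq4] add_mono)
        then show ?thesis using N[of k] False by simp
      qed
      then have "F w - F z \<in> nset l_inf" "nnorm l_inf (F w - F z) \<le> e/2" by (rule l_inf_le)+
      then show ?case using e sn_nonneg[OF seminormed_l_inf, of "F w - F z"] by (simp add: dist_real_def)
    qed
  qed
qed

lemma continuous_into_l_oneI:
  fixes F :: "real \<Rightarrow> cseq"
  assumes cont: "\<And>k. continuous_on UNIV (\<lambda>z. F z k)"
    and bd: "\<And>z k. cmod (F z k) \<le> m k" and m: "summable m"
  shows "continuous_into l_one UNIV F"
  unfolding continuous_into_def
proof (intro ballI conjI)
  fix z :: real
  show "F z \<in> nset l_one"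
    unfolding l_one_mem by (rule summable_comparison_test'[OF m, of 0]) (simp add: bd)
  have "((\<lambda>w. \<Sum>k. cmod (F w k - F z k)) \<longlongrightarrow> (\<Sum>k::nat. 0)) (at z)"
  proof (rule conjunct2[OF conjunct2[OF tannerys_theorem[where a = "\<lambda>k w. cmod (F w k - F z k)"
      and b = "\<lambda>_. 0" and M = "\<lambda>k. m k + m k" and F = "at z"]]])
    show "((\<lambda>w. cmod (F w k - F z k)) \<longlongrightarrow> 0) (at z)" for k
    proof -
      have "((\<lambda>w. F w k) \<longlongrightarrow> F z k) (at z)" using cont[of k] unfolding continuous_on by simp
      then show ?thesis by (intro tendsto_norm_zero LIM_zero)
    qed
    have "norm (cmod (F w k - F z k)) \<le> m k + m k" for w k
      using norm_triangle_ineq4[of "F w k" "F z k"] bd[of w k] bd[of z k] by simp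
    then show "\<forall>\<^sub>F (k, w) in at_top \<times>\<^sub>F at z. norm (cmod (F w k - F z k)) \<le> m k + m k"
      by (simp add: always_eventually)
    show "summable (\<lambda>k. m k + m k)" using m by (intro summable_add)
  qed simp
  then show "((\<lambda>w. nnorm l_one (F w - F z)) \<longlongrightarrow> 0) (at z)"
    by (simp add: l_one_def)
qed

lemma gauss_tendsto_0: "((\<lambda>t. c * ((1 + t\<^sup>2) * exp (- t\<^sup>2))) \<longlongrightarrow> 0) (at_infinity :: real filter)"
proof -
  have "((\<lambda>t. c * ((1 + t) * exp (- t))) \<longlongrightarrow> 0) (at_top :: real filter)"
  proof -
    have "((\<lambda>t::real. t ^ 1 / exp t) \<longlongrightarrow> 0) at_top" by (rule tendsto_power_div_exp_0)
    moreover have "((\<lambda>t::real. t ^ 0 / exp t) \<longlongrightarrow> 0) at_top" by (rule tendsto_power_div_exp_0)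
    ultimately have "((\<lambda>t::real. c * (t ^ 0 / exp t + t ^ 1 / exp t)) \<longlongrightarrow> c * (0 + 0)) at_top"
      by (intro tendsto_intros)
    then show ?thesis by (simp add: exp_minus field_simps)
  qed
  moreover have "filterlim (\<lambda>t::real. (norm t)\<^sup>2) at_top at_infinity"
    by (intro filterlim_pow_at_top filterlim_norm_at_top) simp
  then have "filterlim (\<lambda>t::real. t\<^sup>2) at_top at_infinity" by (simp only: real_norm_def power2_abs)
  ultimately show ?thesis by (rule filterlim_compose)
qed

text \<open>The Abel--Dini weights: dividing \<open>v\<^sup>2\<close> by the square root of its tail keeps it summable.\<close>

definition tail_norm :: "(nat \<Rightarrow> real) \<Rightarrow> nat \<Rightarrow> real"
  where "tail_norm v k = sqrt (\<Sum>m. (v (m + k))\<^sup>2)"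

context
  fixes v :: "nat \<Rightarrow> real"
  assumes v: "summable (\<lambda>k. (v k)\<^sup>2)" and v0: "\<And>k. v k \<ge> 0"
begin

lemma tail_summable: "summable (\<lambda>m. (v (m + k))\<^sup>2)"
  using v summable_iff_shift[of "\<lambda>k. (v k)\<^sup>2" k] by simp

lemma tail_norm_nonneg: "tail_norm v k \<ge> 0"
  unfolding tail_norm_def using tail_summable by (intro real_sqrt_ge_zero suminf_nonneg) auto

lemma tail_norm_sq: "(tail_norm v k)\<^sup>2 = (\<Sum>m. (v (m + k))\<^sup>2)"
  unfolding tail_norm_def using tail_summable by (intro real_sqrt_pow2 suminf_nonneg) auto

lemma tail_norm_step: "(tail_norm v k)\<^sup>2 = (v k)\<^sup>2 + (tail_norm v (Suc k))\<^sup>2"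
  using suminf_split_head[OF tail_summable[of k]] by (simp add: tail_norm_sq)

lemma tail_norm_Suc_le: "tail_norm v (Suc k) \<le> tail_norm v k"
proof (rule power2_le_imp_le)
  show "(tail_norm v (Suc k))\<^sup>2 \<le> (tail_norm v k)\<^sup>2" using tail_norm_step[of k] by simp
qed (rule tail_norm_nonneg)

lemma tail_norm_le: "tail_norm v k \<le> tail_norm v 0"
  by (induction k) (auto intro: order_trans[OF tail_norm_Suc_le])

lemma le_tail_norm: "v k \<le> tail_norm v k"
proof (rule power2_le_imp_le)
  show "(v k)\<^sup>2 \<le> (tail_norm v k)\<^sup>2" using tail_norm_step[of k] by simp
qed (rule tail_norm_nonneg)

lemma tail_norm_tendsto_0: "tail_norm v \<longlonglongrightarrow> 0"
proof -
  have "(\<lambda>k. (\<Sum>n. (v n)\<^sup>2) - (\<Sum>n<k. (v n)\<^sup>2)) \<longlonglongrightarrow> (\<Sum>n. (v n)\<^sup>2) - (\<Sum>n. (v n)\<^sup>2)"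
    by (intro tendsto_intros summable_LIMSEQ v)
  then have "(\<lambda>k. \<Sum>m. (v (m + k))\<^sup>2) \<longlonglongrightarrow> 0"
    by (simp add: suminf_minus_initial_segment[OF v])
  then have "(\<lambda>k. sqrt (\<Sum>m. (v (m + k))\<^sup>2)) \<longlonglongrightarrow> sqrt 0" by (rule tendsto_real_sqrt)
  then show ?thesis by (simp add: tail_norm_def[abs_def])
qed

text \<open>For consecutive tails \<open>r\<close> and \<open>s\<close>,
  \<open>v\<^sup>2 = (r - s) * (r + s)\<close> gives \<open>v\<^sup>2 / r \<le> 2 * (r - s)\<close>,
  which telescopes; where \<open>r = 0\<close> the quotient is 0 by the convention for
  division.\<close>

lemma abel_dini:
  "summable (\<lambda>k. (v k)\<^sup>2 / tail_norm v k)" "(\<Sum>k. (v k)\<^sup>2 / tail_norm v k) \<le> 2 * tail_norm v 0"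
proof -
  have *: "(\<Sum>k<n. (v k)\<^sup>2 / tail_norm v k) \<le> 2 * (tail_norm v 0 - tail_norm v n)" for n
  proof (induction n)
    case (Suc n)
    let ?r = "tail_norm v n" and ?s = "tail_norm v (Suc n)"
    have "(v n)\<^sup>2 / ?r \<le> 2 * (?r - ?s)"
    proof (cases "?r = 0")
      case True
      then show ?thesis using tail_norm_Suc_le[of n] by simp
    next
      case False
      then have r: "?r > 0" using tail_norm_nonneg[of n] by linarith
      have "(v n)\<^sup>2 = (?r - ?s) * (?r + ?s)" using tail_norm_step[of n] by (simp add: power2_eq_square algebra_simps)
      also have "\<dots> \<le> (?r - ?s) * (2 * ?r)" using tail_norm_Suc_le[of n] by (intro mult_left_mono) auto
      finally show ?thesis using r by (simp add: field_simps)
    qed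
    then show ?case using Suc by simp
  qed simp
  then have le: "(\<Sum>k<n. (v k)\<^sup>2 / tail_norm v k) \<le> 2 * tail_norm v 0" for n
    using order_trans[OF *[of n]] tail_norm_nonneg[of n] by force
  show s: "summable (\<lambda>k. (v k)\<^sup>2 / tail_norm v k)"
    using le tail_norm_nonneg by (intro summableI_nonneg_bounded) auto
  show "(\<Sum>k. (v k)\<^sup>2 / tail_norm v k) \<le> 2 * tail_norm v 0" using le by (rule suminf_le_const[OF s])
qed

text \<open>
  The obvious choice \<open>\<bar>y\<bar>\<close> to the power \<open>2z\<close> is not norm continuous into \<open>l\<^sup>\<infinity>\<close> on the left edge when \<open>y\<close> has
  infinite support; the Abel--Dini weights make its coordinates tend to 0 there.
\<close>

lemma C_construct:
  fixes a b c :: cseq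
  assumes ab: "\<And>k. cmod (a k) \<le> v k" "\<And>k. cmod (b k) \<le> v k" "\<And>k. cmod (c k) \<le> v k"
  defines "D \<equiv> \<lambda>k. ln (tail_norm v k / v k)"
  shows "\<exists>F\<in>nset C_space. nnorm C_space F \<le> 8 * tail_norm v 0 \<and> Delta 0 F = a \<and>
      Delta 1 F = (\<lambda>k. b k - 2 * of_real (D k) * a k) \<and>
      Delta 2 F = (\<lambda>k. c k - 2 * of_real (D k) * b k + (2 * (of_real (D k))\<^sup>2 + 1) * a k)"
proof -
  \<comment> \<open>The exponent \<open>- D\<close> makes the coordinate size at most a multiple of
    the tail norm on the left edge and of \<open>v\<^sup>2\<close> over the tail norm on the right
    one. If \<open>v k = 0\<close>, the conventions for division and \<open>ln\<close> give
    \<open>D k = 0\<close>.\<close>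
  define T where "T k = gexp (- D k) (a k) (b k) (c k)" for k
  define F where "F z = (if z \<in> closed_strip then (\<lambda>k. T k z) else 0)" for z
  let ?r = "tail_norm v"
  define q where "q t = 4 * ((1 + t\<^sup>2) * exp (- t\<^sup>2))" for t :: real
  have q0: "q t \<ge> 0" for t by (simp add: q_def)
  have q4: "q t \<le> 4" for t using gauss_le_1[of t] by (simp add: q_def)
  have Tq: "cmod (T k z) \<le> q (Im z) * (v k * exp (2 * - D k * (Re z - 1/2)))" if "z \<in> closed_strip" for k z
    unfolding T_def q_def using gexp_bound[OF that ab(1)[of k] ab(2)[of k] ab(3)[of k], of "- D k"] by (simp only: mult.assoc)
  have D0: "D k \<ge> 0" for k
  proof (cases "v k = 0")
    case False
    then show ?thesis using v0[of k] le_tail_norm[of k] by (simp add: D_def)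
  qed (simp add: D_def)
  have vD: "v k * exp (D k) \<le> ?r k" "v k * exp (- D k) = (v k)\<^sup>2 / ?r k" for k
  proof -
    have "v k * exp (D k) \<le> ?r k \<and> v k * exp (- D k) = (v k)\<^sup>2 / ?r k"
    proof (cases "v k = 0")
      case False
      then have "v k > 0" using v0[of k] by simp
      moreover have "?r k > 0" using calculation le_tail_norm[of k] by simp
      ultimately show ?thesis by (simp add: D_def exp_minus power2_eq_square field_simps)
    qed (simp add: tail_norm_nonneg)
    then show "v k * exp (D k) \<le> ?r k" "v k * exp (- D k) = (v k)\<^sup>2 / ?r k" by auto
  qed
  have T1: "cmod (T k z) \<le> q (Im z) * ?r k" if z: "z \<in> closed_strip" for k z
  proof -
    have "D k * (1/2 - Re z) \<le> D k * (1/2)" using z D0 by (intro mult_left_mono) (auto simp: closed_strip_def)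
    then have "exp (2 * - D k * (Re z - 1/2)) \<le> exp (D k)" by (simp add: algebra_simps)
    then have "v k * exp (2 * - D k * (Re z - 1/2)) \<le> v k * exp (D k)" using v0 by (intro mult_left_mono)
    then have "v k * exp (2 * - D k * (Re z - 1/2)) \<le> ?r k" using vD(1)[of k] by linarith
    then show ?thesis using Tq[OF z, of k] q0[of "Im z"] mult_left_mono order_trans by blast
  qed
  have T2: "cmod (T k (Complex 1 t)) \<le> q t * ((v k)\<^sup>2 / ?r k)" for k t
    using Tq[of "Complex 1 t" k] vD(2)[of k] by (simp add: closed_strip_def)
  have s: "Complex 0 t \<in> closed_strip" "Complex 1 t \<in> closed_strip" for t by (auto simp: closed_strip_def)
  have Tsb: "strip_bdd (T k)" for k unfolding T_def by (rule strip_bdd_gexp)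
  have coord: "strip_bdd (\<lambda>z. F z k)" for k
  proof -
    have "continuous_on closed_strip (\<lambda>z. F z k) \<longleftrightarrow> continuous_on closed_strip (T k)"
      by (rule continuous_on_cong) (auto simp: F_def)
    moreover have "(\<lambda>z. F z k) holomorphic_on open_strip \<longleftrightarrow> T k holomorphic_on open_strip"
      using open_subset_closed_strip by (intro holomorphic_cong) (auto simp: F_def)
    moreover have "(\<lambda>z. F z k) ` closed_strip = T k ` closed_strip"
      by (rule image_cong) (auto simp: F_def)
    ultimately show ?thesis using Tsb[of k] unfolding strip_bdd_def by simp
  qed
  have ce: "continuous_on UNIV (\<lambda>t. F (Complex x t) k)" if "x = 0 \<or> x = 1" for x k
  proof -
    have "continuous_on UNIV (\<lambda>t. Complex x t)" by (intro continuous_intros continuous_on_Complex)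
    moreover have "Complex x ` UNIV \<subseteq> closed_strip" using that s by auto
    ultimately show ?thesis
      using coord[of k] continuous_on_compose2[of closed_strip "\<lambda>z. F z k" UNIV "Complex x"]
      by (auto simp: strip_bdd_def)
  qed
  have B1: "cmod (F z k) \<le> 4 * ?r k" if "z \<in> closed_strip" for z k
    using T1[OF that, of k] mult_right_mono[OF q4[of "Im z"] tail_norm_nonneg[of k]] that by (simp add: F_def)
  have r0: "(\<lambda>k. 4 * ?r k) \<longlonglongrightarrow> 0" using tendsto_mult[OF tendsto_const tail_norm_tendsto_0, of 4] by simp
  have N0: "F (Complex 0 t) \<in> nset l_inf" "nnorm l_inf (F (Complex 0 t)) \<le> q t * ?r 0" for t
  proof -
    have "cmod (F (Complex 0 t) k) \<le> q t * ?r 0" for k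
      using T1[OF s(1), of k t] mult_left_mono[OF tail_norm_le[of k] q0[of t]] s by (simp add: F_def)
    then show "F (Complex 0 t) \<in> nset l_inf" "nnorm l_inf (F (Complex 0 t)) \<le> q t * ?r 0" using l_inf_le by blast+
  qed
  have N1: "F (Complex 1 t) \<in> nset l_one" "nnorm l_one (F (Complex 1 t)) \<le> q t * (2 * ?r 0)" for t
  proof -
    have le: "cmod (F (Complex 1 t) k) \<le> q t * ((v k)\<^sup>2 / ?r k)" for k using T2[of k t] s by (simp add: F_def)
    have sm: "summable (\<lambda>k. q t * ((v k)\<^sup>2 / ?r k))" using abel_dini(1) by (rule summable_mult)
    have sF: "summable (\<lambda>k. cmod (F (Complex 1 t) k))"
      using le by (intro summable_comparison_test'[OF sm, of 0]) simp
    then show "F (Complex 1 t) \<in> nset l_one" by (simp add: l_one_mem)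
    have "(\<Sum>k. cmod (F (Complex 1 t) k)) \<le> (\<Sum>k. q t * ((v k)\<^sup>2 / ?r k))" by (rule suminf_le[OF le sF sm])
    also have "\<dots> = q t * (\<Sum>k. (v k)\<^sup>2 / ?r k)" using abel_dini(1) by (rule suminf_mult)
    also have "\<dots> \<le> q t * (2 * ?r 0)" using abel_dini(2) q0 by (intro mult_left_mono)
    finally show "nnorm l_one (F (Complex 1 t)) \<le> q t * (2 * ?r 0)" by (simp add: l_one_def)
  qed
  have FC: "F \<in> nset C_space"
  proof (rule C_spaceI)
    show "F z = 0" if "z \<notin> closed_strip" for z using that by (simp add: F_def)
    show "continuous_into l_inf closed_strip F"
      using coord B1 by (intro continuous_into_l_infI[OF _ _ r0]) (auto simp: strip_bdd_def)
    show "cmod (F z k) \<le> 4 * ?r 0" if "z \<in> closed_strip" for z k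
      using B1[OF that, of k] tail_norm_le[of k] by linarith
    show "(\<lambda>z. F z k) holomorphic_on open_strip" for k using coord[of k] by (simp add: strip_bdd_def)
    have "((\<lambda>t. nnorm l_inf (F (Complex 0 t))) \<longlongrightarrow> 0) at_infinity"
    proof (rule Lim_null_comparison)
      show "((\<lambda>t. (4 * ?r 0) * ((1 + t\<^sup>2) * exp (- t\<^sup>2))) \<longlongrightarrow> 0) (at_infinity :: real filter)" by (rule gauss_tendsto_0)
      show "\<forall>\<^sub>F t in at_infinity. norm (nnorm l_inf (F (Complex 0 t))) \<le> (4 * ?r 0) * ((1 + t\<^sup>2) * exp (- t\<^sup>2))"
        using N0 sn_nonneg[OF seminormed_l_inf N0(1)] by (intro always_eventually) (simp add: q_def mult_ac)
    qed
    then show "admissible_edge l_inf 0 F"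
      unfolding admissible_edge_def using ce B1[OF s(1)]
      by (intro conjI continuous_into_l_infI[OF _ _ r0]) auto
    have "((\<lambda>t. nnorm l_one (F (Complex 1 t))) \<longlongrightarrow> 0) at_infinity"
    proof (rule Lim_null_comparison)
      show "((\<lambda>t. (4 * (2 * ?r 0)) * ((1 + t\<^sup>2) * exp (- t\<^sup>2))) \<longlongrightarrow> 0) (at_infinity :: real filter)" by (rule gauss_tendsto_0)
      show "\<forall>\<^sub>F t in at_infinity. norm (nnorm l_one (F (Complex 1 t))) \<le> (4 * (2 * ?r 0)) * ((1 + t\<^sup>2) * exp (- t\<^sup>2))"
        using N1 sn_nonneg[OF seminormed_l_one N1(1)] by (intro always_eventually) (simp add: q_def mult_ac)
    qed
    moreover have "continuous_into l_one UNIV (\<lambda>t. F (Complex 1 t))"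
    proof (rule continuous_into_l_oneI)
      show "continuous_on UNIV (\<lambda>t. F (Complex 1 t) k)" for k using ce by simp
      show "summable (\<lambda>k. 4 * ((v k)\<^sup>2 / ?r k))" using abel_dini(1) by (rule summable_mult)
      show "cmod (F (Complex 1 t) k) \<le> 4 * ((v k)\<^sup>2 / ?r k)" for t k
        using T2[of k t] mult_right_mono[OF q4[of t], of "(v k)\<^sup>2 / ?r k"] tail_norm_nonneg[of k] s by (simp add: F_def)
    qed
    ultimately show "admissible_edge l_one 1 F" unfolding admissible_edge_def by blast
  qed
  \<comment> \<open>8 is the bound 4 of the Gaussian factor times the 2 from
    \<open>abel_dini\<close>, attained on the right edge.\<close>
  have nF: "nnorm C_space F \<le> 8 * ?r 0"
  proof (rule C_norm_le)
    fix t
    show "nnorm l_inf (F (Complex 0 t)) \<le> 8 * ?r 0"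
      using N0(2)[of t] mult_right_mono[OF q4[of t] tail_norm_nonneg[of 0]] tail_norm_nonneg[of 0] by linarith
    show "nnorm l_one (F (Complex 1 t)) \<le> 8 * ?r 0"
      using N1(2)[of t] mult_right_mono[OF q4[of t] tail_norm_nonneg[of 0]] tail_norm_nonneg[of 0] by linarith
  qed
  have tF: "tay m (\<lambda>z. F z k) = tay m (T k)" for m k
  proof -
    have "(deriv ^^ m) (\<lambda>z. F z k) (1/2) = (deriv ^^ m) (T k) (1/2)"
    proof (rule higher_deriv_cong_ev)
      show "\<forall>\<^sub>F z in nhds (1/2). F z k = T k z"
        using eventually_nhds_in_open[OF open_open_strip half_in_open_strip]
        by eventually_elim (use open_subset_closed_strip in \<open>auto simp: F_def\<close>)
    qed simp
    then show ?thesis by (simp add: tay_def)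
  qed
  have "Delta 0 F = a" "Delta 1 F = (\<lambda>k. b k - 2 * of_real (D k) * a k)"
      "Delta 2 F = (\<lambda>k. c k - 2 * of_real (D k) * b k + (2 * (of_real (D k))\<^sup>2 + 1) * a k)"
    unfolding Delta_tay[OF FC] tF T_def tay_gexp by simp_all
  with FC nF show ?thesis by blast
qed

end


lemma l2_le_summable:
  assumes "l2_le y r" "r \<ge> 0"
  shows "summable (\<lambda>k. (cmod (y k))\<^sup>2)" "tail_norm (\<lambda>k. cmod (y k)) 0 \<le> r"
proof -
  have le: "(\<Sum>k<n. (cmod (y k))\<^sup>2) \<le> r\<^sup>2" for n using assms by (simp add: l2_le_def)
  show s: "summable (\<lambda>k. (cmod (y k))\<^sup>2)" using le by (intro summableI_nonneg_bounded) auto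
  have "(\<Sum>k. (cmod (y k))\<^sup>2) \<le> r\<^sup>2" using le by (rule suminf_le_const[OF s])
  then have "sqrt (\<Sum>k. (cmod (y k))\<^sup>2) \<le> sqrt (r\<^sup>2)" by (rule real_sqrt_le_mono)
  then show "tail_norm (\<lambda>k. cmod (y k)) 0 \<le> r" using assms by (simp add: tail_norm_def)
qed

lemma upper_l2:
  assumes y: "l2_le y r" "r \<ge> 0"
  shows "\<exists>F\<in>nset C_space. nnorm C_space F \<le> 8 * r \<and> Delta 0 F = 0 \<and> Delta 1 F = 0 \<and> Delta 2 F = y"
proof -
  obtain F where F: "F \<in> nset C_space" "nnorm C_space F \<le> 8 * tail_norm (\<lambda>k. cmod (y k)) 0"
    "Delta 0 F = (\<lambda>_. 0)" "Delta 1 F = (\<lambda>_. 0)" "Delta 2 F = y"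
    using C_construct[OF l2_le_summable(1)[OF y], of "\<lambda>_. 0" "\<lambda>_. 0" y] by auto
  then show ?thesis using l2_le_summable(2)[OF y] by (intro bexI[of _ F]) (auto simp: fun_eq_iff)
qed

text \<open>Take \<open>v = orl (cmod x)\<close>. The tail norms are at most 1, so
  \<open>D \<le> - ln v\<close> and \<open>2 * D * x\<close> is still of size \<open>v\<close>.
  Solving the jet formulas of \<open>C_construct\<close> gives the coefficients
  \<open>(x, 2 D x, 0)\<close>, \<open>(x, D x, - x)\<close> and \<open>(0, x, 2 D x)\<close>
  respectively.\<close>

lemma upper_orl:
  assumes x: "orlicz_unit x"
  shows "\<exists>F\<in>nset C_space. nnorm C_space F \<le> 8 \<and> Delta 0 F = x \<and> Delta 1 F = 0"
    "\<exists>F\<in>nset C_space. nnorm C_space F \<le> 8 \<and> Delta 0 F = x \<and> Delta 2 F = 0"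
    "\<exists>F\<in>nset C_space. nnorm C_space F \<le> 8 \<and> Delta 0 F = 0 \<and> Delta 1 F = x \<and> Delta 2 F = 0"
proof -
  define v where "v k = orl (cmod (x k))" for k
  have xe: "cmod (x k) \<le> exp (-1)" for k using x by (simp add: orlicz_unit_def)
  have v0: "v k \<ge> 0" for k using orl_pos[of "cmod (x k)"] xe[of k] by (cases "x k = 0") (auto simp: v_def)
  have vr: "l2_le (\<lambda>k. of_real (v k)) 1" using x by (simp add: orlicz_unit_def l2_le_def v_def)
  have vs: "summable (\<lambda>k. (v k)\<^sup>2)" using l2_le_summable(1)[OF vr] by simp
  have r1: "tail_norm v 0 \<le> 1" using l2_le_summable(2)[OF vr] v0 by simp
  define D where "D k = ln (tail_norm v k / v k)" for k
  have xv: "cmod (x k) \<le> v k" for k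
    using orl_coeff(2)[of "x k"] xe[of k] by (cases "x k = 0") (auto simp: v_def)
  have D: "2 * (cmod (x k) * \<bar>D k\<bar>) \<le> v k" for k
  proof (cases "x k = 0")
    case False
    then have p: "0 < cmod (x k)" by simp
    note c = orl_coeff[OF p xe[of k]]
    have vp: "v k > 0" using c by (simp add: v_def)
    have rp: "v k \<le> tail_norm v k" by (rule le_tail_norm[OF vs v0])
    have "tail_norm v k \<le> 1" using r1 tail_norm_le[OF vs v0, of k] by linarith
    then have "D k \<le> - ln (v k)" using vp rp by (simp add: D_def ln_div)
    moreover have "0 \<le> D k" using vp rp by (simp add: D_def)
    ultimately have "2 * (cmod (x k) * \<bar>D k\<bar>) \<le> 2 * (cmod (x k) * (- ln (v k)))"
      by (intro mult_left_mono) auto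
    also have "\<dots> \<le> v k" using c(4) unfolding v_def by (simp only: mult.assoc)
    finally show ?thesis .
  qed (simp add: v0)
  have D2: "cmod (2 * of_real (D k) * x k) \<le> v k" "cmod (of_real (D k) * x k) \<le> v k" for k
  proof -
    have "cmod (of_real (D k) * x k) = cmod (x k) * \<bar>D k\<bar>" "cmod (2 * of_real (D k) * x k) = 2 * (cmod (x k) * \<bar>D k\<bar>)"
      by (simp_all add: norm_mult)
    moreover have "0 \<le> cmod (x k) * \<bar>D k\<bar>" by simp
    ultimately show "cmod (2 * of_real (D k) * x k) \<le> v k" "cmod (of_real (D k) * x k) \<le> v k"
      using D[of k] by linarith+
  qed
  have z: "cmod 0 \<le> v k" for k using v0 by simp
  have C: "\<exists>F\<in>nset C_space. nnorm C_space F \<le> 8 \<and> Delta 0 F = a \<and>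
      Delta 1 F = (\<lambda>k. b k - 2 * of_real (D k) * a k) \<and>
      Delta 2 F = (\<lambda>k. c k - 2 * of_real (D k) * b k + (2 * (of_real (D k))\<^sup>2 + 1) * a k)"
    if ab: "\<And>k. cmod (a k) \<le> v k" "\<And>k. cmod (b k) \<le> v k" "\<And>k. cmod (c k) \<le> v k" for a b c
    using C_construct[OF vs v0 ab, folded D_def] r1 by force
  obtain F where F: "F \<in> nset C_space" "nnorm C_space F \<le> 8" "Delta 0 F = x"
    "Delta 1 F = (\<lambda>k. 2 * of_real (D k) * x k - 2 * of_real (D k) * x k)"
    using C[OF xv D2(1) z] by blast
  then show "\<exists>F\<in>nset C_space. nnorm C_space F \<le> 8 \<and> Delta 0 F = x \<and> Delta 1 F = 0"
    by (intro bexI[of _ F]) (auto simp: fun_eq_iff)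
  obtain F where F: "F \<in> nset C_space" "nnorm C_space F \<le> 8" "Delta 0 F = x"
    "Delta 2 F = (\<lambda>k. - x k - 2 * of_real (D k) * (of_real (D k) * x k) + (2 * (of_real (D k))\<^sup>2 + 1) * x k)"
    using C[OF xv D2(2), of "\<lambda>k. - x k"] xv by (auto simp only: norm_minus_cancel)
  moreover have "Delta 2 F = 0" unfolding F(4) by (simp add: fun_eq_iff power2_eq_square algebra_simps)
  ultimately show "\<exists>F\<in>nset C_space. nnorm C_space F \<le> 8 \<and> Delta 0 F = x \<and> Delta 2 F = 0" by blast
  obtain F where F: "F \<in> nset C_space" "nnorm C_space F \<le> 8" "Delta 0 F = (\<lambda>_. 0)"
    "Delta 1 F = (\<lambda>k. x k - 2 * of_real (D k) * 0)"
    "Delta 2 F = (\<lambda>k. 2 * of_real (D k) * x k - 2 * of_real (D k) * x k + (2 * (of_real (D k))\<^sup>2 + 1) * 0)"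
    using C[OF z xv D2(1)] by blast
  then show "\<exists>F\<in>nset C_space. nnorm C_space F \<le> 8 \<and> Delta 0 F = 0 \<and> Delta 1 F = x \<and> Delta 2 F = 0"
    by (intro bexI[of _ F]) (auto simp: fun_eq_iff)
qed

lemma tay_add: "strip_bdd f \<Longrightarrow> strip_bdd g \<Longrightarrow> tay m (\<lambda>z. f z + g z) = tay m f + tay m g"
  unfolding tay_def strip_bdd_def
  by (subst higher_deriv_add[OF _ _ open_open_strip half_in_open_strip]) (auto simp: add_divide_distrib)

lemma tay_cmult: "strip_bdd f \<Longrightarrow> tay m (\<lambda>z. a * f z) = a * tay m f"
  unfolding tay_def strip_bdd_def
  by (subst higher_deriv_cmult[OF _ half_in_open_strip open_open_strip]) auto

lemma Delta_tay': "F \<in> nset C_space \<Longrightarrow> m \<le> 2 \<Longrightarrow> Delta m F = (\<lambda>n. tay m (\<lambda>z. F z n))"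
  using Delta_tay[of F] by (auto simp: le_Suc_eq numeral_2_eq_2)

lemma C_add: "F \<in> nset C_space \<Longrightarrow> G \<in> nset C_space \<Longrightarrow> F + G \<in> nset C_space"
  and C_scale: "F \<in> nset C_space \<Longrightarrow> a *\<^sub>C F \<in> nset C_space"
  using sn_add[OF seminormed_C] sn_scale[OF seminormed_C] by auto

lemma Delta_add: "F \<in> nset C_space \<Longrightarrow> G \<in> nset C_space \<Longrightarrow> m \<le> 2 \<Longrightarrow> Delta m (F + G) = Delta m F + Delta m G"
  by (simp add: Delta_tay' C_add fun_eq_iff tay_add C_strip_bdd)

lemma Delta_scale: "F \<in> nset C_space \<Longrightarrow> m \<le> 2 \<Longrightarrow> Delta m (a *\<^sub>C F) = a *\<^sub>C Delta m F"
  by (simp add: Delta_tay' C_scale fun_eq_iff scaleC_apply scaleC_complex tay_cmult C_strip_bdd)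

lemma scaleC_zero_right [simp]: "a *\<^sub>C 0 = (0 :: 'a::complex_vector)"
proof -
  have "a *\<^sub>C 0 = a *\<^sub>C 0 + a *\<^sub>C (0 :: 'a)" using scaleC_add_right[of a 0 "0::'a"] by simp
  then show ?thesis by simp
qed

lemma Delta_l2:
  assumes F: "F \<in> nset C_space"
  shows "l2_le (Delta 0 F) (256 * nnorm C_space F)"
    "Delta 0 F = 0 \<Longrightarrow> l2_le (Delta 1 F) (256 * nnorm C_space F)"
    "Delta 0 F = 0 \<Longrightarrow> Delta 1 F = 0 \<Longrightarrow> l2_le (Delta 2 F) (256 * nnorm C_space F)"
proof -
  note l = lower_l2[OF C_edge_bdd[OF F]]
  have n: "nnorm C_space F \<ge> 0" by (rule sn_nonneg[OF seminormed_C F])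
  show "l2_le (Delta 0 F) (256 * nnorm C_space F)" using l(1) by (simp add: Delta_tay[OF F])
  show "l2_le (Delta 1 F) (256 * nnorm C_space F)" if "Delta 0 F = 0"
    using l(2) that unfolding Delta_tay[OF F] by (simp add: fun_eq_iff)
  show "l2_le (Delta 2 F) (256 * nnorm C_space F)" if "Delta 0 F = 0" "Delta 1 F = 0"
    using l2_le_mono[OF l(3), of "256 * nnorm C_space F"] that n unfolding Delta_tay[OF F] by (simp add: fun_eq_iff)
qed

lemma Delta_test:
  assumes F: "F \<in> nset C_space"
  shows "Delta 1 F = 0 \<Longrightarrow> test_le (Delta 0 F) (128 * nnorm C_space F)"
    "Delta 2 F = 0 \<Longrightarrow> test_le (Delta 0 F) (128 * nnorm C_space F)"
    "Delta 0 F = 0 \<Longrightarrow> Delta 2 F = 0 \<Longrightarrow> test_le (Delta 1 F) (128 * nnorm C_space F)"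
proof -
  note l = lower_test[OF C_edge_bdd[OF F]]
  show "test_le (Delta 0 F) (128 * nnorm C_space F)" if "Delta 1 F = 0"
    using l(1) that unfolding Delta_tay[OF F] by (simp add: fun_eq_iff)
  show "test_le (Delta 0 F) (128 * nnorm C_space F)" if "Delta 2 F = 0"
    using l(2) that unfolding Delta_tay[OF F] by (simp add: fun_eq_iff)
  show "test_le (Delta 1 F) (128 * nnorm C_space F)" if "Delta 0 F = 0" "Delta 2 F = 0"
    using l(3) that unfolding Delta_tay[OF F] by (simp add: fun_eq_iff)
qed

text \<open>Test with a sequence of constant modulus \<open>t\<close> on \<open>A\<close> carrying
  the given signs. Modular at most 1 allows \<open>t\<close> of order
  \<open>1 / (sqrt n * ln n)\<close>, while the weight contributes \<open>(ln n)\<^sup>2\<close>;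
  together they save one logarithm over \<open>sqrt n\<close>.\<close>

lemma test_le_sign_sum:
  assumes s: "test_le s r" and A: "finite A" "2 \<le> ln (card A)" and e: "\<forall>i. e i \<in> {1,-1}"
  shows "cmod (\<Sum>i\<in>A. e i * s i) \<le> r * (400 * sqrt (card A) / ln (card A))"
proof -
  define n where "n = real (card A)"
  define L where "L = ln n"
  have L: "L \<ge> 2" using A by (simp add: L_def n_def)
  have n: "n > 1"
  proof (rule ccontr)
    assume "\<not> n > 1"
    then have "card A = 0 \<or> card A = 1" by (auto simp: n_def)
    then show False using L by (auto simp: L_def n_def)
  qed
  define t where "t = 1 / (4 * sqrt n * L)"
  have t0: "t > 0" using n L by (simp add: t_def)
  have lt: "- ln t = ln 4 + L / 2 + ln L" using n L by (simp add: t_def ln_div ln_mult ln_sqrt L_def)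
  have "ln L \<le> L - 1" using L by (intro ln_le_minus_one) auto
  moreover have "ln 4 \<le> (2::real)"
  proof -
    have "ln 4 \<le> 4 / exp (1::real)" by (rule ln_le_div_exp_1) simp
    also have "\<dots> \<le> 4 / (5/2)" using exp_1_ge by (intro divide_left_mono) auto
    finally show ?thesis by simp
  qed
  moreover have "ln 4 \<ge> (1::real)"
  proof -
    have "ln (exp 1) \<le> ln (4::real)" using exp_le by (intro ln_mono) auto
    then show ?thesis by simp
  qed
  moreover have "ln L \<ge> 0" using L by simp
  \<comment> \<open>The first bound is \<open>2 + L/2 + (L - 1) \<le> 2 * L\<close>, which is where
    \<open>2 \<le> L\<close> enters.\<close>
  ultimately have lt1: "- ln t \<le> 2 * L" "- ln t \<ge> 1" "- ln t \<ge> L / 2" using lt L by linarith+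
  have te: "t \<le> exp (-1)" using lt1(2) t0 ln_le_cancel_iff[of t "exp (-1)"] by simp
  have "orl t \<le> 4 * t * L" using mult_left_mono[OF lt1(1), of "2 * t"] t0 by (simp add: orl_def)
  then have "orl t \<le> 1 / sqrt n" using n L by (simp add: t_def)
  then have "(orl t)\<^sup>2 \<le> (1 / sqrt n)\<^sup>2" using orl_pos[OF t0 te] by (intro power_mono) auto
  then have o: "n * (orl t)\<^sup>2 \<le> 1" using n by (simp add: power_divide field_simps)
  define y where "y i = e i * of_real t" for i
  have ne: "cmod (e i) = 1" and ce: "cnj (e i) = e i" for i using e[rule_format, of i] by auto
  have ny: "cmod (y i) = t" for i using t0 by (simp add: y_def norm_mult ne)
  have "cmod (\<Sum>k\<in>A. s k * cnj (y k) * (ln (orl (cmod (y k))))\<^sup>2) \<le> r"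
    by (rule s[unfolded test_le_def, rule_format, of A y]) (use A te o in \<open>simp_all add: ny n_def\<close>)
  also have "(\<Sum>k\<in>A. s k * cnj (y k) * (ln (orl (cmod (y k))))\<^sup>2) = of_real (t * (ln (orl t))\<^sup>2) * (\<Sum>i\<in>A. e i * s i)"
    unfolding ny sum_distrib_left by (rule sum.cong) (simp_all add: y_def ce mult_ac)
  finally have 1: "t * (ln (orl t))\<^sup>2 * cmod (\<Sum>i\<in>A. e i * s i) \<le> r"
    using t0 by (simp add: norm_mult norm_power)
  have "L / 10 \<le> - ln (orl t)" using ln_orl(1)[OF t0 te] lt1(3) by linarith
  then have "(L / 10)\<^sup>2 \<le> (- ln (orl t))\<^sup>2" using L by (intro power_mono) auto
  then have "t * (L / 10)\<^sup>2 \<le> t * (ln (orl t))\<^sup>2" using t0 by (intro mult_left_mono) auto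
  moreover have "t * (L / 10)\<^sup>2 = L / (400 * sqrt n)" using L by (simp add: t_def power2_eq_square)
  ultimately have "L / (400 * sqrt n) * cmod (\<Sum>i\<in>A. e i * s i) \<le> t * (ln (orl t))\<^sup>2 * cmod (\<Sum>i\<in>A. e i * s i)"
    by (intro mult_right_mono) auto
  then have "L / (400 * sqrt n) * cmod (\<Sum>i\<in>A. e i * s i) \<le> r" using 1 by linarith
  then show ?thesis using n L unfolding L_def[symmetric] n_def[symmetric] by (simp add: field_simps)
qed

section \<open>Quotients of the Calderon space and their duals\<close>


text \<open>The part common to both spaces. \<open>pr\<close> recovers \<open>F (1/2)\<close> from
  the pair, and \<open>K_test\<close> and \<open>K_lift\<close> are its lower and upper Orlicz
  estimates.\<close>

locale calderon_quotient =
  fixes K :: "(complex \<Rightarrow> cseq) set" and T :: "(complex \<Rightarrow> cseq) \<Rightarrow> cseq \<times> cseq"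
    and pr :: "cseq \<times> cseq \<Rightarrow> cseq"
  assumes K_C: "F \<in> K \<Longrightarrow> F \<in> nset C_space"
    and K_add: "F \<in> K \<Longrightarrow> G \<in> K \<Longrightarrow> F + G \<in> K"
    and K_scale: "F \<in> K \<Longrightarrow> a *\<^sub>C F \<in> K"
    and T_add: "F \<in> K \<Longrightarrow> G \<in> K \<Longrightarrow> T (F + G) = T F + T G"
    and T_scale: "F \<in> K \<Longrightarrow> T (a *\<^sub>C F) = a *\<^sub>C T F"
    and pr_T: "F \<in> K \<Longrightarrow> pr (T F) = Delta 0 F"
    and K_test: "F \<in> K \<Longrightarrow> test_le (Delta 0 F) (128 * nnorm C_space F)"
    and K_lift: "orlicz_unit x \<Longrightarrow> \<exists>F\<in>K. nnorm C_space F \<le> 8 \<and> Delta 0 F = x"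
begin

definition X where "X = quotient_nspace C_space K T"

text \<open>Bounds are expressed by actual representatives because the infimum in the quotient norm
  may fail to be attained.\<close>

definition represented :: "cseq \<times> cseq \<Rightarrow> real \<Rightarrow> bool"
  where "represented u r \<longleftrightarrow> (\<exists>F\<in>K. T F = u \<and> nnorm C_space F \<le> r)"

lemma X_mem: "nset X = T ` K"
  by (simp add: X_def quotient_nspace_def)

lemma norm_nonneg: "F \<in> K \<Longrightarrow> 0 \<le> nnorm C_space F"
  using sn_nonneg[OF seminormed_C K_C] .

lemma K_zero: "0 \<in> K"
proof -
  have "orlicz_unit 0" by (simp add: orlicz_unit_def)
  then obtain F where "F \<in> K" using K_lift by blast
  then show ?thesis using K_scale[of F 0] by simp
qed

lemma T_zero: "T 0 = 0"
  using T_scale[OF K_zero, of 0] by simp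

lemma norm_zero: "nnorm C_space 0 = 0"
  using sn_norm_zero[OF seminormed_C K_C[OF K_zero]] .

lemma X_norm_le: assumes "F \<in> K" shows "nnorm X (T F) \<le> nnorm C_space F"
proof -
  have "bdd_below {nnorm C_space G | G. G \<in> K \<and> T G = T F}" using norm_nonneg by (auto intro!: bdd_belowI)
  then show ?thesis unfolding X_def quotient_nspace_def using assms by (auto intro!: cInf_lower)
qed

lemma X_norm_less: assumes "u \<in> nset X" "nnorm X u < r" shows "\<exists>F\<in>K. T F = u \<and> nnorm C_space F < r"
proof -
  have ne: "{nnorm C_space G | G. G \<in> K \<and> T G = u} \<noteq> {}" using assms(1) by (auto simp: X_mem)
  have "Inf {nnorm C_space G | G. G \<in> K \<and> T G = u} < r" using assms(2) by (simp add: X_def quotient_nspace_def)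
  from cInf_lessD[OF ne this] show ?thesis by blast
qed

lemma X_norm_ge: assumes "u \<in> nset X" "\<And>F. F \<in> K \<Longrightarrow> T F = u \<Longrightarrow> r \<le> nnorm C_space F" shows "r \<le> nnorm X u"
proof (rule ccontr)
  assume "\<not> ?thesis"
  then obtain F where "F \<in> K" "T F = u" "nnorm C_space F < r" using X_norm_less[OF assms(1), of r] by auto
  then show False using assms(2) by force
qed

lemma X_norm_nonneg: "u \<in> nset X \<Longrightarrow> 0 \<le> nnorm X u"
  using X_norm_ge norm_nonneg by blast

text \<open>The value 0 off the space is what membership in the encoded dual demands.\<close>

definition phi :: "nat \<Rightarrow> cseq \<times> cseq \<Rightarrow> complex"
  where "phi i u = (if u \<in> nset X then pr u i else 0)"

lemma phi_T: "F \<in> K \<Longrightarrow> phi i (T F) = Delta 0 F i"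
  by (simp add: phi_def X_mem pr_T)

lemma dual_mem: "f \<in> nset (dual_nspace X) \<longleftrightarrow>
    (\<forall>x\<in>nset X. \<forall>y\<in>nset X. f (x + y) = f x + f y) \<and> (\<forall>a. \<forall>x\<in>nset X. f (a *\<^sub>C x) = a *\<^sub>C f x) \<and>
    (\<exists>B. \<forall>x\<in>nset X. cmod (f x) \<le> B * nnorm X x) \<and> (\<forall>x. x \<notin> nset X \<longrightarrow> f x = 0)"
  by (simp add: dual_nspace_def bounded_clinear_on_def complex_nspace_def conj_assoc)

lemma dual_norm: "nnorm (dual_nspace X) f = (SUP x\<in>{x\<in>nset X. nnorm X x \<le> 1}. cmod (f x))"
  by (simp add: dual_nspace_def)

lemma zero_ball: "0 \<in> {x\<in>nset X. nnorm X x \<le> 1}"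
  using K_zero X_norm_le[OF K_zero] by (force simp: T_zero norm_zero X_mem image_iff)

lemma dual_norm_ge:
  assumes f: "f \<in> nset (dual_nspace X)" and u: "u \<in> nset X" "nnorm X u \<le> 1"
  shows "cmod (f u) \<le> nnorm (dual_nspace X) f"
proof -
  obtain B where B: "\<And>x. x \<in> nset X \<Longrightarrow> cmod (f x) \<le> B * nnorm X x"
    using f unfolding dual_mem by blast
  have "cmod (f x) \<le> \<bar>B\<bar>" if x: "x \<in> nset X" "nnorm X x \<le> 1" for x
  proof -
    have "B * nnorm X x \<le> \<bar>B\<bar> * nnorm X x" using X_norm_nonneg[OF x(1)] by (intro mult_right_mono) auto
    also have "\<dots> \<le> \<bar>B\<bar> * 1" using x by (intro mult_left_mono) auto
    finally show ?thesis using B[OF x(1)] by linarith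
  qed
  then show ?thesis unfolding dual_norm using u by (intro cSUP_upper bdd_aboveI[of _ "\<bar>B\<bar>"]) auto
qed

lemma dual_norm_nonneg: "f \<in> nset (dual_nspace X) \<Longrightarrow> 0 \<le> nnorm (dual_nspace X) f"
  using dual_norm_ge[of f 0] zero_ball norm_ge_zero order_trans by blast

text \<open>The factor 2 pays for representatives: a vector of the closed unit ball has one of norm
  below 2.\<close>

lemma dual_norm_le:
  assumes "\<And>F. F \<in> K \<Longrightarrow> cmod (f (T F)) \<le> s * nnorm C_space F" "s \<ge> 0"
  shows "nnorm (dual_nspace X) f \<le> 2 * s"
  unfolding dual_norm
proof (rule cSUP_least)
  show "{x \<in> nset X. nnorm X x \<le> 1} \<noteq> {}" using zero_ball by blast
  fix u assume "u \<in> {x \<in> nset X. nnorm X x \<le> 1}"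
  then obtain F where F: "F \<in> K" "T F = u" "nnorm C_space F < 2" using X_norm_less[of u 2] by auto
  have "cmod (f u) \<le> s * nnorm C_space F" using assms(1)[OF F(1)] F(2) by simp
  also have "\<dots> \<le> s * 2" using F assms(2) by (intro mult_left_mono) auto
  finally show "cmod (f u) \<le> 2 * s" by simp
qed

lemma phi_dual: "phi i \<in> nset (dual_nspace X)"
  unfolding dual_mem
proof (intro conjI ballI allI impI)
  fix x y assume "x \<in> nset X" "y \<in> nset X"
  then obtain F G where F: "F \<in> K" "x = T F" "G \<in> K" "y = T G" by (auto simp: X_mem)
  then have "phi i (x + y) = Delta 0 (F + G) i" using phi_T[OF K_add] by (simp add: T_add)
  then show "phi i (x + y) = phi i x + phi i y" using F phi_T K_C by (simp add: Delta_add)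
next
  fix a x assume "x \<in> nset X"
  then obtain F where F: "F \<in> K" "x = T F" by (auto simp: X_mem)
  then have "phi i (a *\<^sub>C x) = Delta 0 (a *\<^sub>C F) i" using phi_T[OF K_scale] by (simp add: T_scale)
  then show "phi i (a *\<^sub>C x) = a *\<^sub>C phi i x"
    using F phi_T K_C by (simp add: Delta_scale scaleC_apply)
next
  have "cmod (phi i x) \<le> 256 * nnorm X x" if x: "x \<in> nset X" for x
  proof -
    have "cmod (phi i x) / 256 \<le> nnorm X x"
    proof (rule X_norm_ge[OF x])
      fix F assume F: "F \<in> K" "T F = x"
      have "cmod (Delta 0 F i) \<le> 256 * nnorm C_space F"
        using Delta_l2(1)[OF K_C[OF F(1)]] norm_nonneg[OF F(1)] by (intro l2_le_coord) auto
      then show "cmod (phi i x) / 256 \<le> nnorm C_space F" using phi_T[OF F(1), of i] F(2) by simp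
    qed
    then show ?thesis by simp
  qed
  then show "\<exists>B. \<forall>x\<in>nset X. cmod (phi i x) \<le> B * nnorm X x" by blast
qed (auto simp: phi_def)

text \<open>The sequence with the single entry \<open>exp (-1)\<close> at \<open>i\<close> has
  modular \<open>(2/e)\<^sup>2 \<le> 1\<close>, hence a lift of norm at most 8.\<close>

lemma phi_norm_ge: "exp (-1) / 8 \<le> nnorm (dual_nspace X) (phi i)"
proof -
  define x :: cseq where "x k = (if k = i then exp (-1) else 0)" for k
  have o: "(orl (exp (-1)))\<^sup>2 \<le> 1"
  proof -
    have "orl (exp (-1)) = 2 / exp 1" unfolding orl_def ln_exp by (simp add: exp_minus divide_inverse)
    also have "\<dots> \<le> 2 / (5/2)" using exp_1_ge by (intro divide_left_mono) auto
    finally have "orl (exp (-1)) \<le> 1" by simp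
    moreover have "orl (exp (-1)) \<ge> 0" by (simp add: orl_def)
    ultimately show ?thesis by (simp add: power_le_one)
  qed
  have "orlicz_unit x"
    unfolding orlicz_unit_def
  proof (intro conjI allI impI)
    show "cmod (x k) \<le> exp (-1)" for k by (simp add: x_def)
    fix S :: "nat set" assume S: "finite S"
    have "(\<Sum>k\<in>S. (orl (cmod (x k)))\<^sup>2) = (\<Sum>k\<in>S. if k = i then (orl (exp (-1)))\<^sup>2 else 0)"
      by (intro sum.cong) (auto simp: x_def)
    then show "(\<Sum>k\<in>S. (orl (cmod (x k)))\<^sup>2) \<le> 1" using S o by simp
  qed
  then obtain F where F: "F \<in> K" "nnorm C_space F \<le> 8" "Delta 0 F = x" using K_lift by blast
  let ?G = "(1/8) *\<^sub>C F"
  have G: "?G \<in> K" using K_scale F(1) .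
  have "nnorm C_space ?G \<le> cmod (1/8) * nnorm C_space F" by (rule sn_norm_scale[OF seminormed_C K_C[OF F(1)]])
  then have "nnorm X (T ?G) \<le> 1" using X_norm_le[OF G] F(2) by (simp add: norm_divide)
  then have "cmod (phi i (T ?G)) \<le> nnorm (dual_nspace X) (phi i)"
    using G by (intro dual_norm_ge phi_dual) (auto simp: X_mem)
  moreover have "phi i (T ?G) = exp (-1) / 8"
    using phi_T[OF G, of i] F K_C by (simp add: Delta_scale scaleC_apply scaleC_complex x_def)
  ultimately show ?thesis by (simp add: norm_divide)
qed

lemma dual_add: "f \<in> nset (dual_nspace X) \<Longrightarrow> g \<in> nset (dual_nspace X) \<Longrightarrow> f + g \<in> nset (dual_nspace X)"
  unfolding dual_mem
proof (elim conjE exE, intro conjI)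
  fix B1 B2
  assume B: "\<forall>x\<in>nset X. cmod (f x) \<le> B1 * nnorm X x"
    "\<forall>x\<in>nset X. cmod (g x) \<le> B2 * nnorm X x"
  have "cmod ((f + g) x) \<le> (B1 + B2) * nnorm X x" if "x \<in> nset X" for x
    using norm_triangle_ineq[of "f x" "g x"] B[rule_format, OF that] by (simp add: distrib_right)
  then show "\<exists>B. \<forall>x\<in>nset X. cmod ((f + g) x) \<le> B * nnorm X x" by blast
qed (auto simp: scaleC_complex algebra_simps)

lemma dual_scale: "f \<in> nset (dual_nspace X) \<Longrightarrow> a *\<^sub>C f \<in> nset (dual_nspace X)"
  unfolding dual_mem
proof (elim conjE exE, intro conjI)
  fix B
  assume B: "\<forall>x\<in>nset X. cmod (f x) \<le> B * nnorm X x"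
  have "cmod ((a *\<^sub>C f) x) \<le> (cmod a * B) * nnorm X x" if "x \<in> nset X" for x
    using mult_left_mono[OF B[rule_format, OF that], of "cmod a"]
    by (simp add: scaleC_apply scaleC_complex norm_mult mult.assoc)
  then show "\<exists>B. \<forall>x\<in>nset X. cmod ((a *\<^sub>C f) x) \<le> B * nnorm X x" by blast
qed (auto simp: scaleC_apply scaleC_complex algebra_simps)

lemma dual_sum: "(\<Sum>i\<in>A. e i *\<^sub>C phi i) \<in> nset (dual_nspace X)"
proof (induction A rule: infinite_finite_induct)
  case (infinite A)
  then show ?case using dual_scale[OF phi_dual, of 0] by (simp only: sum.infinite zero_scaleC simp_thms)
next
  case empty
  then show ?case using dual_scale[OF phi_dual, of 0] by (simp only: sum.empty zero_scaleC)
next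
  case (insert a A)
  then show ?case unfolding sum.insert[OF insert(1,2)] by (intro dual_add dual_scale phi_dual)
qed

lemma phi_small:
  assumes d: "d > 0"
  shows "\<exists>n0. \<forall>A e. finite A \<longrightarrow> n0 \<le> card A \<longrightarrow> (\<forall>i. e i \<in> {1, -1}) \<longrightarrow>
    nnorm (dual_nspace X) (\<Sum>i\<in>A. e i *\<^sub>C phi i) \<le> d * sqrt (card A)"
proof -
  \<comment> \<open>102400 is 2 from \<open>dual_norm_le\<close>, times 128 from
    \<open>K_test\<close>, times 400 from \<open>test_le_sign_sum\<close>.\<close>
  define M where "M = max 2 (102400 / d)"
  obtain n0 :: nat where n0: "exp M \<le> real n0" using real_arch_simple by blast
  have "nnorm (dual_nspace X) (\<Sum>i\<in>A. e i *\<^sub>C phi i) \<le> d * sqrt (card A)"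
    if A: "finite A" "n0 \<le> card A" and e: "\<forall>i. e i \<in> {1,-1}" for A e
  proof -
    have "exp M \<le> card A" using n0 A(2) by linarith
    then have lnM: "M \<le> ln (card A)" by (metis exp_gt_zero ln_exp ln_mono)
    have l2: "2 \<le> ln (card A)" using lnM by (simp add: M_def)
    let ?q = "128 * (400 * sqrt (card A) / ln (card A))"
    have "nnorm (dual_nspace X) (\<Sum>i\<in>A. e i *\<^sub>C phi i) \<le> 2 * ?q"
    proof (rule dual_norm_le)
      fix F assume F: "F \<in> K"
      have "cmod (\<Sum>i\<in>A. e i * Delta 0 F i) \<le> 128 * nnorm C_space F * (400 * sqrt (card A) / ln (card A))"
        by (rule test_le_sign_sum[OF K_test[OF F] A(1) l2 e])
      moreover have "(\<Sum>i\<in>A. e i *\<^sub>C phi i) (T F) = (\<Sum>i\<in>A. e i * Delta 0 F i)"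
        by (simp add: sum_fun_apply scaleC_apply scaleC_complex phi_T[OF F])
      ultimately show "cmod ((\<Sum>i\<in>A. e i *\<^sub>C phi i) (T F)) \<le> ?q * nnorm C_space F" by (simp add: mult_ac)
    qed (use l2 in simp)
    also have "\<dots> = (102400 / ln (card A)) * sqrt (card A)" by simp
    also have "\<dots> \<le> d * sqrt (card A)"
    proof (rule mult_right_mono)
      have "102400 / d \<le> ln (card A)" using lnM by (simp add: M_def)
      then show "102400 / ln (card A) \<le> d" using d l2 by (simp add: field_simps)
    qed simp
    finally show ?thesis .
  qed
  then show ?thesis by blast
qed

lemma clinear_sum:
  assumes S: "bounded_clinear_on (dual_nspace X) X S"
  shows "S (\<Sum>i\<in>A. e i *\<^sub>C phi i) = (\<Sum>i\<in>A. e i *\<^sub>C S (phi i))"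
proof -
  have add: "S (f + g) = S f + S g" if "f \<in> nset (dual_nspace X)" "g \<in> nset (dual_nspace X)" for f g
    using S that unfolding bounded_clinear_on_def by blast
  have sc: "S (a *\<^sub>C f) = a *\<^sub>C S f" if "f \<in> nset (dual_nspace X)" for a f
    using S that unfolding bounded_clinear_on_def by blast
  have z: "S 0 = 0" using sc[OF phi_dual, of 0 0] by simp
  show ?thesis
    by (induction A rule: infinite_finite_induct)
      (simp_all only: sum.infinite sum.empty sum.insert simp_thms z add[OF dual_scale[OF phi_dual] dual_sum] sc[OF phi_dual])
qed

text \<open>The \<open>f i\<close> represent the images of \<open>phi i\<close> under the inverse
  \<open>S\<close> of the isomorphism \<open>U\<close>: boundedness of \<open>U\<close> transports
  the lower bound, boundedness of \<open>S\<close> the smallness.\<close>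

lemma isomorphic_dual_sequence:
  assumes "isomorphic_nspace X (dual_nspace X)"
  shows "\<exists>f c. c > 0 \<and> (\<forall>i. f i \<in> K) \<and> (\<forall>i F. F \<in> K \<longrightarrow> T F = T (f i) \<longrightarrow> c \<le> nnorm C_space F) \<and>
    small_sign_sums represented (\<lambda>i. T (f i))"
proof -
  obtain U S where U: "bounded_clinear_on X (dual_nspace X) U" and S: "bounded_clinear_on (dual_nspace X) X S"
    and US: "\<And>y. y \<in> nset (dual_nspace X) \<Longrightarrow> U (S y) = y"
    using assms unfolding isomorphic_nspace_def by blast
  obtain BU where BU: "\<And>x. x \<in> nset X \<Longrightarrow> nnorm (dual_nspace X) (U x) \<le> BU * nnorm X x"
    using U unfolding bounded_clinear_on_def by blast
  obtain BS where BS: "\<And>x. x \<in> nset (dual_nspace X) \<Longrightarrow> nnorm X (S x) \<le> BS * nnorm (dual_nspace X) x"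
    using S unfolding bounded_clinear_on_def by blast
  have Smem: "S x \<in> nset X" if "x \<in> nset (dual_nspace X)" for x
    using S that unfolding bounded_clinear_on_def by blast
  have "\<exists>F. F \<in> K \<and> T F = S (phi i)" for i using Smem[OF phi_dual, of i] unfolding X_mem by auto
  then obtain f where f: "\<And>i. f i \<in> K" "\<And>i. T (f i) = S (phi i)" by metis
  define c where "c = exp (-1) / 8 / (\<bar>BU\<bar> + 1)"
  have c: "c > 0" by (simp add: c_def add_nonneg_pos)
  have low: "c \<le> nnorm C_space F" if F: "F \<in> K" "T F = T (f i)" for F i
  proof -
    have "exp (-1) / 8 \<le> nnorm (dual_nspace X) (U (S (phi i)))" using phi_norm_ge US[OF phi_dual] by simp
    also have "\<dots> \<le> BU * nnorm X (S (phi i))" by (rule BU[OF Smem[OF phi_dual]])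
    also have "\<dots> \<le> (\<bar>BU\<bar> + 1) * nnorm X (S (phi i))"
      using X_norm_nonneg[OF Smem[OF phi_dual]] by (intro mult_right_mono) auto
    also have "\<dots> \<le> (\<bar>BU\<bar> + 1) * nnorm C_space F"
      using X_norm_le[OF F(1)] F(2) f(2)[of i] by (intro mult_left_mono) auto
    finally have "exp (-1) / 8 \<le> nnorm C_space F * (\<bar>BU\<bar> + 1)" by (simp add: mult.commute)
    then show ?thesis unfolding c_def by (subst pos_divide_le_eq) auto
  qed
  have "small_sign_sums represented (\<lambda>i. T (f i))"
    unfolding small_sign_sums_def
  proof (intro allI impI)
    fix d :: real assume d: "d > 0"
    define d' where "d' = d / (2 * (\<bar>BS\<bar> + 1))"
    have d': "d' > 0" "(\<bar>BS\<bar> + 1) * d' = d / 2"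
      using d abs_ge_zero[of BS] by (auto simp: d'_def divide_simps add_nonneg_pos)
    obtain n0 where n0: "\<forall>A e. finite A \<longrightarrow> n0 \<le> card A \<longrightarrow> (\<forall>i. e i \<in> {1, -1}) \<longrightarrow>
      nnorm (dual_nspace X) (\<Sum>i\<in>A. e i *\<^sub>C phi i) \<le> d' * sqrt (card A)" using phi_small[OF d'(1)] by blast
    \<comment> \<open>\<open>Suc n0\<close> keeps \<open>A\<close> nonempty, so the half held back
      in \<open>d'\<close> yields a strict inequality, and a strict bound on the quotient norm
      provides a representative.\<close>
    have "represented (\<Sum>i\<in>A. e i *\<^sub>C T (f i)) (d * sqrt (card A))"
      if A: "finite A" "Suc n0 \<le> card A" and e: "\<forall>i. e i \<in> {1,-1}" for A e
    proof -
      let ?p = "\<Sum>i\<in>A. e i *\<^sub>C phi i"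
      have pn: "nnorm (dual_nspace X) ?p \<le> d' * sqrt (card A)" using n0 A e by auto
      have "nnorm X (S ?p) \<le> BS * nnorm (dual_nspace X) ?p" by (rule BS[OF dual_sum])
      also have "\<dots> \<le> (\<bar>BS\<bar> + 1) * nnorm (dual_nspace X) ?p"
        using dual_norm_nonneg[OF dual_sum] by (intro mult_right_mono) auto
      also have "\<dots> \<le> (\<bar>BS\<bar> + 1) * (d' * sqrt (card A))" using pn by (intro mult_left_mono) auto
      also have "\<dots> = d / 2 * sqrt (card A)" using d'(2) by (simp add: mult.assoc[symmetric])
      also have "\<dots> < d * sqrt (card A)" using d A by (intro mult_strict_right_mono) auto
      finally obtain F where "F \<in> K" "T F = S ?p" "nnorm C_space F < d * sqrt (card A)"
        using X_norm_less[OF Smem[OF dual_sum]] by blast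
      then show ?thesis unfolding represented_def clinear_sum[OF S] f(2) by (intro bexI[of _ F]) auto
    qed
    then show "\<exists>n0. \<forall>A e. finite A \<longrightarrow> n0 \<le> card A \<longrightarrow> (\<forall>i. e i \<in> {1, -1}) \<longrightarrow>
       represented (\<Sum>i\<in>A. e i *\<^sub>C T (f i)) (d * sqrt (card A))" by blast
  qed
  then show ?thesis using c f low by blast
qed

end


section \<open>Passing from the quotient to the kernel of the extension\<close>

lemma small_sign_sums_map:
  assumes u: "small_sign_sums P u" and c: "c > 0"
    and PQ: "\<And>A e r. finite A \<Longrightarrow> P (\<Sum>i\<in>A. e i *\<^sub>C u i) r \<Longrightarrow> Q (\<Sum>i\<in>A. e i *\<^sub>C x i) (c * r)"
  shows "small_sign_sums Q x"
  unfolding small_sign_sums_def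
proof (intro allI impI)
  fix d :: real assume d: "d > 0"
  obtain n0 where n0: "\<forall>A e. finite A \<longrightarrow> n0 \<le> card A \<longrightarrow> (\<forall>i. e i \<in> {1, -1}) \<longrightarrow>
      P (\<Sum>i\<in>A. e i *\<^sub>C u i) (d / c * sqrt (card A))"
    using small_sign_sumsD[OF u, of "d / c"] d c by auto
  have "Q (\<Sum>i\<in>A. e i *\<^sub>C x i) (d * sqrt (card A))"
    if "finite A" "n0 \<le> card A" "\<forall>i. e i \<in> {1,-1}" for A e
  proof -
    have "P (\<Sum>i\<in>A. e i *\<^sub>C u i) (d / c * sqrt (card A))" using n0 that by blast
    from PQ[OF that(1) this] show ?thesis using c by simp
  qed
  then show "\<exists>n0. \<forall>A e. finite A \<longrightarrow> n0 \<le> card A \<longrightarrow> (\<forall>i. e i \<in> {1, -1}) \<longrightarrow>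
      Q (\<Sum>i\<in>A. e i *\<^sub>C x i) (d * sqrt (card A))" by blast
qed

lemma strict_mono_choice:
  fixes P :: "nat \<Rightarrow> nat \<Rightarrow> bool"
  assumes "\<And>j m. \<exists>i\<ge>m. P j i"
  shows "\<exists>g. strict_mono g \<and> (\<forall>j. P j (g j))"
proof -
  have "\<exists>g. \<forall>j. P j (g j) \<and> g j < g (Suc j)"
  proof (rule dependent_nat_choice)
    show "\<exists>i. P 0 i" using assms by blast
    show "\<exists>i'. P (Suc j) i' \<and> i < i'" for i j using assms[where j = "Suc j" and m = "Suc i"] Suc_le_lessD by blast
  qed
  then show ?thesis by (auto simp: strict_mono_Suc_iff)
qed

context calderon_quotient
begin

lemma K_sum: "(\<And>i. i \<in> A \<Longrightarrow> f i \<in> K) \<Longrightarrow> (\<Sum>i\<in>A. e i *\<^sub>C f i) \<in> K"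
proof (induction A rule: infinite_finite_induct)
  case (insert a A)
  then show ?case unfolding sum.insert[OF insert(1,2)] by (intro K_add K_scale) auto
qed (simp_all only: sum.infinite sum.empty K_zero simp_thms)

lemma T_sum: "(\<And>i. i \<in> A \<Longrightarrow> f i \<in> K) \<Longrightarrow> T (\<Sum>i\<in>A. e i *\<^sub>C f i) = (\<Sum>i\<in>A. e i *\<^sub>C T (f i))"
proof (induction A rule: infinite_finite_induct)
  case (insert a A)
  then have H: "T (e a *\<^sub>C f a + (\<Sum>i\<in>A. e i *\<^sub>C f i)) = T (e a *\<^sub>C f a) + T (\<Sum>i\<in>A. e i *\<^sub>C f i)"
    by (intro T_add K_scale K_sum) auto
  then show ?case using insert(3-4) T_scale[of "f a" "e a"] unfolding sum.insert[OF insert(1,2)] H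
    by (simp only: insert_iff simp_thms)
qed (simp_all only: sum.infinite sum.empty T_zero simp_thms)

lemma Delta_sum: "(\<And>i. i \<in> A \<Longrightarrow> f i \<in> K) \<Longrightarrow> m \<le> 2 \<Longrightarrow> Delta m (\<Sum>i\<in>A. e i *\<^sub>C f i) = (\<Sum>i\<in>A. e i *\<^sub>C Delta m (f i))"
proof (induction A rule: infinite_finite_induct)
  case (insert a A)
  then have H: "Delta m (e a *\<^sub>C f a + (\<Sum>i\<in>A. e i *\<^sub>C f i)) = Delta m (e a *\<^sub>C f a) + Delta m (\<Sum>i\<in>A. e i *\<^sub>C f i)"
    by (intro Delta_add K_C K_scale K_sum) auto
  then show ?case using insert(3-5) Delta_scale[OF K_C, of "f a" m "e a"] unfolding sum.insert[OF insert(1,2)] H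
    by (simp only: insert_iff simp_thms)
next
  case empty
  then show ?case using Delta_scale[OF K_C[OF K_zero], of m 0] by (simp only: sum.empty zero_scaleC)
next
  case (infinite A)
  then show ?case using Delta_scale[OF K_C[OF K_zero], of m 0] by (simp only: sum.infinite zero_scaleC simp_thms)
qed

lemma K_uminus: "F \<in> K \<Longrightarrow> - F \<in> K" and T_uminus: "F \<in> K \<Longrightarrow> T (- F) = - T F"
  using K_scale[of F "-1"] T_scale[of F "-1"] by (simp_all add: minus_one_scaleC)

lemma K_diff: "F \<in> K \<Longrightarrow> G \<in> K \<Longrightarrow> F - G \<in> K"
  and T_diff: "F \<in> K \<Longrightarrow> G \<in> K \<Longrightarrow> T (F - G) = T F - T G"
  using K_add[of F "- G"] K_uminus[of G] T_add[of F "- G"] T_uminus[of G] by simp_all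

lemma Delta_diff: "F \<in> K \<Longrightarrow> G \<in> K \<Longrightarrow> m \<le> 2 \<Longrightarrow> Delta m (F - G) = Delta m F - Delta m G"
  using Delta_add[of F "- G" m] Delta_scale[of G m "-1"] K_C K_uminus[of G] by (simp add: minus_one_scaleC)

text \<open>The subtracted functions have norms summing to at most 2, which
  \<open>d / 2 * sqrt n\<close> absorbs once \<open>sqrt n \<ge> 4 / d\<close>. Signs on the
  subsequence are carried back along the injective \<open>g\<close>.\<close>

lemma perturbation:
  assumes f: "\<And>i. f i \<in> K" and sm: "small_sign_sums represented (\<lambda>i. T (f i))"
    and g: "strict_mono g" and G: "\<And>j. G j \<in> K" "\<And>j. nnorm C_space (G j) \<le> (1/2) ^ j"
  shows "small_sign_sums represented (\<lambda>j. T (f (g j) - G j))"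
  unfolding small_sign_sums_def
proof (intro allI impI)
  fix d :: real assume d: "d > 0"
  obtain n0 where n0: "\<forall>A e. finite A \<longrightarrow> n0 \<le> card A \<longrightarrow> (\<forall>i. e i \<in> {1, -1}) \<longrightarrow>
      represented (\<Sum>i\<in>A. e i *\<^sub>C T (f i)) (d / 2 * sqrt (card A))"
    using small_sign_sumsD[OF sm, of "d / 2"] d by auto
  obtain n1 :: nat where n1: "(4 / d)\<^sup>2 \<le> real n1" using real_arch_simple by blast
  have gi: "inj g" using g strict_mono_imp_inj_on by blast
  have "represented (\<Sum>j\<in>A. e j *\<^sub>C T (f (g j) - G j)) (d * sqrt (card A))"
    if A: "finite A" "max n0 n1 \<le> card A" and e: "\<forall>i. e i \<in> {1,-1}" for A and e :: "nat \<Rightarrow> complex"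
  proof -
    define e' where "e' i = (if i \<in> range g then e (inv g i) else 1)" for i
    have e': "\<forall>i. e' i \<in> {1,-1}" using e by (auto simp: e'_def)
    have c: "card (g ` A) = card A" using gi by (intro card_image) (auto intro: inj_on_subset)
    have "represented (\<Sum>i\<in>g ` A. e' i *\<^sub>C T (f i)) (d / 2 * sqrt (card A))"
      using n0[rule_format, of "g ` A" e'] A e' c by auto
    moreover have "(\<Sum>i\<in>g ` A. e' i *\<^sub>C T (f i)) = (\<Sum>j\<in>A. e j *\<^sub>C T (f (g j)))"
    proof (subst sum.reindex)
      show "inj_on g A" using gi by (auto intro: inj_on_subset)
      show "sum ((\<lambda>i. e' i *\<^sub>C T (f i)) \<circ> g) A = (\<Sum>j\<in>A. e j *\<^sub>C T (f (g j)))"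
        using gi by (intro sum.cong) (auto simp: e'_def)
    qed
    ultimately obtain H where H: "H \<in> K" "T H = (\<Sum>j\<in>A. e j *\<^sub>C T (f (g j)))"
        "nnorm C_space H \<le> d / 2 * sqrt (card A)"
      unfolding represented_def by auto
    let ?G = "\<Sum>j\<in>A. e j *\<^sub>C G j"
    have GK: "?G \<in> K" using G by (intro K_sum)
    have ne: "cmod (e j) = 1" for j using e[rule_format, of j] by auto
    have "nnorm C_space ?G \<le> (\<Sum>j\<in>A. nnorm C_space (e j *\<^sub>C G j))"
      using G K_scale K_C by (intro sn_norm_sum[OF seminormed_C _ K_C[OF K_zero]]) auto
    also have "\<dots> \<le> (\<Sum>j\<in>A. (1/2) ^ j)"
    proof (rule sum_mono)
      fix j
      show "nnorm C_space (e j *\<^sub>C G j) \<le> (1/2) ^ j"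
        using sn_norm_scale[OF seminormed_C K_C[OF G(1)[of j]], of "e j"] G(2)[of j] by (simp add: ne)
    qed
    also have "\<dots> \<le> (\<Sum>j. (1/2) ^ j)" using A(1) by (intro sum_le_suminf summable_geometric) auto
    also have "\<dots> = 2" using suminf_geometric[of "1/2::real"] by simp
    finally have nG: "nnorm C_space ?G \<le> 2" .
    have "sqrt ((4 / d)\<^sup>2) \<le> sqrt (card A)" using n1 A(2) by (intro real_sqrt_le_mono) linarith
    then have "4 / d \<le> sqrt (card A)" using d by simp
    then have "2 \<le> d / 2 * sqrt (card A)" using d by (simp add: field_simps)
    then have "nnorm C_space (H - ?G) \<le> d * sqrt (card A)"
      using sn_tri_diff[OF seminormed_C K_C[OF H(1)] K_C[OF GK]] H(3) nG by simp
    moreover have "T (H - ?G) = (\<Sum>j\<in>A. e j *\<^sub>C T (f (g j) - G j))"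
    proof -
      have "T (H - ?G) = (\<Sum>j\<in>A. e j *\<^sub>C T (f (g j))) - (\<Sum>j\<in>A. e j *\<^sub>C T (G j))"
        using T_diff[OF H(1) GK] H(2) T_sum[of A G e] G by simp
      also have "\<dots> = T (\<Sum>j\<in>A. e j *\<^sub>C f (g j)) - T ?G" using T_sum[of A "\<lambda>j. f (g j)" e] T_sum[of A G e] f G by simp
      also have "\<dots> = T ((\<Sum>j\<in>A. e j *\<^sub>C f (g j)) - ?G)" using T_diff[OF K_sum GK, of A "\<lambda>j. f (g j)" e] f by simp
      also have "(\<Sum>j\<in>A. e j *\<^sub>C f (g j)) - ?G = (\<Sum>j\<in>A. e j *\<^sub>C (f (g j) - G j))"
      proof -
        have "a *\<^sub>C (x - y) = a *\<^sub>C x - a *\<^sub>C y" for a and x y :: "complex \<Rightarrow> cseq"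
          using scaleC_add_right[of a "x - y" y] by (simp add: eq_diff_eq)
        then show ?thesis by (simp only: sum_subtractf)
      qed
      also have "T \<dots> = (\<Sum>j\<in>A. e j *\<^sub>C T (f (g j) - G j))" using f G by (intro T_sum K_diff)
      finally show ?thesis .
    qed
    ultimately show ?thesis unfolding represented_def using K_diff[OF H(1) GK] by blast
  qed
  then show "\<exists>n0. \<forall>A e. finite A \<longrightarrow> n0 \<le> card A \<longrightarrow> (\<forall>i. e i \<in> {1, -1}) \<longrightarrow>
      represented (\<Sum>j\<in>A. e j *\<^sub>C T (f (g j) - G j)) (d * sqrt (card A))" by blast
qed

text \<open>A representative \<open>F\<close> of a sign sum need not be the sum of the
  \<open>f i\<close>, but by \<open>Q\<close> it has the same \<open>Delta m\<close>. The side
  condition in \<open>P\<close> passes on that \<open>Delta 0 F\<close> vanishes if every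
  \<open>Delta 0 (f i)\<close> does, as needed on the kernel.\<close>

lemma represented_Delta:
  assumes f: "\<And>i. f i \<in> K" and sm: "small_sign_sums represented (\<lambda>i. T (f i))" and c: "c > 0"
    and Q: "\<And>F G. F \<in> K \<Longrightarrow> G \<in> K \<Longrightarrow> T F = T G \<Longrightarrow> Delta m F = Delta m G" and m: "m \<le> 2"
    and P: "\<And>F r. F \<in> K \<Longrightarrow> ((\<And>i. Delta 0 (f i) = 0) \<Longrightarrow> Delta 0 F = 0) \<Longrightarrow>
      P (Delta m F) (c * nnorm C_space F)"
    and mono: "\<And>s r r'. P s r \<Longrightarrow> r \<le> r' \<Longrightarrow> 0 \<le> r \<Longrightarrow> P s r'"
  shows "small_sign_sums P (\<lambda>i. Delta m (f i))"
proof (rule small_sign_sums_map[OF sm c])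
  fix A r and e :: "nat \<Rightarrow> complex" assume A: "finite A" "represented (\<Sum>i\<in>A. e i *\<^sub>C T (f i)) r"
  then obtain F where F: "F \<in> K" "T F = (\<Sum>i\<in>A. e i *\<^sub>C T (f i))" "nnorm C_space F \<le> r"
    unfolding represented_def by blast
  let ?G = "\<Sum>i\<in>A. e i *\<^sub>C f i"
  have G: "?G \<in> K" using f by (intro K_sum)
  have TG: "T F = T ?G" using F(2) T_sum[of A f e] f by simp
  have "Delta m F = (\<Sum>i\<in>A. e i *\<^sub>C Delta m (f i))"
    using Q[OF F(1) G TG] Delta_sum[of A f m e] f m by simp
  moreover have "Delta 0 F = 0" if "\<And>i. Delta 0 (f i) = 0"
  proof -
    have "Delta 0 F = Delta 0 ?G" using pr_T[OF F(1)] pr_T[OF G] TG by simp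
    also have "\<dots> = (\<Sum>i\<in>A. e i *\<^sub>C Delta 0 (f i))" using Delta_sum[of A f 0 e] f by simp
    finally show ?thesis using that by simp
  qed
  then have "P (Delta m F) (c * nnorm C_space F)" by (rule P[OF F(1)])
  then have "P (Delta m F) (c * r)"
    by (rule mono) (use c F norm_nonneg in \<open>auto intro: mult_left_mono\<close>)
  ultimately show "P (\<Sum>i\<in>A. e i *\<^sub>C Delta m (f i)) (c * r)" by simp
qed

lemma lift_scaled:
  assumes "orlicz_unit (of_real c *\<^sub>C x)" "c > 0" and L: "\<And>x. orlicz_unit x \<Longrightarrow> \<exists>F\<in>K. nnorm C_space F \<le> 8 \<and> R F x"
    and R: "\<And>F a. F \<in> K \<Longrightarrow> R F (of_real c *\<^sub>C x) \<Longrightarrow> R (of_real (1 / c) *\<^sub>C F) x"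
  shows "\<exists>F\<in>K. nnorm C_space F \<le> 8 / c \<and> R F x"
proof -
  obtain F where F: "F \<in> K" "nnorm C_space F \<le> 8" "R F (of_real c *\<^sub>C x)" using L assms(1) by blast
  have "nnorm C_space (of_real (1 / c) *\<^sub>C F) \<le> cmod (of_real (1 / c)) * nnorm C_space F"
    by (rule sn_norm_scale[OF seminormed_C K_C[OF F(1)]])
  also have "\<dots> \<le> 8 / c" using F(2) \<open>c > 0\<close> by (simp add: norm_divide field_simps)
  finally show ?thesis using R[OF F(1,3)] K_scale[OF F(1)] by blast
qed

text \<open>\<open>ker\<close> asks that small sequences in the kernel have arbitrarily small norms
  arbitrarily far out; the Orlicz argument for \<open>Delta 0\<close> reduces the general case to
  it.\<close>

lemma not_isomorphic_dual:
  assumes ker: "\<And>f \<theta> J. (\<And>j. f j \<in> K) \<Longrightarrow> (\<And>j. Delta 0 (f j) = 0) \<Longrightarrow>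
      small_sign_sums represented (\<lambda>j. T (f j)) \<Longrightarrow> \<theta> > 0 \<Longrightarrow>
      \<exists>j\<ge>J. \<exists>F\<in>K. T F = T (f j) \<and> nnorm C_space F \<le> \<theta>"
  shows "\<not> isomorphic_nspace X (dual_nspace X)"
proof
  assume "isomorphic_nspace X (dual_nspace X)"
  then obtain f c where c: "c > 0" and f: "\<And>i. f i \<in> K"
    and low: "\<And>i F. F \<in> K \<Longrightarrow> T F = T (f i) \<Longrightarrow> c \<le> nnorm C_space F"
    and sm: "small_sign_sums represented (\<lambda>i. T (f i))"
    using isomorphic_dual_sequence by blast
  have det: "Delta 0 F = Delta 0 G" if "F \<in> K" "G \<in> K" "T F = T G" for F G
    using pr_T[OF that(1)] pr_T[OF that(2)] that(3) by simp
  have l2: "small_sign_sums l2_le (\<lambda>i. Delta 0 (f i))"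
  proof (rule represented_Delta[OF f sm, of 256])
    show "l2_le (Delta 0 F) (256 * nnorm C_space F)" if "F \<in> K" for F using Delta_l2(1)[OF K_C[OF that]] .
  qed (simp | erule (2) det | erule (2) l2_le_mono)+
  have te: "small_sign_sums test_le (\<lambda>i. Delta 0 (f i))"
  proof (rule represented_Delta[OF f sm, of 128])
    show "test_le (Delta 0 F) (128 * nnorm C_space F)" if "F \<in> K" for F using K_test[OF that] .
  qed (simp | erule (2) det | erule (1) test_le_mono)+
  have "\<exists>i\<ge>m. \<exists>G\<in>K. nnorm C_space G \<le> (1/2) ^ j \<and> Delta 0 G = Delta 0 (f i)" for j m
  proof -
    \<comment> \<open>Scaling by \<open>8 * 2 ^ j\<close> turns the lifting constant 8 into the
      bound \<open>(1/2) ^ j\<close> required by \<open>perturbation\<close>.\<close>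
    have p: "8 * 2 ^ j > (0::real)" by simp
    obtain i where i: "i \<ge> m" "orlicz_unit (of_real (8 * 2 ^ j) *\<^sub>C Delta 0 (f i))"
      using orlicz_unit_frequently[OF l2 te p, of m] by blast
    have "\<exists>G\<in>K. nnorm C_space G \<le> 8 / (8 * 2 ^ j) \<and> Delta 0 G = Delta 0 (f i)"
      using i(2) p K_lift
    proof (rule lift_scaled)
      show "Delta 0 (of_real (1 / (8 * 2 ^ j)) *\<^sub>C F) = Delta 0 (f i)"
        if "F \<in> K" "Delta 0 F = of_real (8 * 2 ^ j) *\<^sub>C Delta 0 (f i)" for F
        using that K_C by (simp add: Delta_scale scaleC_scaleC scaleC_one)
    qed
    then show ?thesis using i(1) by (auto simp: power_one_over)
  qed
  then obtain g where g: "strict_mono g"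
    "\<And>j. \<exists>G\<in>K. nnorm C_space G \<le> (1/2) ^ j \<and> Delta 0 G = Delta 0 (f (g j))"
    using strict_mono_choice[of "\<lambda>j i. \<exists>G\<in>K. nnorm C_space G \<le> (1/2) ^ j \<and> Delta 0 G = Delta 0 (f i)"] by blast
  then have "\<forall>j. \<exists>G. G \<in> K \<and> nnorm C_space G \<le> (1/2) ^ j \<and> Delta 0 G = Delta 0 (f (g j))" by blast
  from choice[OF this] obtain G where G: "\<And>j. G j \<in> K" "\<And>j. nnorm C_space (G j) \<le> (1/2) ^ j"
    "\<And>j. Delta 0 (G j) = Delta 0 (f (g j))" by blast
  have sm': "small_sign_sums represented (\<lambda>j. T (f (g j) - G j))"
    by (rule perturbation[OF f sm g(1) G(1,2)])
  obtain J where J: "(1/2) ^ J < c / 2" using real_arch_pow_inv[of "c/2" "1/2"] c by auto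
  have "\<exists>j\<ge>J. \<exists>F\<in>K. T F = T (f (g j) - G j) \<and> nnorm C_space F \<le> c / 2"
  proof (rule ker)
    show "f (g j) - G j \<in> K" for j by (rule K_diff[OF f G(1)])
    show "Delta 0 (f (g j) - G j) = 0" for j using Delta_diff[OF f G(1)] G(3) by simp
  qed (use sm' c in auto)
  then obtain j F where j: "j \<ge> J" and F: "F \<in> K" "T F = T (f (g j) - G j)" "nnorm C_space F \<le> c / 2"
    by blast
  \<comment> \<open>Adding the lift back represents the original term with norm below
    \<open>c\<close>, against the lower bound.\<close>
  have "T (F + G j) = T (f (g j))" using T_add[OF F(1) G(1)] F(2) T_diff[OF f G(1)] by simp
  then have "c \<le> nnorm C_space (F + G j)" using low K_add[OF F(1) G(1)] by blast
  also have "\<dots> \<le> c / 2 + (1/2) ^ j"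
    using sn_tri[OF seminormed_C K_C[OF F(1)] K_C[OF G(1)[of j]]] F(3) G(2)[of j] by linarith
  also have "\<dots> \<le> c / 2 + (1/2) ^ J" using j by (intro add_left_mono power_decreasing) auto
  finally show False using J by simp
qed

end

section \<open>The two spaces\<close>

interpretation wedge: calderon_quotient "ker_Delta 1" "Delta_pair 2 0" snd
proof
  show "orlicz_unit x \<Longrightarrow> \<exists>F\<in>ker_Delta 1. nnorm C_space F \<le> 8 \<and> Delta 0 F = x" for x
    using upper_orl(1)[of x] by (auto simp: ker_Delta_def)
qed (auto simp: ker_Delta_def C_add C_scale Delta_add Delta_scale Delta_pair_def scaleC_prod_def Delta_test)

interpretation circ: calderon_quotient "ker_Delta 2" "Delta_pair 0 1" fst
proof
  show "orlicz_unit x \<Longrightarrow> \<exists>F\<in>ker_Delta 2. nnorm C_space F \<le> 8 \<and> Delta 0 F = x" for x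
    using upper_orl(2)[of x] by (auto simp: ker_Delta_def)
qed (auto simp: ker_Delta_def C_add C_scale Delta_add Delta_scale Delta_pair_def scaleC_prod_def Delta_test)

text \<open>On the kernel \<open>Delta 0\<close> and \<open>Delta 1\<close> vanish, so
  \<open>Delta 2\<close> ranges over \<open>l2\<close> with equivalent norm by
  \<open>Delta_l2\<close> and \<open>upper_l2\<close>, and \<open>l2_small_tendsto_0\<close>
  applies.\<close>

lemma wedge_not_isomorphic_dual: "\<not> isomorphic_nspace wedge_space (dual_nspace wedge_space)"
proof -
  have "\<exists>j\<ge>J. \<exists>F\<in>ker_Delta 1. Delta_pair 2 0 F = Delta_pair 2 0 (f j) \<and> nnorm C_space F \<le> \<theta>"
    if f: "\<And>j. f j \<in> ker_Delta 1" and 0: "\<And>j. Delta 0 (f j) = 0"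
      and sm: "small_sign_sums wedge.represented (\<lambda>j. Delta_pair 2 0 (f j))" and th: "\<theta> > 0" for f \<theta> J
  proof -
    have "small_sign_sums l2_le (\<lambda>j. Delta 2 (f j))"
      by (rule wedge.represented_Delta[OF f sm, of 256])
        (use 0 in \<open>auto simp: Delta_pair_def ker_Delta_def simp del: One_nat_def intro: Delta_l2(3) l2_le_mono\<close>)
    then obtain i0 where i0: "\<forall>i\<ge>i0. l2_le (Delta 2 (f i)) (\<theta> / 8)" using l2_small_tendsto_0[of _ "\<theta> / 8"] th by auto
    let ?j = "max i0 J"
    obtain F where F: "F \<in> nset C_space" "nnorm C_space F \<le> 8 * (\<theta> / 8)" "Delta 0 F = 0" "Delta 1 F = 0"
      "Delta 2 F = Delta 2 (f ?j)"
      using upper_l2[of "Delta 2 (f ?j)" "\<theta> / 8"] i0 th by auto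
    then show ?thesis using 0[of ?j]
      by (intro exI[of _ ?j] conjI bexI[of _ F]) (auto simp: ker_Delta_def Delta_pair_def)
  qed
  then have "\<not> isomorphic_nspace wedge.X (dual_nspace wedge.X)" by (rule wedge.not_isomorphic_dual)
  then show ?thesis unfolding wedge.X_def wedge_space_def .
qed

text \<open>On the kernel \<open>Delta 0\<close> and \<open>Delta 2\<close> vanish, and
  \<open>Delta 1\<close> obeys the same Orlicz estimates as \<open>Delta 0\<close> did in the
  quotient, so \<open>orlicz_unit_frequently\<close> is used a second time.\<close>

lemma circ_not_isomorphic_dual: "\<not> isomorphic_nspace circ_space (dual_nspace circ_space)"
proof -
  have "\<exists>j\<ge>J. \<exists>F\<in>ker_Delta 2. Delta_pair 0 1 F = Delta_pair 0 1 (f j) \<and> nnorm C_space F \<le> \<theta>"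
    if f: "\<And>j. f j \<in> ker_Delta 2" and 0: "\<And>j. Delta 0 (f j) = 0"
      and sm: "small_sign_sums circ.represented (\<lambda>j. Delta_pair 0 1 (f j))" and th: "\<theta> > 0" for f \<theta> J
  proof -
    have l2: "small_sign_sums l2_le (\<lambda>j. Delta 1 (f j))"
      by (rule circ.represented_Delta[OF f sm, of 256])
        (use 0 in \<open>auto simp: Delta_pair_def ker_Delta_def simp del: One_nat_def intro: Delta_l2(2) l2_le_mono\<close>)
    have te: "small_sign_sums test_le (\<lambda>j. Delta 1 (f j))"
      by (rule circ.represented_Delta[OF f sm, of 128])
        (use 0 in \<open>auto simp: Delta_pair_def ker_Delta_def simp del: One_nat_def intro: Delta_test(3) test_le_mono\<close>)
    have p: "8 / \<theta> > 0" using th by simp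
    obtain j where j: "j \<ge> J" "orlicz_unit (of_real (8 / \<theta>) *\<^sub>C Delta 1 (f j))"
      using orlicz_unit_frequently[OF l2 te p, of J] by blast
    have "\<exists>F\<in>ker_Delta 2. nnorm C_space F \<le> 8 / (8 / \<theta>) \<and> (Delta 0 F = 0 \<and> Delta 1 F = Delta 1 (f j))"
      using j(2) p
    proof (rule circ.lift_scaled)
      show "\<exists>F\<in>ker_Delta 2. nnorm C_space F \<le> 8 \<and> (Delta 0 F = 0 \<and> Delta 1 F = x)" if "orlicz_unit x" for x
        using upper_orl(3)[OF that] by (auto simp: ker_Delta_def)
      show "Delta 0 (of_real (1 / (8 / \<theta>)) *\<^sub>C F) = 0 \<and> Delta 1 (of_real (1 / (8 / \<theta>)) *\<^sub>C F) = Delta 1 (f j)"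
        if "F \<in> ker_Delta 2" "Delta 0 F = 0 \<and> Delta 1 F = of_real (8 / \<theta>) *\<^sub>C Delta 1 (f j)" for F
        using that th by (auto simp: ker_Delta_def Delta_scale scaleC_scaleC scaleC_one simp del: One_nat_def)
    qed
    then obtain F where F: "F \<in> ker_Delta 2" "nnorm C_space F \<le> \<theta>" "Delta 0 F = 0" "Delta 1 F = Delta 1 (f j)"
      using th by auto
    then show ?thesis using 0[of j] j(1)
      by (intro exI[of _ j] conjI bexI[of _ F]) (auto simp: Delta_pair_def)
  qed
  then have "\<not> isomorphic_nspace circ.X (dual_nspace circ.X)" by (rule circ.not_isomorphic_dual)
  then show ?thesis unfolding circ.X_def circ_space_def .
qed

theorem proposition7p11:
  "\<not> isomorphic_nspace wedge_space (dual_nspace wedge_space) \<and>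
   \<not> isomorphic_nspace circ_space (dual_nspace circ_space)"
  using wedge_not_isomorphic_dual circ_not_isomorphic_dual by blast

end
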